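(* Let $\mathbf P$ be an irreducible $s\times s$ stochastic matrix, let $\mathcal P_{\rm st}$ be the set of $s\times s$ stochastic matrices, and let $\mathcal U\subset\mathbb R^{s\times s}$ be an open neighbourhood of $\mathbf P$. Let $\phi:\mathcal U\cap\mathcal P_{\rm st}\to\mathcal Y$ be a functional defined on stochastic matrices, where $\mathcal Y$ is a finite-dimensional normed space. Suppose that there exists a map $\Phi:\mathcal U\to\mathcal Y$ such that $\Phi(\mathbf Q)=\phi(\mathbf Q)$ for every $\mathbf Q\in\mathcal U\cap\mathcal P_{\rm st}$. Let $\widehat{\mathbf P}(n)$ be the maximum likelihood estimator of $\mathbf P$, set $\mathbf W_n=\sqrt n\{\widehat{\mathbf P}(n)-\mathbf P\}$, and let $\mathbf W_{\mathbf P}$ be the Gaussian matrix and $\mathcal T_{\mathbf P}$ the tangent space defined in the context. If $\Phi$ is continuous at $\mathbf P$, then $$\phi(\widehat{\mathbf P}(n))\to\phi(\mathbf P)\quad\text{almost surely},$$ where the plug-in estimator may be defined arbitrarily before all rows have been observed. In particular, this convergence holds under each of the differentiability assumptions below. The following assertions also hold. (i) If $\Phi$ is Fréchet differentiable at $\mathbf P$, then $$\sqrt n\{\phi(\widehat{\mathbf P}(n))-\phi(\mathbf P)\}\xrightarrow{d}\Phi'_{\mathbf P}(\mathbf W_{\mathbf P}).$$ (ii) If $\Phi$ is $r$ times continuously Fréchet differentiable on $\mathcal U$, with $r\ge2$, then $$\phi(\widehat{\mathbf P}(n))=\phi(\mathbf P)+\sum_{j=1}^{r}\frac{1}{j!\,n^{j/2}}\Phi^{(j)}_{\mathbf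 P}(\mathbf W_n,\ldots,\mathbf W_n)+o_p(n^{-r/2}).$$ Moreover, for every $m=1,\ldots,r$, $$n^{m/2}\Big\{\phi(\widehat{\mathbf P}(n))-\phi(\mathbf P)-\sum_{j=1}^{m-1}\frac{1}{j!\,n^{j/2}}\Phi^{(j)}_{\mathbf P}(\mathbf W_n,\ldots,\mathbf W_n)\Big\}\xrightarrow{d}\frac1{m!}\Phi^{(m)}_{\mathbf P}(\mathbf W_{\mathbf P},\ldots,\mathbf W_{\mathbf P}),$$ where the sum is empty when $m=1$. (iii) If $\Phi$ is real analytic in a neighbourhood of $\mathbf P$ contained in $\mathcal U$, then there exists an open neighbourhood $\mathcal V\subset\mathcal U$ of $\mathbf P$ such that, on the event $\{\widehat{\mathbf P}(n)\in\mathcal V\cap\mathcal P_{\rm st}\}$, $$\phi(\widehat{\mathbf P}(n))=\phi(\mathbf P)+\sum_{j\ge1}\frac{1}{j!\,n^{j/2}}\Phi^{(j)}_{\mathbf P}(\mathbf W_n,\ldots,\mathbf W_n),$$ where the series converges absolutely. The probability of this event tends to one. Consequently, for every fixed $r\ge1$, $$\phi(\widehat{\mathbf P}(n))=\phi(\mathbf P)+\sum_{j=1}^{r}\frac{1}{j!\,n^{j/2}}\Phi^{(j)}_{\mathbf P}(\mathbf W_n,\ldots,\mathbf W_n)+O_p(n^{-(r+1)/2}).$$ (iv) If, for some integer $r\ge1$, two $C^r$ maps $\Phi_1$ and $\Phi_2$ represent the same stochastic functional $\phi$ on $\mathcal U\cap\mathcal P_{\rm st}$ (that is, both coincide with $\phi$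 there), then, for every $j=1,\ldots,r$, $$\Phi^{(j)}_{1,\mathbf P}(\mathbf H_1,\ldots,\mathbf H_j)=\Phi^{(j)}_{2,\mathbf P}(\mathbf H_1,\ldots,\mathbf H_j),\qquad \mathbf H_1,\ldots,\mathbf H_j\in\mathcal T_{\mathbf P}.$$ Consequently, the terms in the limits and expansions displayed in (i), (ii) and (iii), whenever evaluated on $\mathbf W_n$ or $\mathbf W_{\mathbf P}$, do not depend on the chosen differentiable matrix representation of $\phi$.
   Context: $(X_m)_{m\ge0}$ is a time-homogeneous Markov chain on $S=\{1,\ldots,s\}$ with irreducible transition matrix $\mathbf P=(p_{ij})$ and stationary row vector $\boldsymbol\pi=(\pi_1,\ldots,\pi_s)$, observed along a single trajectory until time $n$. $N_{ij}(n)$ is the number of transitions from $i$ to $j$, $N_i(n)$ is the number of one-step transitions departing from $i$, and $\widehat{\mathbf P}(n)=(\widehat p_{ij}(n))$ is the non-parametric maximum likelihood estimator, $\widehat p_{ij}(n)=N_{ij}(n)/N_i(n)$, with the convention that rows not yet visited are null. All limits are as $n\to\infty$; $\xrightarrow{d}$ is convergence in distribution, and $o_p$, $O_p$ are the usual stochastic order symbols. $\mathbf W_{\mathbf P}=(W_{ij})$ is the centered Gaussian random $s\times s$ matrix with $\operatorname{Cov}(W_{ij},W_{kl})=\delta_{ik}\pi_i^{-1}p_{ij}(\delta_{jl}-p_{il})$; it is the limit in distribution of $\mathbf W_n$. $\mathcal T_{\mathbf P}=\{\mathbf H\in\mathbb R^{s\times s}:\mathbf H\mathbf 1_s=\mathbf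 0_s,\ h_{ij}=0\text{ whenever }p_{ij}=0\}$, where $\mathbf 1_s=(1,\ldots,1)^\top$. $\Phi'_{\mathbf P}=\Phi^{(1)}_{\mathbf P}$ denotes the Fréchet derivative of $\Phi$ at $\mathbf P$, and $\Phi^{(j)}_{\mathbf P}(\mathbf H_1,\ldots,\mathbf H_j)$ the $j$-th Fréchet differential of $\Phi$ at $\mathbf P$ (a $j$-linear map).
   Formalization: In the last sentence of (iv), independence of the terms evaluated on W_n is claimed almost surely and only at times n when all rows have been observed (the estimator is a stochastic matrix); with unvisited rows null, W_n need not be tangent and the terms can differ. *)

theory Defs
  imports "HOL-Probability.Probability"
begin

section \<open>Finite Markov chains\<close>

definition stochastic_matrices :: "(real^'s^'s::finite) set" where
  "stochastic_matrices = {Q. (\<forall>i j. 0 \<le> Q $ i $ j) \<and> (\<forall>i. (\<Sum>j\<in>UNIV. Q $ i $ j) = 1)}"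

definition matrix_power :: "real^'s^'s \<Rightarrow> nat \<Rightarrow> real^'s^'s::finite" where
  "matrix_power A m = (((**) A) ^^ m) (mat 1)"

definition irreducible_matrix :: "real^'s^'s::finite \<Rightarrow> bool" where
  "irreducible_matrix A \<longleftrightarrow> (\<forall>i j. \<exists>m. matrix_power A m $ i $ j > 0)"

definition stationary_vector :: "real^'s^'s \<Rightarrow> real^'s::finite \<Rightarrow> bool" where
  "stationary_vector P \<pi> \<longleftrightarrow>
     (\<forall>i. 0 \<le> \<pi> $ i) \<and> (\<Sum>i\<in>UNIV. \<pi> $ i) = 1 \<and> \<pi> v* P = \<pi>"

text \<open>The initial distribution is unrestricted.\<close>

definition markov_chain :: "'a measure \<Rightarrow> (nat \<Rightarrow> 'a \<Rightarrow> 's::finite) \<Rightarrow> real^'s^'s \<Rightarrow> bool" where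
  "markov_chain M X P \<longleftrightarrow>
     prob_space M \<and>
     (\<forall>m. X m \<in> measurable M (count_space UNIV)) \<and>
     (\<forall>m x j. \<P>(\<omega> in M. \<forall>k\<le>m. X k \<omega> = x k) > 0 \<longrightarrow>
        \<P>(\<omega> in M. X (Suc m) \<omega> = j \<bar> \<forall>k\<le>m. X k \<omega> = x k) = P $ x m $ j)"

definition transition_count :: "(nat \<Rightarrow> 'a \<Rightarrow> 's) \<Rightarrow> nat \<Rightarrow> 'a \<Rightarrow> 's \<Rightarrow> 's \<Rightarrow> nat" where
  "transition_count X n \<omega> i j = card {m. m < n \<and> X m \<omega> = i \<and> X (Suc m) \<omega> = j}"

definition departure_count :: "(nat \<Rightarrow> 'a \<Rightarrow> 's) \<Rightarrow> nat \<Rightarrow> 'a \<Rightarrow> 's \<Rightarrow> nat" where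
  "departure_count X n \<omega> i = card {m. m < n \<and> X m \<omega> = i}"

text \<open>Since \<open>x / 0 = 0\<close>, the row of a state that has not been left before time \<open>n\<close> is null;
  hence the estimator lies in \<^const>\<open>stochastic_matrices\<close> exactly when all rows have been observed.\<close>

definition mle :: "(nat \<Rightarrow> 'a \<Rightarrow> 's) \<Rightarrow> nat \<Rightarrow> 'a \<Rightarrow> real^'s^'s::finite" where
  "mle X n \<omega> = (\<chi> i j. real (transition_count X n \<omega> i j) / real (departure_count X n \<omega> i))"

definition scaled_error ::
    "real^'s^'s \<Rightarrow> (nat \<Rightarrow> 'a \<Rightarrow> 's) \<Rightarrow> nat \<Rightarrow> 'a \<Rightarrow> real^'s^'s::finite" where
  "scaled_error P X n \<omega> = sqrt (real n) *\<^sub>R (mle X n \<omega> - P)"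

definition tangent_space :: "real^'s^'s \<Rightarrow> (real^'s^'s::finite) set" where
  "tangent_space P =
     {H. H *v (\<chi> i. 1) = 0 \<and> (\<forall>i j. P $ i $ j = 0 \<longrightarrow> H $ i $ j = 0)}"

text \<open>Values of \<open>T\<close> are prescribed only where \<open>\<phi>\<close> can be evaluated at the estimator; elsewhere,
  in particular before all rows have been observed, they are arbitrary.\<close>

definition plug_in_estimator ::
    "'a measure \<Rightarrow> (nat \<Rightarrow> 'a \<Rightarrow> 's) \<Rightarrow> (real^'s^'s) set \<Rightarrow> (real^'s^'s::finite \<Rightarrow> 'y)
      \<Rightarrow> (nat \<Rightarrow> 'a \<Rightarrow> 'y) \<Rightarrow> bool" where
  "plug_in_estimator M X U \<phi> T \<longleftrightarrow>
     (\<forall>n. \<forall>\<omega>\<in>space M. mle X n \<omega> \<in> U \<inter> stochastic_matrices \<longrightarrow> T n \<omega> = \<phi> (mle X n \<omega>))"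


section \<open>Gaussian limit\<close>

text \<open>Degenerate normal laws are included: the covariance of interest is singular.\<close>

definition gaussian_variable :: "'b measure \<Rightarrow> ('b \<Rightarrow> real) \<Rightarrow> bool" where
  "gaussian_variable N Z \<longleftrightarrow>
     (\<exists>\<mu> \<sigma>. \<sigma> > 0 \<and> distributed N lborel Z (normal_density \<mu> \<sigma>)) \<or>
     (\<exists>\<mu>. Z \<in> borel_measurable N \<and> (AE \<omega> in N. Z \<omega> = \<mu>))"

definition gaussian_vector :: "'b measure \<Rightarrow> ('b \<Rightarrow> 'v::euclidean_space) \<Rightarrow> bool" where
  "gaussian_vector N Z \<longleftrightarrow>
     Z \<in> borel_measurable N \<and> (\<forall>a. gaussian_variable N (\<lambda>\<omega>. a \<bullet> Z \<omega>))"

definition covariance :: "'b measure \<Rightarrow> ('b \<Rightarrow> real) \<Rightarrow> ('b \<Rightarrow> real) \<Rightarrow> real" where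
  "covariance N Y Z =
     (\<integral>\<omega>. (Y \<omega> - (\<integral>\<omega>'. Y \<omega>' \<partial>N)) * (Z \<omega> - (\<integral>\<omega>'. Z \<omega>' \<partial>N)) \<partial>N)"

definition gaussian_limit_matrix ::
    "'b measure \<Rightarrow> real^'s^'s \<Rightarrow> real^'s \<Rightarrow> ('b \<Rightarrow> real^'s^'s::finite) \<Rightarrow> bool" where
  "gaussian_limit_matrix N P \<pi> W \<longleftrightarrow>
     prob_space N \<and> gaussian_vector N W \<and>
     (\<forall>i j. (\<integral>\<omega>. W \<omega> $ i $ j \<partial>N) = 0) \<and>
     (\<forall>i j k l. covariance N (\<lambda>\<omega>. W \<omega> $ i $ j) (\<lambda>\<omega>. W \<omega> $ k $ l) =
        of_bool (i = k) * (1 / \<pi> $ i) * P $ i $ j * (of_bool (j = l) - P $ i $ l))"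


section \<open>Stochastic convergence\<close>

text \<open>Measurability is part of the following definitions because Isabelle's \<^const>\<open>measure\<close> and Bochner
  integral return 0 on non-measurable arguments.\<close>

definition converges_in_distribution ::
    "'a measure \<Rightarrow> (nat \<Rightarrow> 'a \<Rightarrow> 'y::topological_space) \<Rightarrow> 'b measure \<Rightarrow> ('b \<Rightarrow> 'y) \<Rightarrow> bool" where
  "converges_in_distribution M Y N Z \<longleftrightarrow>
     (\<forall>n. Y n \<in> borel_measurable M) \<and> Z \<in> borel_measurable N \<and>
     (\<forall>f::'y \<Rightarrow> real. continuous_on UNIV f \<and> bounded (range f) \<longrightarrow>
        (\<lambda>n. \<integral>\<omega>. f (Y n \<omega>) \<partial>M) \<longlonglongrightarrow> (\<integral>\<omega>. f (Z \<omega>) \<partial>N))"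

definition little_o_p ::
    "'a measure \<Rightarrow> (nat \<Rightarrow> 'a \<Rightarrow> 'y::real_normed_vector) \<Rightarrow> (nat \<Rightarrow> real) \<Rightarrow> bool" where
  "little_o_p M R a \<longleftrightarrow>
     (\<forall>n. R n \<in> borel_measurable M) \<and>
     (\<forall>\<epsilon>>0. (\<lambda>n. \<P>(\<omega> in M. norm (R n \<omega>) > \<epsilon> * a n)) \<longlonglongrightarrow> 0)"

definition big_O_p ::
    "'a measure \<Rightarrow> (nat \<Rightarrow> 'a \<Rightarrow> 'y::real_normed_vector) \<Rightarrow> (nat \<Rightarrow> real) \<Rightarrow> bool" where
  "big_O_p M R a \<longleftrightarrow>
     (\<forall>n. R n \<in> borel_measurable M) \<and>
     (\<forall>\<epsilon>>0. \<exists>C>0. \<forall>\<^sub>F n in sequentially. \<P>(\<omega> in M. norm (R n \<omega>) > C * a n) \<le> \<epsilon>)"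


section \<open>Higher Frechet differentials\<close>

text \<open>\<open>frechet_differential f [h\<^sub>1, \<dots>, h\<^sub>j] x\<close> is the \<open>j\<close>-th differential of \<open>f\<close> at \<open>x\<close>, evaluated at
  \<open>(h\<^sub>1, \<dots>, h\<^sub>j)\<close>. Lists are used because the type of \<open>j\<close>-linear maps cannot depend on \<open>j\<close>.\<close>

primrec frechet_differential ::
    "('a::real_normed_vector \<Rightarrow> 'b::real_normed_vector) \<Rightarrow> 'a list \<Rightarrow> 'a \<Rightarrow> 'b" where
  "frechet_differential f [] x = f x"
| "frechet_differential f (h # hs) x = frechet_derivative (frechet_differential f hs) (at x) h"

text \<open>The second conjunct below says that the \<open>j\<close>-th differential, as a map into the \<open>j\<close>-linear maps
  with the operator norm, has the \<open>(j+1)\<close>-st differential as its Frechet derivative at \<open>x\<close>. The first one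
  ensures that the values of \<^const>\<open>frechet_derivative\<close> used here are genuine derivatives.\<close>

definition differential_differentiable_at ::
    "nat \<Rightarrow> ('a::real_normed_vector \<Rightarrow> 'b::real_normed_vector) \<Rightarrow> 'a \<Rightarrow> bool" where
  "differential_differentiable_at j f x \<longleftrightarrow>
     (\<forall>hs. length hs = j \<longrightarrow> frechet_differential f hs differentiable (at x)) \<and>
     (\<forall>\<epsilon>>0. \<forall>\<^sub>F y in at x. \<forall>hs. length hs = j \<longrightarrow>
        norm (frechet_differential f hs y - frechet_differential f hs x
              - frechet_differential f ((y - x) # hs) x)
          \<le> \<epsilon> * norm (y - x) * (\<Prod>h\<leftarrow>hs. norm h))"

definition differential_continuous_at ::
    "nat \<Rightarrow> ('a::real_normed_vector \<Rightarrow> 'b::real_normed_vector) \<Rightarrow> 'a \<Rightarrow> bool" where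
  "differential_continuous_at j f x \<longleftrightarrow>
     (\<forall>\<epsilon>>0. \<forall>\<^sub>F y in at x. \<forall>hs. length hs = j \<longrightarrow>
        norm (frechet_differential f hs y - frechet_differential f hs x)
          \<le> \<epsilon> * (\<Prod>h\<leftarrow>hs. norm h))"

text \<open>Intended for open \<open>U\<close>.\<close>

definition continuously_frechet_differentiable_on ::
    "nat \<Rightarrow> ('a::real_normed_vector \<Rightarrow> 'b::real_normed_vector) \<Rightarrow> 'a set \<Rightarrow> bool" where
  "continuously_frechet_differentiable_on r f U \<longleftrightarrow>
     (\<forall>x\<in>U. (\<forall>j<r. differential_differentiable_at j f x) \<and> differential_continuous_at r f x)"

text \<open>The indices \<open>\<alpha>\<close> are the multi-indices on the standard basis.\<close>

definition real_analytic_at ::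
    "('a::euclidean_space \<Rightarrow> 'b::real_normed_vector) \<Rightarrow> 'a \<Rightarrow> bool" where
  "real_analytic_at f x \<longleftrightarrow>
     (\<exists>c :: ('a \<Rightarrow> nat) \<Rightarrow> 'b. \<exists>\<rho>>0. \<forall>y\<in>ball x \<rho>.
        ((\<lambda>\<alpha>. (\<Prod>b\<in>Basis. ((y - x) \<bullet> b) ^ \<alpha> b) *\<^sub>R c \<alpha>) has_sum f y)
          (PiE Basis (\<lambda>_. UNIV)))"

definition real_analytic_near ::
    "('a::euclidean_space \<Rightarrow> 'b::real_normed_vector) \<Rightarrow> 'a \<Rightarrow> 'a set \<Rightarrow> bool" where
  "real_analytic_near f p U \<longleftrightarrow>
     (\<exists>G. open G \<and> p \<in> G \<and> G \<subseteq> U \<and> (\<forall>x\<in>G. real_analytic_at f x))"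

definition taylor_term ::
    "('a::real_normed_vector \<Rightarrow> 'b::real_normed_vector) \<Rightarrow> 'a \<Rightarrow> nat \<Rightarrow> 'a \<Rightarrow> nat \<Rightarrow> 'b" where
  "taylor_term f p n w j =
     (1 / (fact j * real n powr (real j / 2))) *\<^sub>R frechet_differential f (replicate j w) p"

end

theory Submission
  imports Defs
begin

text \<open>
  All randomness enters through two facts about the maximum likelihood estimator: it converges to
  \<open>P\<close> almost surely, and its scaled error \<open>W\<^sub>n\<close> converges in distribution to the Gaussian matrix.
  What remains is calculus at the point \<open>P\<close>.

  Both facts concern sums \<open>d (X 0) (X 1) + \<dots> + d (X (n-1)) (X n)\<close> with \<open>d\<close> centred in its second
  argument, that is, martingales with bounded increments. The state space is finite, so conditioning
  on the past is a finite sum over paths, and a product of factors \<open>u (X k) (X (k+1))\<close> is integrated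
  one factor at a time (\<open>expectation_step\<close>). For \<open>u = exp (l d)\<close> this is a Chernoff bound, and
  Borel--Cantelli gives the strong law (\<open>step_sum_strong_law\<close>). Applied to
  \<open>N\<^sub>i\<^sub>j(n) - p\<^sub>i\<^sub>j N\<^sub>i(n)\<close>, the strong law makes the vector \<open>\<nu>\<^sub>n\<close> of occupation frequencies almost
  stationary, \<open>\<nu>\<^sub>n - \<nu>\<^sub>n P \<rightarrow> 0\<close>. A stationary vector of an irreducible matrix is unique, hence
  \<open>\<nu>\<^sub>n \<rightarrow> \<pi>\<close>, and consistency of the estimator follows.

  For the central limit theorem the factors are \<open>exp (\<i> d / sqrt n + v / (2 n))\<close>, where \<open>v\<close> is the
  conditional variance of \<open>d\<close>. The expectation of their product tends to one, and the product of the
  factors \<open>exp (v / (2 n))\<close> depends only on the occupation frequencies, hence becomes deterministic;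
  so the characteristic function of the normalised sum tends to a Gaussian one
  (\<open>step_sum_characteristic_function\<close>). In several dimensions, convergence of characteristic functions
  is turned into convergence in distribution by tightness and by uniform approximation with
  trigonometric polynomials (\<open>levy_continuity_tight\<close>). Slutsky's lemma finally replaces the
  normalisation \<open>n \<pi>\<^sub>i\<close> by \<open>N\<^sub>i(n)\<close> (\<open>scaled_error_limit\<close>).

  On the analytic side, iterated differentials are multilinear, and Taylor's formula along a segment
  has a remainder \<open>o(norm h ^ r)\<close> for maps of class \<open>C\<^sup>r\<close> (\<open>taylor_little_o\<close>). An analytic map can be
  differentiated termwise, and comparing its power series with its Taylor polynomials identifies the
  homogeneous parts with the differentials (\<open>frechet_differential_eq_homogeneous_part\<close>), which gives a
  remainder \<open>O(norm h ^ (r + 1))\<close> for every \<open>r\<close>. On putting \<open>h = W\<^sub>n / sqrt n\<close>, tightness of \<open>W\<^sub>n\<close> turns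
  these deterministic bounds into the stochastic ones (\<open>remainder_tail\<close>, \<open>delta_method\<close>).

  Independence of the representation rests on the fact that \<open>P + H\<close> is stochastic for every small
  tangent matrix \<open>H\<close>: two representations agree near \<open>P\<close> on the affine space of these matrices, so all
  their derivatives in tangential directions agree (\<open>frechet_differential_eq_tangential\<close>). The matrices
  \<open>W\<^sub>n\<close> and \<open>W\<close> are tangent almost surely.
\<close>

section \<open>Path expectations of a finite Markov chain\<close>

locale finite_markov_chain = prob_space M for M :: "'a measure" +
  fixes X :: "nat \<Rightarrow> 'a \<Rightarrow> 's::finite" and P :: "real^'s^'s"
  assumes chain: "markov_chain M X P" and stochastic: "P \<in> stochastic_matrices"
begin

lemma P_nonneg: "0 \<le> P $ i $ j" and P_row: "(\<Sum>j\<in>UNIV. P $ i $ j) = 1"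
  using stochastic by (auto simp: stochastic_matrices_def)

lemma X_measurable [measurable]: "X m \<in> measurable M (count_space UNIV)"
  using chain by (simp add: markov_chain_def)

lemma cylinder_measurable [measurable]: "Measurable.pred M (\<lambda>\<omega>. \<forall>k\<le>m. X k \<omega> = x k)"
  by measurable

lemma measurable_pair_function [measurable]:
  fixes u :: "'s \<Rightarrow> 's \<Rightarrow> 'c::topological_space"
  shows "(\<lambda>\<omega>. u (X m \<omega>) (X k \<omega>)) \<in> borel_measurable M"
proof -
  have "(\<lambda>\<omega>. u i (X k \<omega>)) \<in> borel_measurable M" for i
    by (rule measurable_compose[OF X_measurable]) simp
  thus ?thesis
    by (rule measurable_compose_countable'[OF _ X_measurable]) (auto intro: countable_finite)
qed

lemma measurable_state_function [measurable]:
  fixes u :: "'s \<Rightarrow> 'c::topological_space"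
  shows "(\<lambda>\<omega>. u (X m \<omega>)) \<in> borel_measurable M"
  by (rule measurable_compose[OF X_measurable]) simp

text \<open>The Markov property is assumed for paths of positive probability only. On the other paths both sides
  are zero.\<close>

lemma cylinder_step:
  "prob {\<omega>\<in>space M. (\<forall>k\<le>m. X k \<omega> = x k) \<and> X (Suc m) \<omega> = j}
    = prob {\<omega>\<in>space M. \<forall>k\<le>m. X k \<omega> = x k} * P $ x m $ j"
proof (cases "prob {\<omega>\<in>space M. \<forall>k\<le>m. X k \<omega> = x k} = 0")
  case True
  have "prob {\<omega>\<in>space M. (\<forall>k\<le>m. X k \<omega> = x k) \<and> X (Suc m) \<omega> = j}
        \<le> prob {\<omega>\<in>space M. \<forall>k\<le>m. X k \<omega> = x k}"
    by (intro finite_measure_mono) auto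
  with True show ?thesis by (simp add: measure_le_0_iff)
next
  case False
  hence pos: "prob {\<omega>\<in>space M. \<forall>k\<le>m. X k \<omega> = x k} > 0"
    by (simp add: zero_less_measure_iff)
  hence "cond_prob M (\<lambda>\<omega>. X (Suc m) \<omega> = j) (\<lambda>\<omega>. \<forall>k\<le>m. X k \<omega> = x k) = P $ x m $ j"
    using chain by (simp add: markov_chain_def)
  thus ?thesis using pos by (simp add: cond_prob_def field_simps conj_commute)
qed

text \<open>The integrated Markov property: a function of the path up to time \<open>m\<close> takes finitely many values, so
  both expectations are finite sums over cylinders, which are compared term by term.\<close>

lemma expectation_step:
  fixes G :: "(nat \<Rightarrow> 's) \<Rightarrow> 'c::{real_normed_field,banach,second_countable_topology}"
  assumes G: "\<And>x y. (\<And>k. k \<le> m \<Longrightarrow> x k = y k) \<Longrightarrow> G x = G y"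
  shows "expectation (\<lambda>\<omega>. G (\<lambda>k. X k \<omega>) * u (X m \<omega>) (X (Suc m) \<omega>))
       = expectation (\<lambda>\<omega>. G (\<lambda>k. X k \<omega>) * (\<Sum>j\<in>UNIV. P $ X m \<omega> $ j *\<^sub>R u (X m \<omega>) j))"
proof -
  let ?Q = "PiE {..m} (\<lambda>_. UNIV :: 's set)"
  let ?C = "\<lambda>x. {\<omega>\<in>space M. \<forall>k\<le>m. X k \<omega> = x k}"
  let ?D = "\<lambda>x j. {\<omega>\<in>space M. (\<forall>k\<le>m. X k \<omega> = x k) \<and> X (Suc m) \<omega> = j}"
  have fin: "finite ?Q" by (auto intro: finite_PiE)
  have path: "restrict (\<lambda>k. X k \<omega>) {..m} \<in> ?Q" for \<omega> by auto
  have uniq: "(\<forall>k\<le>m. X k \<omega> = x k) \<longleftrightarrow> x = restrict (\<lambda>k. X k \<omega>) {..m}" if "x \<in> ?Q" for x \<omega>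
    using that by (auto simp: fun_eq_iff PiE_def extensional_def restrict_def)
  have Gr: "G (restrict (\<lambda>k. X k \<omega>) {..m}) = G (\<lambda>k. X k \<omega>)" for \<omega>
    by (rule G) auto
  have L: "G (\<lambda>k. X k \<omega>) * u (X m \<omega>) (X (Suc m) \<omega>)
      = (\<Sum>x\<in>?Q. \<Sum>j\<in>UNIV. indicator (?D x j) \<omega> *\<^sub>R (G x * u (x m) j))" if "\<omega> \<in> space M" for \<omega>
  proof -
    have "(\<Sum>x\<in>?Q. \<Sum>j\<in>UNIV. indicator (?D x j) \<omega> *\<^sub>R (G x * u (x m) j))
      = (\<Sum>x\<in>?Q. if x = restrict (\<lambda>k. X k \<omega>) {..m} then G x * u (x m) (X (Suc m) \<omega>) else 0)"
    proof (intro sum.cong refl)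
      fix x assume x: "x \<in> ?Q"
      have "(\<Sum>j\<in>UNIV. indicator (?D x j) \<omega> *\<^sub>R (G x * u (x m) j))
        = (\<Sum>j\<in>UNIV. if j = X (Suc m) \<omega> then
             (if x = restrict (\<lambda>k. X k \<omega>) {..m} then G x * u (x m) (X (Suc m) \<omega>) else 0) else 0)"
        using that x by (intro sum.cong refl) (auto simp: uniq indicator_def)
      thus "(\<Sum>j\<in>UNIV. indicator (?D x j) \<omega> *\<^sub>R (G x * u (x m) j))
        = (if x = restrict (\<lambda>k. X k \<omega>) {..m} then G x * u (x m) (X (Suc m) \<omega>) else 0)"
        by (simp add: sum.delta)
    qed
    also have "\<dots> = G (\<lambda>k. X k \<omega>) * u (X m \<omega>) (X (Suc m) \<omega>)"
      using path[of \<omega>] fin by (simp add: sum.delta Gr)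
    finally show ?thesis by simp
  qed
  have R: "G (\<lambda>k. X k \<omega>) * (\<Sum>j\<in>UNIV. P $ X m \<omega> $ j *\<^sub>R u (X m \<omega>) j)
      = (\<Sum>x\<in>?Q. indicator (?C x) \<omega> *\<^sub>R (G x * (\<Sum>j\<in>UNIV. P $ x m $ j *\<^sub>R u (x m) j)))"
    if "\<omega> \<in> space M" for \<omega>
  proof -
    have "(\<Sum>x\<in>?Q. indicator (?C x) \<omega> *\<^sub>R (G x * (\<Sum>j\<in>UNIV. P $ x m $ j *\<^sub>R u (x m) j)))
      = (\<Sum>x\<in>?Q. if x = restrict (\<lambda>k. X k \<omega>) {..m}
           then G x * (\<Sum>j\<in>UNIV. P $ x m $ j *\<^sub>R u (x m) j) else 0)"
      using that by (intro sum.cong refl) (auto simp: uniq indicator_def)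
    also have "\<dots> = G (\<lambda>k. X k \<omega>) * (\<Sum>j\<in>UNIV. P $ X m \<omega> $ j *\<^sub>R u (X m \<omega>) j)"
      using path[of \<omega>] fin by (simp add: sum.delta Gr)
    finally show ?thesis by simp
  qed
  have [measurable]: "?D x j \<in> sets M" for x j by measurable
  have iD: "integrable M (\<lambda>\<omega>. indicator (?D x j) \<omega> *\<^sub>R c)" for x j and c :: 'c
    by (rule integrable_scaleR_left) (simp add: emeasure_eq_measure)
  have iD': "expectation (\<lambda>\<omega>. indicator (?D x j) \<omega> *\<^sub>R c) = prob (?D x j) *\<^sub>R c" for x j and c :: 'c
    by (subst integral_scaleR_left) (simp_all add: emeasure_eq_measure)
  have "expectation (\<lambda>\<omega>. G (\<lambda>k. X k \<omega>) * u (X m \<omega>) (X (Suc m) \<omega>))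
      = expectation (\<lambda>\<omega>. \<Sum>x\<in>?Q. \<Sum>j\<in>UNIV. indicator (?D x j) \<omega> *\<^sub>R (G x * u (x m) j))"
    by (rule Bochner_Integration.integral_cong) (simp_all add: L)
  also have "\<dots> = (\<Sum>x\<in>?Q. \<Sum>j\<in>UNIV. prob (?D x j) *\<^sub>R (G x * u (x m) j))"
    by (simp only: iD iD' Bochner_Integration.integral_sum Bochner_Integration.integrable_sum)
  also have "\<dots> = (\<Sum>x\<in>?Q. prob (?C x) *\<^sub>R (G x * (\<Sum>j\<in>UNIV. P $ x m $ j *\<^sub>R u (x m) j)))"
    by (simp add: cylinder_step scaleR_sum_right sum_distrib_left)
  also have "\<dots> = expectation (\<lambda>\<omega>. \<Sum>x\<in>?Q. indicator (?C x) \<omega> *\<^sub>R (G x * (\<Sum>j\<in>UNIV. P $ x m $ j *\<^sub>R u (x m) j)))"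
    by (subst Bochner_Integration.integral_sum) (simp_all add: emeasure_eq_measure)
  also have "\<dots> = expectation (\<lambda>\<omega>. G (\<lambda>k. X k \<omega>) * (\<Sum>j\<in>UNIV. P $ X m \<omega> $ j *\<^sub>R u (X m \<omega>) j))"
    by (rule Bochner_Integration.integral_cong) (simp_all add: R)
  finally show ?thesis .
qed

end

section \<open>Stationary vectors of an irreducible matrix\<close>

lemma matrix_power_nonneg:
  assumes "\<And>i j. 0 \<le> P $ i $ j"
  shows "0 \<le> matrix_power P m $ i $ j"
proof (induction m arbitrary: i j)
  case 0 show ?case by (simp add: matrix_power_def mat_def)
next
  case (Suc m)
  thus ?case using assms
    by (auto simp: matrix_power_def matrix_matrix_mult_def intro!: sum_nonneg)
qed

lemma invariant_matrix_power:
  fixes \<mu> :: "real^'s::finite"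
  assumes "\<mu> v* P = \<mu>"
  shows "\<mu> v* matrix_power P m = \<mu>"
proof (induction m)
  case 0 show ?case by (simp add: matrix_power_def)
next
  case (Suc m)
  have "matrix_power P (Suc m) = P ** matrix_power P m" by (simp add: matrix_power_def)
  thus ?case using Suc assms by (metis vector_matrix_mul_assoc)
qed

lemma invariant_nonneg_imp_pos:
  fixes \<mu> :: "real^'s::finite"
  assumes "\<And>i j. 0 \<le> P $ i $ j" "irreducible_matrix P" "\<mu> v* P = \<mu>"
    and nn: "\<And>i. 0 \<le> \<mu> $ i" and k: "0 < \<mu> $ k"
  shows "0 < \<mu> $ i"
proof -
  obtain m where m: "matrix_power P m $ k $ i > 0"
    using assms(2) by (auto simp: irreducible_matrix_def)
  have "0 < matrix_power P m $ k $ i * \<mu> $ k" using m k by simp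
  also have "\<dots> \<le> (\<Sum>l\<in>UNIV. matrix_power P m $ l $ i * \<mu> $ l)"
    by (rule member_le_sum) (auto intro!: mult_nonneg_nonneg nn matrix_power_nonneg assms)
  also have "\<dots> = (\<mu> v* matrix_power P m) $ i"
    by (simp add: vector_matrix_mult_def mult.commute)
  also have "\<dots> = \<mu> $ i" by (simp add: invariant_matrix_power assms)
  finally show ?thesis .
qed

lemma stationary_vector_pos:
  assumes "\<And>i j. 0 \<le> P $ i $ j" "irreducible_matrix P" "stationary_vector P \<pi>"
  shows "0 < \<pi> $ i"
proof -
  have "\<exists>k. \<pi> $ k > 0"
  proof (rule ccontr)
    assume "\<not> ?thesis"
    hence "(\<Sum>i\<in>UNIV. \<pi> $ i) \<le> 0" by (intro sum_nonpos) (auto simp: not_less)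
    thus False using assms by (simp add: stationary_vector_def)
  qed
  thus ?thesis using invariant_nonneg_imp_pos[of P \<pi>] assms by (auto simp: stationary_vector_def)
qed

text \<open>Uniqueness of the stationary vector, in linear form. Subtract from \<open>\<nu>\<close> the largest multiple of \<open>\<pi>\<close>
  that leaves a nonnegative vector. The difference is invariant and has a zero entry; an invariant
  nonnegative vector with one positive entry is positive everywhere, so the difference is zero.\<close>

lemma invariant_sum_zero_imp_zero:
  fixes \<nu> :: "real^'s::finite"
  assumes P: "\<And>i j. 0 \<le> P $ i $ j" "irreducible_matrix P" "stationary_vector P \<pi>"
    and \<nu>: "\<nu> v* P = \<nu>" "(\<Sum>i\<in>UNIV. \<nu> $ i) = 0"
  shows "\<nu> = 0"
proof -
  have pos: "\<pi> $ i > 0" for i by (rule stationary_vector_pos[OF P])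
  \<comment> \<open>The largest \<open>c\<close> for which \<open>\<nu> - c \<pi>\<close> is nonnegative; the entry at which the minimum is attained becomes zero.\<close>
  define c where "c = Min (range (\<lambda>i. \<nu> $ i / \<pi> $ i))"
  have "c \<in> range (\<lambda>i. \<nu> $ i / \<pi> $ i)" unfolding c_def by (rule Min_in) auto
  then obtain k where k: "c = \<nu> $ k / \<pi> $ k" by auto
  have cle: "c \<le> \<nu> $ i / \<pi> $ i" for i unfolding c_def by (rule Min_le) auto
  define \<mu> where "\<mu> = \<nu> - c *\<^sub>R \<pi>"
  have nn: "0 \<le> \<mu> $ i" for i using cle[of i] pos[of i] by (simp add: \<mu>_def field_simps)
  have zk: "\<mu> $ k = 0" using pos[of k] by (simp add: \<mu>_def k)
  have \<pi>: "\<pi> v* P = \<pi>" "(\<Sum>i\<in>UNIV. \<pi> $ i) = 1" using P(3) by (auto simp: stationary_vector_def)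
  have inv: "\<mu> v* P = \<mu>"
    using \<nu>(1) \<pi>(1) by (simp add: \<mu>_def vector_matrix_mult_diff_distrib scaleR_vector_matrix_assoc)
  have "\<mu> = 0"
  proof (rule ccontr)
    assume "\<mu> \<noteq> 0"
    then obtain l where "\<mu> $ l \<noteq> 0" by (metis vec_eq_iff zero_index)
    hence "\<mu> $ l > 0" using nn[of l] by simp
    hence "\<mu> $ k > 0" using invariant_nonneg_imp_pos[OF P(1,2) inv nn] by blast
    thus False using zk by simp
  qed
  hence e: "\<nu> = c *\<^sub>R \<pi>" by (simp add: \<mu>_def)
  hence "c = 0" using \<nu>(2) \<pi>(2) by (simp flip: sum_distrib_left)
  thus ?thesis using e by simp
qed

section \<open>Sums of centred functions of the transitions\<close>

lemma exp_le_quadratic: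
  fixes x :: real
  assumes "\<bar>x\<bar> \<le> 1"
  shows "exp x \<le> 1 + x + x\<^sup>2"
proof (cases "x \<ge> 0")
  case True thus ?thesis using exp_bound assms by auto
next
  case False
  define y where "y = - x"
  have y: "y \<ge> 0" using False by (simp add: y_def)
  have "1 + y + y\<^sup>2/2 \<le> exp y" by (rule exp_lower_Taylor_quadratic[OF y])
  moreover have "1 \<le> (1 - y + y\<^sup>2) * (1 + y + y\<^sup>2/2)"
  proof -
    have "(1 - y + y\<^sup>2) * (1 + y + y\<^sup>2/2) = 1 + y^2/2 + y^3/2 + y^4/2"
      by (simp add: algebra_simps add_divide_distrib diff_divide_distrib power2_eq_square power3_eq_cube power4_eq_xxxx)
    thus ?thesis using y by simp
  qed
  moreover have p: "1 - y + y\<^sup>2 \<ge> 0"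
  proof -
    have "1 - y + y\<^sup>2 = (y - 1/2)^2 + 3/4" by (simp add: power2_eq_square algebra_simps)
    thus ?thesis by simp
  qed
  ultimately have "1 \<le> (1 - y + y\<^sup>2) * exp y"
    by (meson mult_left_mono order_trans)
  hence "exp (-y) \<le> 1 - y + y\<^sup>2" by (simp add: exp_minus field_simps)
  thus ?thesis by (simp add: y_def)
qed

definition centred :: "real^'s^'s::finite \<Rightarrow> ('s \<Rightarrow> 's \<Rightarrow> real) \<Rightarrow> bool" where
  "centred P d \<longleftrightarrow> (\<forall>i. (\<Sum>j\<in>UNIV. P $ i $ j * d i j) = 0)"

definition step_sum :: "(nat \<Rightarrow> 'a \<Rightarrow> 's) \<Rightarrow> ('s \<Rightarrow> 's \<Rightarrow> real) \<Rightarrow> nat \<Rightarrow> 'a \<Rightarrow> real" where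
  "step_sum X d n \<omega> = (\<Sum>m<n. d (X m \<omega>) (X (Suc m) \<omega>))"

text \<open>The bound is strictly positive because it will be divided by.\<close>

lemma bounded_on_finite_pairs:
  fixes d :: "'s::finite \<Rightarrow> 's \<Rightarrow> 'c::real_normed_vector"
  obtains c where "c > 0" "\<And>i j. norm (d i j) \<le> c"
proof
  show "0 < 1 + Max (range (\<lambda>(i,j). norm (d i j)))"
    by (intro add_pos_nonneg) (auto simp: Max_ge_iff)
  show "norm (d i j) \<le> 1 + Max (range (\<lambda>(i,j). norm (d i j)))" for i j
    by (rule add_increasing) (auto intro!: Max_ge)
qed

context finite_markov_chain
begin

lemma step_sum_measurable [measurable]: "step_sum X d n \<in> borel_measurable M"
  unfolding step_sum_def[abs_def] by measurable

lemma integrable_bounded: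
  fixes f :: "'a \<Rightarrow> 'c::{banach,second_countable_topology}"
  assumes "f \<in> borel_measurable M" "\<And>\<omega>. norm (f \<omega>) \<le> B"
  shows "integrable M f"
  using assms by (intro integrable_const_bound[of _ B]) auto

lemma prod_step_integrable:
  fixes u :: "'s \<Rightarrow> 's \<Rightarrow> 'c::{real_normed_field,banach,second_countable_topology}"
  assumes "\<And>i. norm (v i) \<le> (D::real)"
  shows "integrable M (\<lambda>\<omega>. (\<Prod>k<n. u (X k \<omega>) (X (Suc k) \<omega>)) * v (X n \<omega>))"
proof -
  obtain c where c: "c > 0" "\<And>i j. norm (u i j) \<le> c" using bounded_on_finite_pairs by blast
  have "norm ((\<Prod>k<n. u (X k \<omega>) (X (Suc k) \<omega>)) * v (X n \<omega>)) \<le> c ^ n * D" for \<omega>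
  proof -
    have "(\<Prod>k<n. norm (u (X k \<omega>) (X (Suc k) \<omega>))) \<le> (\<Prod>k<n. c)"
      by (rule prod_mono) (auto intro: c)
    thus ?thesis unfolding norm_mult prod_norm[symmetric] using assms c(1)
      by (intro mult_mono) auto
  qed
  thus ?thesis by (intro integrable_bounded) measurable
qed

lemma expectation_prod_Suc:
  fixes u :: "'s \<Rightarrow> 's \<Rightarrow> 'c::{real_normed_field,banach,second_countable_topology}"
  shows "expectation (\<lambda>\<omega>. \<Prod>k<Suc n. u (X k \<omega>) (X (Suc k) \<omega>))
    = expectation (\<lambda>\<omega>. (\<Prod>k<n. u (X k \<omega>) (X (Suc k) \<omega>)) * (\<Sum>j\<in>UNIV. P $ X n \<omega> $ j *\<^sub>R u (X n \<omega>) j))"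
  using expectation_step[of n "\<lambda>x. \<Prod>k<n. u (x k) (x (Suc k))" u] by (simp add: mult.commute)

text \<open>Integrate the factors from the last to the first; each costs at most \<open>q\<close>.\<close>

lemma expectation_prod_le:
  fixes u :: "'s \<Rightarrow> 's \<Rightarrow> real"
  assumes nn: "\<And>i j. 0 \<le> u i j" and q: "\<And>i. (\<Sum>j\<in>UNIV. P $ i $ j * u i j) \<le> q"
  shows "expectation (\<lambda>\<omega>. \<Prod>k<n. u (X k \<omega>) (X (Suc k) \<omega>)) \<le> q ^ n"
proof (induction n)
  case 0 show ?case by (simp add: prob_space)
next
  case (Suc n)
  have q0: "0 \<le> q" using q[of undefined] nn P_nonneg
    by (meson order_trans sum_nonneg mult_nonneg_nonneg)
  have b: "norm (\<Sum>j\<in>UNIV. P $ i $ j *\<^sub>R u i j) \<le> q" for i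
    using q[of i] nn P_nonneg by (simp add: sum_nonneg)
  have I: "integrable M (\<lambda>\<omega>. (\<Prod>k<n. u (X k \<omega>) (X (Suc k) \<omega>)))"
    using prod_step_integrable[where v="\<lambda>_. 1" and D=1 and u=u and n=n] by simp
  have "expectation (\<lambda>\<omega>. \<Prod>k<Suc n. u (X k \<omega>) (X (Suc k) \<omega>))
     \<le> expectation (\<lambda>\<omega>. (\<Prod>k<n. u (X k \<omega>) (X (Suc k) \<omega>)) * q)"
    unfolding expectation_prod_Suc
    using q nn I prod_step_integrable[where v="\<lambda>i. \<Sum>j\<in>UNIV. P $ i $ j *\<^sub>R u i j" and u=u and n=n, OF b]
    by (intro integral_mono) (simp_all add: mult_left_mono prod_nonneg)
  also have "\<dots> \<le> q ^ n * q" using I Suc q0 by (simp add: mult_right_mono)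
  finally show ?case by (simp add: mult.commute)
qed

text \<open>Centring removes the linear term of \<open>exp x \<le> 1 + x + x\<^sup>2\<close>, so one transition contributes a factor of
  at most \<open>1 + (l c)\<^sup>2 \<le> exp ((l c)\<^sup>2)\<close>.\<close>

lemma exp_step_sum_le:
  assumes d: "centred P d" "\<And>i j. \<bar>d i j\<bar> \<le> c" and l: "\<bar>l\<bar> * c \<le> 1"
  shows "expectation (\<lambda>\<omega>. exp (l * step_sum X d n \<omega>)) \<le> exp (real n * (l * c)\<^sup>2)"
proof -
  have "(\<Sum>j\<in>UNIV. P $ i $ j * exp (l * d i j)) \<le> exp ((l * c)\<^sup>2)" for i
  proof -
    have "(\<Sum>j\<in>UNIV. P $ i $ j * exp (l * d i j))
       \<le> (\<Sum>j\<in>UNIV. P $ i $ j * (1 + l * d i j + (l * c)\<^sup>2))"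
    proof (intro sum_mono mult_left_mono P_nonneg)
      fix j
      have a: "\<bar>l * d i j\<bar> \<le> \<bar>l * c\<bar>" unfolding abs_mult using d(2)[of i j] by (intro mult_left_mono) auto
      hence "(l * d i j)\<^sup>2 \<le> (l * c)\<^sup>2" by (simp add: abs_le_square_iff)
      moreover have "\<bar>l * d i j\<bar> \<le> 1" using a l d(2)[of i j] by (simp add: abs_mult)
      ultimately show "exp (l * d i j) \<le> 1 + l * d i j + (l * c)\<^sup>2"
        using exp_le_quadratic[of "l * d i j"] by linarith
    qed
    also have "\<dots> = (\<Sum>j\<in>UNIV. P $ i $ j) + l * (\<Sum>j\<in>UNIV. P $ i $ j * d i j) + (l*c)\<^sup>2 * (\<Sum>j\<in>UNIV. P $ i $ j)"
      by (simp add: algebra_simps sum.distrib sum_distrib_left)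
    also have "\<dots> = 1 + (l*c)\<^sup>2" using d(1) by (simp add: P_row centred_def)
    also have "\<dots> \<le> exp ((l*c)\<^sup>2)" by (rule exp_ge_add_one_self)
    finally show ?thesis .
  qed
  from expectation_prod_le[of "\<lambda>i j. exp (l * d i j)", OF _ this, of n]
  show ?thesis by (simp add: step_sum_def sum_distrib_left exp_sum exp_of_nat_mult)
qed

text \<open>Chernoff's bound for the sum and for its negative. With \<open>l\<close> constant it gives the strong law, with
  \<open>l = 1 / sqrt n\<close> it gives tightness in the central limit theorem.\<close>

lemma step_sum_tail:
  assumes d: "centred P d" "\<And>i j. \<bar>d i j\<bar> \<le> c" and l: "0 < l" "l * c \<le> 1"
  shows "prob {\<omega>\<in>space M. K \<le> \<bar>step_sum X d n \<omega>\<bar>} \<le> 2 * exp (real n * (l * c)\<^sup>2 - l * K)"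
proof -
  have one: "prob {\<omega>\<in>space M. exp (l * K) \<le> exp (s * l * step_sum X d n \<omega>)} \<le> exp (real n * (l * c)\<^sup>2 - l * K)"
    if s: "s = 1 \<or> s = -1" for s
  proof -
    have I: "integrable M (\<lambda>\<omega>. exp (s * l * step_sum X d n \<omega>))"
      using prod_step_integrable[where v="\<lambda>_. 1" and D=1 and n=n and u="\<lambda>i j. exp (s * l * d i j)"]
      by (simp add: step_sum_def sum_distrib_left exp_sum)
    have "prob {\<omega>\<in>space M. exp (l * K) \<le> exp (s * l * step_sum X d n \<omega>)}
       \<le> expectation (\<lambda>\<omega>. exp (s * l * step_sum X d n \<omega>)) / exp (l * K)"
      by (rule integral_Markov_inequality_measure[OF I, of "{}"]) auto
    also have "\<dots> \<le> exp (real n * (s * l * c)\<^sup>2) / exp (l * K)"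
      using s l by (intro divide_right_mono exp_step_sum_le d) auto
    also have "\<dots> = exp (real n * (l * c)\<^sup>2 - l * K)" using s by (auto simp: exp_diff)
    finally show ?thesis .
  qed
  have sub: "{\<omega>\<in>space M. K \<le> \<bar>step_sum X d n \<omega>\<bar>} \<subseteq>
      {\<omega>\<in>space M. exp (l * K) \<le> exp (1 * l * step_sum X d n \<omega>)} \<union>
      {\<omega>\<in>space M. exp (l * K) \<le> exp (-1 * l * step_sum X d n \<omega>)}"
  proof
    fix \<omega> assume "\<omega> \<in> {\<omega>\<in>space M. K \<le> \<bar>step_sum X d n \<omega>\<bar>}"
    hence w: "\<omega> \<in> space M" "K \<le> step_sum X d n \<omega> \<or> K \<le> - step_sum X d n \<omega>" by auto
    hence "l * K \<le> l * step_sum X d n \<omega> \<or> l * K \<le> l * - step_sum X d n \<omega>"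
      using l(1) by (meson mult_left_mono less_imp_le)
    thus "\<omega> \<in> {\<omega>\<in>space M. exp (l * K) \<le> exp (1 * l * step_sum X d n \<omega>)} \<union>
      {\<omega>\<in>space M. exp (l * K) \<le> exp (-1 * l * step_sum X d n \<omega>)}"
      using w(1) by simp
  qed
  have "prob {\<omega>\<in>space M. K \<le> \<bar>step_sum X d n \<omega>\<bar>} \<le>
     prob ({\<omega>\<in>space M. exp (l * K) \<le> exp (1 * l * step_sum X d n \<omega>)} \<union>
      {\<omega>\<in>space M. exp (l * K) \<le> exp (-1 * l * step_sum X d n \<omega>)})"
    by (rule finite_measure_mono[OF sub]) measurable
  also have "\<dots> \<le> prob {\<omega>\<in>space M. exp (l * K) \<le> exp (1 * l * step_sum X d n \<omega>)}
     + prob {\<omega>\<in>space M. exp (l * K) \<le> exp (-1 * l * step_sum X d n \<omega>)}"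
    by (rule measure_Un_le) measurable
  also have "\<dots> \<le> 2 * exp (real n * (l * c)\<^sup>2 - l * K)"
    using one[of 1] one[of "-1"] by linarith
  finally show ?thesis .
qed

lemma step_sum_strong_law:
  assumes d: "centred P d"
  shows "AE \<omega> in M. (\<lambda>n. step_sum X d n \<omega> / real n) \<longlonglongrightarrow> 0"
proof -
  obtain c where c: "c > 0" "\<And>i j. norm (d i j) \<le> c" using bounded_on_finite_pairs by blast
  have ev: "AE \<omega> in M. \<forall>\<^sub>F n in sequentially. \<bar>step_sum X d n \<omega>\<bar> < \<epsilon> * real n" if e: "\<epsilon> > 0" for \<epsilon>
  proof -
    \<comment> \<open>With this choice the exponent \<open>n l (l c\<^sup>2 - \<epsilon>)\<close> is at most \<open>- n l \<epsilon> / 2\<close>.\<close>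
    define l where "l = min (1/c) (\<epsilon> / (2 * c\<^sup>2))"
    have l: "0 < l" "l * c \<le> 1" "l * c\<^sup>2 \<le> \<epsilon>/2"
      using c(1) e by (auto simp: l_def min_def field_simps power2_eq_square)
    have bd: "prob {\<omega>\<in>space M. \<epsilon> * real n \<le> \<bar>step_sum X d n \<omega>\<bar>} \<le> 2 * exp (- (l * \<epsilon>/2)) ^ n" for n
    proof -
      have "real n * (l * c)\<^sup>2 - l * (\<epsilon> * real n) = real n * l * (l * c\<^sup>2 - \<epsilon>)"
        by (simp add: power2_eq_square algebra_simps)
      also have "\<dots> \<le> real n * l * (-\<epsilon>/2)" using l by (intro mult_left_mono) auto
      finally have "exp (real n * (l * c)\<^sup>2 - l * (\<epsilon> * real n)) \<le> exp (real n * (- (l * \<epsilon> / 2)))"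
        by (simp add: algebra_simps)
      thus ?thesis using step_sum_tail[OF d _ l(1,2), of "\<epsilon> * real n" n] c(2)
        unfolding exp_of_nat_mult by fastforce
    qed
    have "summable (\<lambda>n. 2 * exp (- (l * \<epsilon>/2)) ^ n)"
      using l e by (intro summable_mult summable_geometric) auto
    hence "summable (\<lambda>n. prob {\<omega>\<in>space M. \<epsilon> * real n \<le> \<bar>step_sum X d n \<omega>\<bar>})"
      by (rule summable_comparison_test'[where N=0]) (use bd in auto)
    hence "AE \<omega> in M. \<forall>\<^sub>F n in sequentially. \<omega> \<in> space M - {\<omega>\<in>space M. \<epsilon> * real n \<le> \<bar>step_sum X d n \<omega>\<bar>}"
      by (intro borel_cantelli_AE1) (auto simp: emeasure_eq_measure)
    thus ?thesis
      by (rule AE_mp) (auto intro!: AE_I2 elim!: eventually_mono)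
  qed
  have "AE \<omega> in M. \<forall>k. \<forall>\<^sub>F n in sequentially. \<bar>step_sum X d n \<omega>\<bar> < 1 / real (Suc k) * real n"
    unfolding AE_all_countable by (intro allI ev) auto
  thus ?thesis
  proof (rule AE_mp, intro AE_I2 impI)
    fix \<omega> assume H: "\<forall>k. \<forall>\<^sub>F n in sequentially. \<bar>step_sum X d n \<omega>\<bar> < 1 / real (Suc k) * real n"
    show "(\<lambda>n. step_sum X d n \<omega> / real n) \<longlonglongrightarrow> 0"
    proof (rule LIMSEQ_I)
      fix r :: real assume "r > 0"
      then obtain k where k: "1 / real (Suc k) < r" using nat_approx_posE by blast
      have "\<forall>\<^sub>F n in sequentially. norm (step_sum X d n \<omega> / real n - 0) < r"
        using H[rule_format, of k] eventually_gt_at_top[of 0]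
      proof eventually_elim
        case (elim n)
        hence "\<bar>step_sum X d n \<omega>\<bar> / real n < 1 / real (Suc k)" by (simp add: field_simps)
        thus ?case using k by simp
      qed
      thus "\<exists>no. \<forall>n\<ge>no. norm (step_sum X d n \<omega> / real n - 0) < r"
        by (simp add: eventually_sequentially)
    qed
  qed
qed

end

section \<open>Occupation frequencies and strong consistency\<close>

lemma card_conv_sum:
  fixes n :: nat
  shows "real (card {m. m < n \<and> Q m}) = (\<Sum>m<n. of_bool (Q m))"
proof -
  have "real (card {m. m < n \<and> Q m}) = (\<Sum>m\<in>{m. m < n \<and> Q m}. 1)" by simp
  also have "\<dots> = (\<Sum>m<n. of_bool (Q m))"
    by (rule sum.mono_neutral_cong_left) auto
  finally show ?thesis .
qed

lemma matrix_borel_measurableI: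
  fixes f :: "'a \<Rightarrow> real^'m::finite^'n::finite"
  assumes "\<And>i j. (\<lambda>\<omega>. f \<omega> $ i $ j) \<in> borel_measurable M"
  shows "f \<in> borel_measurable M"
proof (rule borel_measurable_euclidean_space[THEN iffD2], rule ballI)
  fix b :: "real^'m^'n" assume "b \<in> Basis"
  then obtain i j where b: "b = axis i (axis j 1)" by (auto simp: Basis_vec_def)
  show "(\<lambda>\<omega>. f \<omega> \<bullet> b) \<in> borel_measurable M"
    using assms[of i j] by (simp add: b inner_axis)
qed

lemma departure_count_sum:
  "real (departure_count X n \<omega> i) = (\<Sum>m<n. of_bool (X m \<omega> = i))"
  unfolding departure_count_def by (rule card_conv_sum)

lemma transition_count_sum:
  "real (transition_count X n \<omega> i j) = (\<Sum>m<n. of_bool (X m \<omega> = i) * of_bool (X (Suc m) \<omega> = j))"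
  unfolding transition_count_def card_conv_sum of_bool_conj ..

text \<open>The martingale difference behind the estimator: its sum is \<open>N\<^sub>i\<^sub>j(n) - p\<^sub>i\<^sub>j N\<^sub>i(n)\<close>.\<close>

definition transition_noise :: "real^'s^'s::finite \<Rightarrow> 's \<Rightarrow> 's \<Rightarrow> 's \<Rightarrow> 's \<Rightarrow> real" where
  "transition_noise P i j a b = of_bool (a = i) * (of_bool (b = j) - P $ i $ j)"

lemma step_sum_transition_noise:
  "step_sum X (transition_noise P i j) n \<omega>
    = real (transition_count X n \<omega> i j) - P $ i $ j * real (departure_count X n \<omega> i)"
  unfolding step_sum_def transition_noise_def transition_count_sum departure_count_sum
  by (simp add: right_diff_distrib sum_subtractf sum_distrib_left sum_distrib_right mult.commute)

lemma sum_departure_count: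
  fixes X :: "nat \<Rightarrow> 'a \<Rightarrow> 's::finite"
  shows "(\<Sum>i\<in>UNIV. real (departure_count X n \<omega> i)) = real n"
proof -
  have "(\<Sum>i\<in>UNIV. real (departure_count X n \<omega> i)) = (\<Sum>m<n. \<Sum>i\<in>UNIV. of_bool (X m \<omega> = i))"
    unfolding departure_count_sum by (rule sum.swap)
  also have "\<dots> = (\<Sum>m<n. 1)"
    by (intro sum.cong refl) (simp add: of_bool_def)
  finally show ?thesis by simp
qed

text \<open>Every arrival is the next departure, up to the two ends of the trajectory. This boundary term is all
  that separates the occupation frequencies from a stationary vector, apart from the noise.\<close>

lemma sum_transition_count_target:
  fixes X :: "nat \<Rightarrow> 'a \<Rightarrow> 's::finite"
  shows "(\<Sum>i\<in>UNIV. real (transition_count X n \<omega> i j))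
    = real (departure_count X n \<omega> j) + of_bool (X n \<omega> = j) - of_bool (X 0 \<omega> = j)"
proof -
  have one: "(\<Sum>i\<in>UNIV. of_bool (X m \<omega> = i) :: real) = 1" for m by (simp add: of_bool_def)
  have "(\<Sum>i\<in>UNIV. real (transition_count X n \<omega> i j))
      = (\<Sum>m<n. (\<Sum>i\<in>UNIV. of_bool (X m \<omega> = i)) * of_bool (X (Suc m) \<omega> = j))"
    unfolding transition_count_sum sum_distrib_right by (rule sum.swap)
  also have "\<dots> = (\<Sum>m<n. of_bool (X (Suc m) \<omega> = j))" by (simp add: one)
  also have "\<dots> = (\<Sum>m<Suc n. of_bool (X m \<omega> = j)) - of_bool (X 0 \<omega> = j)"
    by (subst sum.lessThan_Suc_shift) simp
  finally show ?thesis by (simp add: departure_count_sum)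
qed

lemma sum_transition_count_source:
  fixes X :: "nat \<Rightarrow> 'a \<Rightarrow> 's::finite"
  shows "(\<Sum>j\<in>UNIV. real (transition_count X n \<omega> i j)) = real (departure_count X n \<omega> i)"
proof -
  have one: "(\<Sum>i\<in>UNIV. of_bool (X m \<omega> = i) :: real) = 1" for m by (simp add: of_bool_def)
  have "(\<Sum>j\<in>UNIV. real (transition_count X n \<omega> i j))
      = (\<Sum>m<n. of_bool (X m \<omega> = i) * (\<Sum>j\<in>UNIV. of_bool (X (Suc m) \<omega> = j)))"
    unfolding transition_count_sum sum_distrib_left by (rule sum.swap)
  thus ?thesis by (simp add: one departure_count_sum)
qed

locale irreducible_markov_chain = finite_markov_chain M X P
  for M :: "'a measure" and X :: "nat \<Rightarrow> 'a \<Rightarrow> 's::finite" and P :: "real^'s^'s" +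
  fixes \<pi> :: "real^'s"
  assumes irreducible: "irreducible_matrix P" and stationary: "stationary_vector P \<pi>"
begin

lemma \<pi>_pos: "0 < \<pi> $ i"
  using stationary_vector_pos[OF P_nonneg irreducible stationary] .

lemma centred_transition_noise: "centred P (transition_noise P i j)"
  unfolding centred_def transition_noise_def
proof
  fix a
  have "(\<Sum>b\<in>UNIV. P $ a $ b * (of_bool (a = i) * (of_bool (b = j) - P $ i $ j)))
      = of_bool (a = i) * ((\<Sum>b\<in>UNIV. P $ a $ b * of_bool (b = j)) - (\<Sum>b\<in>UNIV. P $ a $ b) * P $ i $ j)"
    by (simp add: algebra_simps sum_subtractf sum_distrib_left sum_distrib_right)
  also have "\<dots> = 0" by (simp add: P_row)
  finally show "(\<Sum>b\<in>UNIV. P $ a $ b * (of_bool (a = i) * (of_bool (b = j) - P $ i $ j))) = 0" .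
qed

lemma departure_count_measurable [measurable]: "(\<lambda>\<omega>. real (departure_count X n \<omega> i)) \<in> borel_measurable M"
  unfolding departure_count_sum by measurable

lemma transition_count_measurable [measurable]: "(\<lambda>\<omega>. real (transition_count X n \<omega> i j)) \<in> borel_measurable M"
  unfolding transition_count_sum by measurable

lemma AE_transition_noise:
  "AE \<omega> in M. \<forall>i j. (\<lambda>n. step_sum X (transition_noise P i j) n \<omega> / real n) \<longlonglongrightarrow> 0"
  by (simp add: AE_all_countable step_sum_strong_law centred_transition_noise)

text \<open>By the strong law and by counting arrivals, the frequency vector \<open>\<nu> n\<close> satisfies
  \<open>\<nu> n - \<nu> n v* P \<rightarrow> 0\<close>. The linear map \<open>F\<close>, which collects this defect and the total mass, is injective by
  uniqueness of the stationary vector, hence bounded below, and \<open>F (\<nu> n - \<pi>) \<rightarrow> 0\<close> forces \<open>\<nu> n \<rightarrow> \<pi>\<close>.\<close>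

lemma occupation_frequency:
  "AE \<omega> in M. \<forall>i. (\<lambda>n. real (departure_count X n \<omega> i) / real n) \<longlonglongrightarrow> \<pi> $ i"
  using AE_transition_noise
proof (rule AE_mp, intro AE_I2 impI)
  fix \<omega>
  assume noise: "\<forall>i j. (\<lambda>n. step_sum X (transition_noise P i j) n \<omega> / real n) \<longlonglongrightarrow> 0"
  define \<nu> where "\<nu> n = (\<chi> i. real (departure_count X n \<omega> i) / real n)" for n
  define F :: "real^'s \<Rightarrow> (real^'s) \<times> real" where "F v = (v - v v* P, \<Sum>i\<in>UNIV. v $ i)" for v
  have lin: "linear F"
    by (rule linearI)
      (auto simp: F_def vector_matrix_left_distrib scaleR_vector_matrix_assoc sum.distrib
         scaleR_diff_right sum_distrib_left)
  have "v = 0" if "F v = 0" for v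
    using that invariant_sum_zero_imp_zero[OF P_nonneg irreducible stationary, of v]
    by (simp add: F_def zero_prod_def)
  hence "inj F" using linear_injective_0[OF lin] by auto
  then obtain B where B: "B > 0" "\<And>v. B * norm v \<le> norm (F v)"
    using linear_inj_bounded_below_pos[OF lin] by blast
  have diff: "(\<nu> n - \<nu> n v* P) $ j = (\<Sum>i\<in>UNIV. step_sum X (transition_noise P i j) n \<omega> / real n)
        - (of_bool (X n \<omega> = j) - of_bool (X 0 \<omega> = j)) / real n" for n j
  proof -
    have "(\<Sum>i\<in>UNIV. step_sum X (transition_noise P i j) n \<omega>)
      = real (departure_count X n \<omega> j) + of_bool (X n \<omega> = j) - of_bool (X 0 \<omega> = j)
        - (\<Sum>i\<in>UNIV. P $ i $ j * real (departure_count X n \<omega> i))"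
      unfolding step_sum_transition_noise sum_subtractf sum_transition_count_target ..
    thus ?thesis
      by (simp add: \<nu>_def vector_matrix_mult_def sum_divide_distrib[symmetric] diff_divide_distrib
          add_divide_distrib mult.commute)
  qed
  have bnd: "(\<lambda>n. (of_bool (X n \<omega> = j) - of_bool (X 0 \<omega> = j)) / real n) \<longlonglongrightarrow> 0" for j
  proof (rule Lim_null_comparison)
    show "\<forall>\<^sub>F n in sequentially. norm ((of_bool (X n \<omega> = j) - of_bool (X 0 \<omega> = j)) / real n) \<le> 1 / real n"
      by (auto simp: divide_right_mono of_bool_def)
  qed (rule lim_1_over_n)
  have "(\<lambda>n. \<nu> n - \<nu> n v* P) \<longlonglongrightarrow> 0"
  proof (rule vec_tendstoI)
    fix j
    have "(\<lambda>n. (\<Sum>i\<in>UNIV. step_sum X (transition_noise P i j) n \<omega> / real n)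
        - (of_bool (X n \<omega> = j) - of_bool (X 0 \<omega> = j)) / real n) \<longlonglongrightarrow> (\<Sum>i\<in>(UNIV::'s set). 0) - 0"
      using noise bnd by (intro tendsto_intros) auto
    thus "(\<lambda>n. (\<nu> n - \<nu> n v* P) $ j) \<longlonglongrightarrow> 0 $ j" unfolding diff by simp
  qed
  hence lim: "(\<lambda>n. norm (\<nu> n - \<nu> n v* P) / B) \<longlonglongrightarrow> 0"
    by (intro tendsto_divide_zero tendsto_norm_zero)
  have \<pi>: "\<pi> v* P = \<pi>" "(\<Sum>i\<in>UNIV. \<pi> $ i) = 1" using stationary by (auto simp: stationary_vector_def)
  have le: "norm (\<nu> n - \<pi>) \<le> norm (\<nu> n - \<nu> n v* P) / B" if "n > 0" for n
  proof -
    have "F (\<nu> n - \<pi>) = (\<nu> n - \<nu> n v* P, 0)"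
      using that \<pi> sum_departure_count[of X n \<omega>]
      by (simp add: F_def \<nu>_def[of n] vector_matrix_mult_diff_distrib sum_subtractf flip: sum_divide_distrib)
    thus ?thesis using B(2)[of "\<nu> n - \<pi>"] B(1) by (simp add: norm_Pair field_simps)
  qed
  have "\<nu> \<longlonglongrightarrow> \<pi>"
    by (rule LIM_zero_cancel, rule Lim_null_comparison[OF _ lim])
       (rule eventually_mono[OF eventually_gt_at_top[of 0] le])
  show "\<forall>i. (\<lambda>n. real (departure_count X n \<omega> i) / real n) \<longlonglongrightarrow> \<pi> $ i"
    using tendsto_vec_nth[OF \<open>\<nu> \<longlonglongrightarrow> \<pi>\<close>] by (simp add: \<nu>_def)
qed

lemma mle_measurable [measurable]: "mle X n \<in> borel_measurable M"
  by (rule matrix_borel_measurableI) (simp add: mle_def)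

lemma mle_minus_P:
  assumes "departure_count X n \<omega> i > 0"
  shows "mle X n \<omega> $ i $ j - P $ i $ j
    = step_sum X (transition_noise P i j) n \<omega> / real (departure_count X n \<omega> i)"
  using assms by (simp add: mle_def step_sum_transition_noise field_simps)

lemma mle_stochastic:
  assumes "\<And>i. departure_count X n \<omega> i > 0"
  shows "mle X n \<omega> \<in> stochastic_matrices"
  using assms by (simp add: stochastic_matrices_def mle_def sum_transition_count_source flip: sum_divide_distrib)

lemma AE_all_rows_observed:
  "AE \<omega> in M. \<forall>\<^sub>F n in sequentially. \<forall>i. departure_count X n \<omega> i > 0"
  using occupation_frequency
proof (rule AE_mp, intro AE_I2 impI)
  fix \<omega> assume H: "\<forall>i. (\<lambda>n. real (departure_count X n \<omega> i) / real n) \<longlonglongrightarrow> \<pi> $ i"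
  have "\<forall>\<^sub>F n in sequentially. departure_count X n \<omega> i > 0" for i
    using order_tendstoD(1)[OF H[rule_format] \<pi>_pos[of i]]
    by eventually_elim (auto simp: zero_less_divide_iff)
  thus "\<forall>\<^sub>F n in sequentially. \<forall>i. departure_count X n \<omega> i > 0"
    by (simp add: eventually_all_finite)
qed

lemma mle_strongly_consistent:
  "AE \<omega> in M. (\<lambda>n. mle X n \<omega>) \<longlonglongrightarrow> P"
  using AE_all_rows_observed occupation_frequency AE_transition_noise
proof eventually_elim
  case (elim \<omega>)
  show ?case
  proof (intro vec_tendstoI)
    fix i j
    have "(\<lambda>n. (step_sum X (transition_noise P i j) n \<omega> / real n) / (real (departure_count X n \<omega> i) / real n)) \<longlonglongrightarrow> 0 / \<pi> $ i"
      using elim \<pi>_pos[of i] by (intro tendsto_divide) auto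
    moreover have "\<forall>\<^sub>F n in sequentially. (step_sum X (transition_noise P i j) n \<omega> / real n) / (real (departure_count X n \<omega> i) / real n)
       = mle X n \<omega> $ i $ j - P $ i $ j"
      using elim(1) eventually_gt_at_top[of 0]
      by eventually_elim (simp add: mle_minus_P)
    ultimately have "(\<lambda>n. mle X n \<omega> $ i $ j - P $ i $ j) \<longlonglongrightarrow> 0"
      by (simp add: filterlim_cong[OF refl refl])
    thus "(\<lambda>n. mle X n \<omega> $ i $ j) \<longlonglongrightarrow> P $ i $ j" by (rule LIM_zero_cancel)
  qed
qed

end

section \<open>Characteristic functions of the normalised sums\<close>

lemma n_times_exp_minus_one:
  fixes v :: real
  assumes "v \<ge> 0"
  shows "(\<lambda>n. real n * (exp (v / (2 * real n)) - 1)) \<longlonglongrightarrow> v / 2"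
proof (rule tendsto_sandwich[of "\<lambda>_. v / 2" _ _ "\<lambda>n. v / 2 + (v\<^sup>2 / 4) * (1 / real n)"])
  obtain N :: nat where N: "real N > v" using reals_Archimedean2 by blast
  show "\<forall>\<^sub>F n in sequentially. v / 2 \<le> real n * (exp (v / (2 * real n)) - 1)"
    using eventually_gt_at_top[of 0]
  proof eventually_elim
    case (elim n)
    have "real n * (v / (2 * real n)) \<le> real n * (exp (v / (2 * real n)) - 1)"
      by (rule mult_left_mono) (use exp_ge_add_one_self[of "v / (2 * real n)"] in linarith, simp)
    thus ?case using elim by simp
  qed
  show "\<forall>\<^sub>F n in sequentially. real n * (exp (v / (2 * real n)) - 1) \<le> v / 2 + (v\<^sup>2 / 4) * (1 / real n)"
    using eventually_gt_at_top[of 0] eventually_ge_at_top[of N]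
  proof eventually_elim
    case (elim n)
    have "v \<le> real n" using elim N by (meson less_eq_real_def of_nat_le_iff order_trans)
    hence "exp (v / (2 * real n)) \<le> 1 + v / (2 * real n) + (v / (2 * real n))\<^sup>2"
      using elim assms by (intro exp_bound) (auto simp: field_simps)
    hence "real n * (exp (v / (2 * real n)) - 1) \<le> real n * (v / (2 * real n) + (v / (2 * real n))\<^sup>2)"
      by (intro mult_left_mono) auto
    also have "\<dots> = v / 2 + (v\<^sup>2 / 4) * (1 / real n)"
      using elim by (simp add: field_simps power2_eq_square)
    finally show ?case .
  qed
  show "(\<lambda>n. v / 2 + (v\<^sup>2 / 4) * (1 / real n)) \<longlonglongrightarrow> v / 2"
    using tendsto_add[OF tendsto_const tendsto_mult[OF tendsto_const lim_1_over_n], of "v/2" "v\<^sup>2/4"] by simp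
qed simp

lemma n_times_iexp_second_order:
  fixes d :: real
  shows "(\<lambda>n. of_nat n * (iexp (d / sqrt (real n)) - 1 - \<i> * of_real (d / sqrt (real n)))) \<longlonglongrightarrow> - of_real (d\<^sup>2 / 2)"
proof (rule LIM_zero_cancel, rule Lim_null_comparison)
  show "\<forall>\<^sub>F n in sequentially. norm (of_nat n * (iexp (d / sqrt (real n)) - 1 - \<i> * of_real (d / sqrt (real n))) - - of_real (d\<^sup>2 / 2))
      \<le> \<bar>d\<bar>^3 / 6 * (1 / sqrt (real n))"
    using eventually_gt_at_top[of 0]
  proof eventually_elim
    case (elim n)
    define x where "x = d / sqrt (real n)"
    have x2: "real n * x\<^sup>2 = d\<^sup>2" using elim by (simp add: x_def power_divide)
    have ap: "cmod (iexp x - (\<Sum>k\<le>2. (\<i> * of_real x) ^ k / fact k)) \<le> \<bar>x\<bar> ^ 3 / fact 3"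
      using iexp_approx1[of x 2] by (simp add: numeral_3_eq_3)
    have sm: "(\<Sum>k\<le>2. (\<i> * complex_of_real x) ^ k / fact k) = 1 + \<i> * of_real x - of_real (x\<^sup>2) / 2"
      by (simp add: numeral_2_eq_2 power_mult_distrib)
    have "of_nat n * (iexp x - 1 - \<i> * of_real x) - - complex_of_real (d\<^sup>2 / 2)
      = of_nat n * (iexp x - (1 + \<i> * of_real x - of_real (x\<^sup>2) / 2))"
      unfolding x2[symmetric] by (simp add: algebra_simps)
    hence "norm (of_nat n * (iexp x - 1 - \<i> * of_real x) - - complex_of_real (d\<^sup>2 / 2))
       = real n * cmod (iexp x - (\<Sum>k\<le>2. (\<i> * of_real x) ^ k / fact k))"
      unfolding sm by (simp add: norm_mult)
    also have "\<dots> \<le> real n * (\<bar>x\<bar> ^ 3 / 6)"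
      using ap by (intro mult_left_mono) (auto simp: fact_numeral)
    also have "\<dots> = (real n * x\<^sup>2) * \<bar>x\<bar> / 6" by (simp add: power3_eq_cube power2_eq_square)
    also have "\<dots> = \<bar>d\<bar>^3 / 6 * (1 / sqrt (real n))"
      unfolding x2 by (simp add: x_def abs_divide power3_eq_cube power2_eq_square)
    finally show ?case by (simp add: x_def)
  qed
  have "(\<lambda>n. 1 / sqrt (real n)) \<longlonglongrightarrow> 0"
    using tendsto_inverse_0_at_top[OF filterlim_compose[OF sqrt_at_top filterlim_real_sequentially]]
    by (simp add: inverse_eq_divide)
  thus "(\<lambda>n. \<bar>d\<bar>^3 / 6 * (1 / sqrt (real n))) \<longlonglongrightarrow> 0"
    by (rule tendsto_mult_right_zero)
qed

context irreducible_markov_chain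
begin

text \<open>The factors \<open>q n i j\<close> compensate, to the order \<open>1 / n\<close>, the loss \<open>v i / (2 n)\<close> that \<open>exp (\<i> d / sqrt n)\<close>
  suffers in conditional mean; their conditional expectation is \<open>1 + \<rho> n i\<close> with \<open>n \<rho> n i \<rightarrow> 0\<close>.
  Therefore the expectation of the product \<open>Mk n n\<close> of \<open>n\<close> factors tends to one. The compensator
  \<open>exp (A n)\<close> in that product is a function of the occupation frequencies and converges almost surely
  to \<open>exp (\<sigma> / 2)\<close>; by dominated convergence it may be replaced by this constant.\<close>

lemma step_sum_characteristic_function:
  assumes d: "centred P d"
  shows "(\<lambda>n. expectation (\<lambda>\<omega>. iexp (step_sum X d n \<omega> / sqrt (real n))))
    \<longlonglongrightarrow> of_real (exp (- (\<Sum>i\<in>UNIV. \<pi> $ i * (\<Sum>j\<in>UNIV. P $ i $ j * (d i j)\<^sup>2)) / 2))"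
proof -
  define v where "v i = (\<Sum>j\<in>UNIV. P $ i $ j * (d i j)\<^sup>2)" for i
  define \<sigma> where "\<sigma> = (\<Sum>i\<in>UNIV. \<pi> $ i * v i)"
  have v0: "0 \<le> v i" for i using P_nonneg by (auto simp: v_def intro!: sum_nonneg)
  obtain V where V: "V > 0" "\<And>i. v i \<le> V"
    using bounded_on_finite_pairs[of "\<lambda>i _. v i"] by (metis real_norm_def abs_le_D1)
  define q where "q n i j = iexp (d i j / sqrt (real n)) * of_real (exp (v i / (2 * real n)))" for n :: nat and i j
  define \<rho> where "\<rho> n i = (\<Sum>j\<in>UNIV. P $ i $ j *\<^sub>R q n i j) - 1" for n i
  have \<rho>: "(\<lambda>n. of_nat n * \<rho> n i) \<longlonglongrightarrow> 0" for i
  proof -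
    have eq: "of_nat n * \<rho> n i = of_real (exp (v i / (2 * real n))) *
        (\<Sum>j\<in>UNIV. P $ i $ j *\<^sub>R (of_nat n * (iexp (d i j / sqrt (real n)) - 1 - \<i> * of_real (d i j / sqrt (real n)))))
        + of_real (real n * (exp (v i / (2 * real n)) - 1))" for n
    proof -
      have c1: "(\<Sum>j\<in>UNIV. P $ i $ j *\<^sub>R (\<i> * of_real (d i j / sqrt (real n)))) = 0"
      proof -
        have "(\<Sum>j\<in>UNIV. P $ i $ j *\<^sub>R (\<i> * of_real (d i j / sqrt (real n))))
          = \<i> * of_real ((\<Sum>j\<in>UNIV. P $ i $ j * d i j) / sqrt (real n))"
          by (simp add: scaleR_conv_of_real sum_distrib_left sum_divide_distrib mult_ac)
        also have "(\<Sum>j\<in>UNIV. P $ i $ j * d i j) = 0" using d by (simp add: centred_def)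
        finally show ?thesis by simp
      qed
      have c2: "(\<Sum>j\<in>UNIV. P $ i $ j *\<^sub>R (1::complex)) = 1"
        by (simp add: scaleR_sum_left[symmetric] P_row)
      have s1: "(\<Sum>j\<in>UNIV. P $ i $ j *\<^sub>R (of_nat n * (iexp (d i j / sqrt (real n)) - 1 - \<i> * of_real (d i j / sqrt (real n)))))
        = of_nat n * ((\<Sum>j\<in>UNIV. P $ i $ j *\<^sub>R iexp (d i j / sqrt (real n))) - 1)"
      proof -
        have "(\<Sum>j\<in>UNIV. P $ i $ j *\<^sub>R (of_nat n * (iexp (d i j / sqrt (real n)) - 1 - \<i> * of_real (d i j / sqrt (real n)))))
          = of_nat n * ((\<Sum>j\<in>UNIV. P $ i $ j *\<^sub>R iexp (d i j / sqrt (real n))) - (\<Sum>j\<in>UNIV. P $ i $ j *\<^sub>R (1::complex)) - (\<Sum>j\<in>UNIV. P $ i $ j *\<^sub>R (\<i> * of_real (d i j / sqrt (real n)))))"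
          unfolding sum_subtractf[symmetric] sum_distrib_left
          by (intro sum.cong refl) (simp add: scaleR_conv_of_real algebra_simps)
        thus ?thesis unfolding c1 c2 by simp
      qed
      have s2: "(\<Sum>j\<in>UNIV. P $ i $ j *\<^sub>R q n i j)
         = of_real (exp (v i / (2 * real n))) * (\<Sum>j\<in>UNIV. P $ i $ j *\<^sub>R iexp (d i j / sqrt (real n)))"
        unfolding sum_distrib_left q_def by (intro sum.cong refl) (simp add: scaleR_conv_of_real mult_ac)
      show ?thesis unfolding \<rho>_def s1 s2 by (simp add: algebra_simps)
    qed
    have e1: "(\<lambda>n. exp (v i / (2 * real n))) \<longlonglongrightarrow> exp 0"
    proof (rule tendsto_exp)
      have "(\<lambda>n. v i / 2 * (1 / real n)) \<longlonglongrightarrow> 0" by (rule tendsto_mult_right_zero[OF lim_1_over_n])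
      thus "(\<lambda>n. v i / (2 * real n)) \<longlonglongrightarrow> 0" by simp
    qed
    have "(\<lambda>n. of_nat n * \<rho> n i) \<longlonglongrightarrow> of_real (exp 0) * (\<Sum>j\<in>UNIV. P $ i $ j *\<^sub>R (- of_real ((d i j)\<^sup>2 / 2))) + of_real (v i / 2)"
      unfolding eq
      by (intro tendsto_add tendsto_mult tendsto_of_real tendsto_sum tendsto_scaleR tendsto_const
          e1 v0 n_times_iexp_second_order n_times_exp_minus_one)
    also have "of_real (exp 0) * (\<Sum>j\<in>UNIV. P $ i $ j *\<^sub>R (- complex_of_real ((d i j)\<^sup>2 / 2))) + of_real (v i / 2) = 0"
      by (simp add: v_def scaleR_conv_of_real sum_negf sum_divide_distrib)
    finally show ?thesis .
  qed
  define Mk where "Mk n k \<omega> = (\<Prod>l<k. q n (X l \<omega>) (X (Suc l) \<omega>))" for n k \<omega>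
  have Mk_le: "norm (Mk n k \<omega>) \<le> exp (V / 2)" if "k \<le> n" for n k \<omega>
  proof -
    have "norm (Mk n k \<omega>) \<le> (\<Prod>l<k. exp (V / (2 * real n)))"
      unfolding Mk_def prod_norm[symmetric]
      by (rule prod_mono) (auto simp: q_def norm_mult V intro: divide_right_mono)
    also have "\<dots> = exp (real k * (V / (2 * real n)))" by (simp add: exp_of_nat_mult[symmetric])
    also have "\<dots> \<le> exp (V / 2)"
    proof -
      have "V * real k \<le> V * real n" using that V by (intro mult_left_mono) auto
      thus ?thesis using that V by (cases "n = 0") (auto simp: field_simps)
    qed
    finally show ?thesis .
  qed
  have Mk_meas [measurable]: "Mk n k \<in> borel_measurable M" for n k
    unfolding Mk_def[abs_def] by measurable
  have Mk_int: "integrable M (Mk n k)" if "k \<le> n" for n k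
    by (rule integrable_bounded[OF Mk_meas Mk_le[OF that]])
  define r where "r n = (\<Sum>i\<in>UNIV. norm (\<rho> n i))" for n
  have \<rho>r: "norm (\<rho> n i) \<le> r n" for n i unfolding r_def by (rule member_le_sum) auto
  have step: "norm (expectation (Mk n (Suc k)) - expectation (Mk n k)) \<le> exp (V / 2) * r n" if "Suc k \<le> n" for n k
  proof -
    have i1: "integrable M (\<lambda>\<omega>. Mk n k \<omega> * \<rho> n (X k \<omega>))"
      using prod_step_integrable[where v="\<rho> n" and u="q n" and n=k, OF \<rho>r] by (simp add: Mk_def)
    have "expectation (Mk n (Suc k)) = expectation (\<lambda>\<omega>. Mk n k \<omega> * (1 + \<rho> n (X k \<omega>)))"
      using expectation_prod_Suc[of "q n" k] by (simp add: Mk_def[abs_def] \<rho>_def)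
    also have "\<dots> = expectation (Mk n k) + expectation (\<lambda>\<omega>. Mk n k \<omega> * \<rho> n (X k \<omega>))"
      using Mk_int[of k n] that i1 by (simp add: distrib_left)
    finally have "norm (expectation (Mk n (Suc k)) - expectation (Mk n k)) = norm (expectation (\<lambda>\<omega>. Mk n k \<omega> * \<rho> n (X k \<omega>)))"
      by simp
    also have "\<dots> \<le> expectation (\<lambda>\<omega>. norm (Mk n k \<omega> * \<rho> n (X k \<omega>)))" by (rule integral_norm_bound)
    also have "\<dots> \<le> expectation (\<lambda>\<omega>. exp (V / 2) * r n)"
    proof (rule integral_mono[OF integrable_norm[OF i1]])
      show "norm (Mk n k \<omega> * \<rho> n (X k \<omega>)) \<le> exp (V / 2) * r n" for \<omega>
        unfolding norm_mult using that by (intro mult_mono Mk_le \<rho>r) auto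
    qed simp
    also have "\<dots> = exp (V / 2) * r n" by (simp add: prob_space)
    finally show ?thesis .
  qed
  have tele: "norm (expectation (Mk n k) - 1) \<le> real k * (exp (V / 2) * r n)" if "k \<le> n" for n k
    using that
  proof (induction k)
    case 0 show ?case by (simp add: Mk_def prob_space)
  next
    case (Suc k)
    have "norm (expectation (Mk n (Suc k)) - 1) \<le> norm (expectation (Mk n (Suc k)) - expectation (Mk n k)) + norm (expectation (Mk n k) - 1)"
      using norm_triangle_ineq[of "expectation (Mk n (Suc k)) - expectation (Mk n k)" "expectation (Mk n k) - 1"] by simp
    also have "\<dots> \<le> exp (V / 2) * r n + real k * (exp (V / 2) * r n)"
      using Suc step[of k n] by (intro add_mono) auto
    finally show ?case by (simp add: algebra_simps)
  qed
  have nr: "(\<lambda>n. exp (V / 2) * (real n * r n)) \<longlonglongrightarrow> 0"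
  proof -
    have "(\<lambda>n. \<Sum>i\<in>UNIV. norm (of_nat n * \<rho> n i)) \<longlonglongrightarrow> (\<Sum>i\<in>(UNIV::'s set). 0)"
      by (intro tendsto_sum tendsto_norm_zero \<rho>)
    moreover have "(\<Sum>i\<in>UNIV. norm (of_nat n * \<rho> n i)) = real n * r n" for n
      by (simp add: r_def norm_mult sum_distrib_left)
    ultimately show ?thesis by (simp add: tendsto_mult_right_zero)
  qed
  have EM: "(\<lambda>n. expectation (Mk n n)) \<longlonglongrightarrow> 1"
  proof (rule LIM_zero_cancel, rule Lim_null_comparison[OF _ nr])
    show "\<forall>\<^sub>F n in sequentially. norm (expectation (Mk n n) - 1) \<le> exp (V / 2) * (real n * r n)"
      using tele by (auto simp: mult_ac)
  qed
  define A where "A n \<omega> = (\<Sum>i\<in>UNIV. v i * (real (departure_count X n \<omega> i) / real n)) / 2" for n \<omega>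
  have MkA: "Mk n n \<omega> = iexp (step_sum X d n \<omega> / sqrt (real n)) * of_real (exp (A n \<omega>))" for n \<omega>
  proof -
    have "(\<Sum>l<n. v (X l \<omega>)) = (\<Sum>l<n. \<Sum>i\<in>UNIV. v i * of_bool (X l \<omega> = i))"
      by (intro sum.cong refl) simp
    also have "\<dots> = (\<Sum>i\<in>UNIV. v i * real (departure_count X n \<omega> i))"
      unfolding departure_count_sum sum_distrib_left by (rule sum.swap)
    finally have "A n \<omega> = (\<Sum>l<n. v (X l \<omega>) / (2 * real n))"
      by (simp add: A_def sum_divide_distrib[symmetric] mult.commute)
    thus ?thesis
      by (simp add: Mk_def q_def prod.distrib step_sum_def exp_sum[symmetric] of_real_prod[symmetric]
           sum_divide_distrib sum_distrib_left del: of_real_exp of_real_prod)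
  qed
  \<comment> \<open>The error of replacing the compensator by its limit.\<close>
  define D where "D n \<omega> = iexp (step_sum X d n \<omega> / sqrt (real n)) - of_real (exp (- \<sigma> / 2)) * Mk n n \<omega>" for n \<omega>
  have Dm [measurable]: "D n \<in> borel_measurable M" for n unfolding D_def[abs_def] by measurable
  have \<sigma>0: "0 \<le> \<sigma>" unfolding \<sigma>_def
    by (intro sum_nonneg mult_nonneg_nonneg v0 order.strict_implies_order[OF \<pi>_pos])
  have Dle: "norm (D n \<omega>) \<le> 1 + exp (V / 2)" for n \<omega>
  proof -
    have "norm (D n \<omega>) \<le> 1 + exp (- \<sigma> / 2) * norm (Mk n n \<omega>)"
      unfolding D_def by (rule order_trans[OF norm_triangle_ineq4]) (simp add: norm_mult)
    also have "exp (- \<sigma> / 2) * norm (Mk n n \<omega>) \<le> 1 * exp (V / 2)"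
      using \<sigma>0 by (intro mult_mono Mk_le) auto
    finally show ?thesis by simp
  qed
  have "(\<lambda>n. expectation (D n)) \<longlonglongrightarrow> expectation (\<lambda>_. 0)"
  proof (rule integral_dominated_convergence[where w="\<lambda>_. 1 + exp (V / 2)"])
    show "AE \<omega> in M. (\<lambda>n. D n \<omega>) \<longlonglongrightarrow> 0"
      using occupation_frequency
    proof eventually_elim
      case (elim \<omega>)
      have "(\<lambda>n. A n \<omega>) \<longlonglongrightarrow> (\<Sum>i\<in>UNIV. v i * \<pi> $ i) / 2"
        unfolding A_def using elim by (intro tendsto_intros) auto
      hence "(\<lambda>n. 1 - exp (- \<sigma> / 2) * exp (A n \<omega>)) \<longlonglongrightarrow> 1 - exp (- \<sigma> / 2) * exp (\<sigma> / 2)"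
        by (intro tendsto_intros) (simp add: \<sigma>_def mult.commute)
      hence lim: "(\<lambda>n. \<bar>1 - exp (- \<sigma> / 2) * exp (A n \<omega>)\<bar>) \<longlonglongrightarrow> 0"
        by (simp add: exp_minus tendsto_rabs_zero)
      have "norm (D n \<omega>) = \<bar>1 - exp (- \<sigma> / 2) * exp (A n \<omega>)\<bar>" for n
      proof -
        have "D n \<omega> = iexp (step_sum X d n \<omega> / sqrt (real n)) * of_real (1 - exp (- \<sigma> / 2) * exp (A n \<omega>))"
          unfolding D_def MkA by (simp add: algebra_simps)
        thus ?thesis by (simp only: norm_mult norm_exp_i_times norm_of_real mult_1)
      qed
      thus ?case using lim by (simp add: tendsto_norm_zero_iff[of "\<lambda>n. D n \<omega>", symmetric])
    qed
  qed (auto simp: Dle)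
  hence ED: "(\<lambda>n. expectation (D n)) \<longlonglongrightarrow> 0" by simp
  have "expectation (\<lambda>\<omega>. iexp (step_sum X d n \<omega> / sqrt (real n))) = expectation (D n) + of_real (exp (- \<sigma> / 2)) * expectation (Mk n n)" for n
  proof -
    have "expectation (\<lambda>\<omega>. iexp (step_sum X d n \<omega> / sqrt (real n))) = expectation (\<lambda>\<omega>. D n \<omega> + of_real (exp (- \<sigma> / 2)) * Mk n n \<omega>)"
      by (simp add: D_def)
    also have "\<dots> = expectation (D n) + of_real (exp (- \<sigma> / 2)) * expectation (Mk n n)"
      using integrable_bounded[OF Dm Dle] Mk_int[of n n] by simp
    finally show ?thesis .
  qed
  moreover have "(\<lambda>n. expectation (D n) + of_real (exp (- \<sigma> / 2)) * expectation (Mk n n)) \<longlonglongrightarrow> 0 + of_real (exp (- \<sigma> / 2)) * 1"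
    by (intro tendsto_intros ED EM)
  ultimately show ?thesis by (simp add: \<sigma>_def v_def)
qed

end

section \<open>Convergence in distribution on Euclidean spaces\<close>

text \<open>Real trigonometric polynomials with arbitrary frequencies. They form an algebra that separates points
  (the addition theorems give the products), and their expectations are determined by the
  characteristic function.\<close>

inductive trig_poly :: "('v::euclidean_space \<Rightarrow> real) \<Rightarrow> bool" where
  cos: "trig_poly (\<lambda>x. cos (a \<bullet> x))"
| sin: "trig_poly (\<lambda>x. sin (a \<bullet> x))"
| add: "trig_poly f \<Longrightarrow> trig_poly g \<Longrightarrow> trig_poly (\<lambda>x. f x + g x)"
| scale: "trig_poly f \<Longrightarrow> trig_poly (\<lambda>x. c * f x)"

lemma trig_poly_const: "trig_poly (\<lambda>x. c)"
  using trig_poly.scale[OF trig_poly.cos[of 0], of c] by simp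

lemma trig_poly_diff: "trig_poly f \<Longrightarrow> trig_poly g \<Longrightarrow> trig_poly (\<lambda>x. f x - g x)"
  using trig_poly.add[of f "\<lambda>x. (-1) * g x"] trig_poly.scale[of g "-1"] by simp

lemma trig_poly_half: "trig_poly f \<Longrightarrow> trig_poly (\<lambda>x. f x / 2)"
  using trig_poly.scale[of f "1/2"] by simp

lemma trig_poly_mult_basic:
  assumes "trig_poly f"
  shows "trig_poly (\<lambda>x. f x * cos (b \<bullet> x)) \<and> trig_poly (\<lambda>x. f x * sin (b \<bullet> x))"
  using assms
proof induction
  case (cos a)
  show ?case
    unfolding cos_times_cos cos_times_sin inner_diff_left[symmetric] inner_add_left[symmetric]
    by (intro conjI trig_poly_half trig_poly.add trig_poly_diff trig_poly.cos trig_poly.sin)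
next
  case (sin a)
  show ?case
    unfolding sin_times_cos sin_times_sin inner_diff_left[symmetric] inner_add_left[symmetric]
    by (intro conjI trig_poly_half trig_poly.add trig_poly_diff trig_poly.cos trig_poly.sin)
next
  case (add f g)
  thus ?case by (simp add: distrib_right trig_poly.add)
next
  case (scale f c)
  thus ?case by (simp add: mult.assoc trig_poly.scale)
qed

lemma trig_poly_mult:
  assumes "trig_poly g" "trig_poly f"
  shows "trig_poly (\<lambda>x. f x * g x)"
  using assms
proof induction
  case (cos a) thus ?case using trig_poly_mult_basic by blast
next
  case (sin a) thus ?case using trig_poly_mult_basic by blast
next
  case (add f g) thus ?case by (simp add: distrib_left trig_poly.add)
next
  case (scale g c) thus ?case using trig_poly.scale[of "\<lambda>x. f x * g x" c] by (simp add: mult_ac)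
qed

lemma trig_poly_continuous: "trig_poly f \<Longrightarrow> continuous_on UNIV f"
  by (induction rule: trig_poly.induct) (auto intro!: continuous_intros)

lemma trig_poly_bounded: "trig_poly f \<Longrightarrow> \<exists>C. \<forall>x. \<bar>f x\<bar> \<le> C"
proof (induction rule: trig_poly.induct)
  case (cos a) thus ?case by (intro exI[of _ 1]) auto
next
  case (sin a) thus ?case by (intro exI[of _ 1]) auto
next
  case (add f g)
  then obtain C D where "\<And>x. \<bar>f x\<bar> \<le> C" "\<And>x. \<bar>g x\<bar> \<le> D" by blast
  thus ?case by (intro exI[of _ "C + D"]) (metis abs_triangle_ineq add_mono order_trans)
next
  case (scale f c)
  then obtain C where "\<And>x. \<bar>f x\<bar> \<le> C" by blast
  thus ?case by (intro exI[of _ "\<bar>c\<bar> * C"]) (simp add: abs_mult mult_left_mono)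
qed

lemma trig_poly_compose_polynomial:
  assumes "real_polynomial_function p" "trig_poly f"
  shows "trig_poly (\<lambda>x. p (f x))"
  using assms
proof induction
  case (linear h)
  have "h = (\<lambda>t. h 1 * t)"
  proof
    fix t :: real
    interpret bounded_linear h by fact
    show "h t = h 1 * t" using scaleR[of t 1] by simp
  qed
  thus ?case using trig_poly.scale[OF linear(2), of "h 1"] by (metis (no_types, lifting) ext)
next
  case (const c) thus ?case by (simp add: trig_poly_const)
next
  case (add g h) thus ?case by (simp add: trig_poly.add)
next
  case (mult g h) thus ?case by (simp add: trig_poly_mult)
qed

text \<open>Stone--Weierstrass gives an approximation \<open>g\<close> on the ball only; outside of it \<open>g\<close> is bounded, but by an
  uncontrolled constant. Composing \<open>g\<close> with a polynomial that is close, on the range of \<open>g\<close>, to the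
  truncation at the levels \<open>- B\<close> and \<open>B\<close> stays inside the algebra and restores the global bound.\<close>

lemma trig_poly_approximation:
  fixes f :: "'v::euclidean_space \<Rightarrow> real"
  assumes f: "continuous_on UNIV f" "\<And>x. \<bar>f x\<bar> \<le> B" and e: "\<epsilon> > 0"
  obtains g where "trig_poly g" "\<And>x. \<bar>g x\<bar> \<le> B + \<epsilon>" "\<And>x. norm x \<le> K \<Longrightarrow> \<bar>f x - g x\<bar> \<le> 2 * \<epsilon>"
proof -
  have B: "B \<ge> 0" using f(2)[of 0] by linarith
  have "\<exists>g. trig_poly g \<and> (\<forall>x\<in>cball 0 K. \<bar>f x - g x\<bar> < \<epsilon>)"
  proof (rule Stone_Weierstrass_HOL)
    show "\<exists>f. trig_poly f \<and> f x \<noteq> f y" if "x \<in> cball 0 K \<and> y \<in> cball 0 K \<and> x \<noteq> y" for x y :: 'v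
    proof -
      define d where "d = x - y"
      define s where "s = 1 / (d \<bullet> d)"
      have "d \<bullet> d > 0" using that by (simp add: d_def)
      hence "(s *\<^sub>R d) \<bullet> x - (s *\<^sub>R d) \<bullet> y = 1"
        by (simp add: d_def[symmetric] s_def inner_diff_right[symmetric] diff_divide_distrib[symmetric])
      hence e: "(s *\<^sub>R d) \<bullet> x = (s *\<^sub>R d) \<bullet> y + 1" by simp
      have "cos ((s *\<^sub>R d) \<bullet> x) \<noteq> cos ((s *\<^sub>R d) \<bullet> y) \<or> sin ((s *\<^sub>R d) \<bullet> x) \<noteq> sin ((s *\<^sub>R d) \<bullet> y)"
      proof (rule ccontr)
        define t where "t = (s *\<^sub>R d) \<bullet> y"
        assume "\<not> ?thesis"
        hence "cos (t + 1) = cos t" "sin (t + 1) = sin t" unfolding e t_def by auto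
        hence "cos ((t + 1) - t) = 1" unfolding cos_diff by (simp add: sin_cos_squared_add power2_eq_square[symmetric])
        moreover have "cos (1::real) < 1" using cos_monotone_0_pi[of 0 1] pi_gt3 by simp
        ultimately show False by simp
      qed
      thus ?thesis using trig_poly.cos trig_poly.sin by metis
    qed
    show "continuous_on (cball 0 K) f" using f(1) continuous_on_subset by blast
    show "trig_poly (\<lambda>x. c)" for c by (rule trig_poly_const)
    show "continuous_on (cball 0 K) h" if "trig_poly h" for h
      using continuous_on_subset[OF trig_poly_continuous[OF that]] by simp
    show "trig_poly (\<lambda>x. h x + k x)" if "trig_poly h \<and> trig_poly k" for h k
      using that trig_poly.add by blast
    show "trig_poly (\<lambda>x. h x * k x)" if "trig_poly h \<and> trig_poly k" for h k
      using that trig_poly_mult by blast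
  qed (use e in auto)
  then obtain g where g: "trig_poly g" "\<And>x. norm x \<le> K \<Longrightarrow> \<bar>f x - g x\<bar> < \<epsilon>" by auto
  obtain C where C: "\<And>x. \<bar>g x\<bar> \<le> C" using trig_poly_bounded[OF g(1)] by blast
  let ?clip = "\<lambda>t. max (- B) (min B t)"
  have "continuous_on {-C..C} ?clip" by (intro continuous_intros)
  then obtain p where p: "real_polynomial_function p" "\<And>t. t \<in> {-C..C} \<Longrightarrow> \<bar>?clip t - p t\<bar> < \<epsilon>"
    using Stone_Weierstrass_real_polynomial_function[of "{-C..C}" ?clip \<epsilon>] e by auto
  have gC: "g x \<in> {-C..C}" for x using C[of x] by auto
  show thesis
  proof
    show "trig_poly (\<lambda>x. p (g x))" by (rule trig_poly_compose_polynomial[OF p(1) g(1)])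
    show "\<bar>p (g x)\<bar> \<le> B + \<epsilon>" for x
      using p(2)[OF gC[of x]] B by (auto simp: max_def min_def split: if_splits)
    show "\<bar>f x - p (g x)\<bar> \<le> 2 * \<epsilon>" if "norm x \<le> K" for x
    proof -
      have "\<bar>f x - ?clip (g x)\<bar> \<le> \<epsilon>" using g(2)[OF that] f(2)[of x] B by (auto simp: max_def min_def)
      thus ?thesis using p(2)[OF gC[of x]] by linarith
    qed
  qed
qed

lemma (in prob_space) norm_tail:
  fixes Z :: "'a \<Rightarrow> 'v::euclidean_space"
  assumes [measurable]: "Z \<in> borel_measurable M" and e: "\<epsilon> > 0"
  obtains K where "K > 0" "prob {\<omega>\<in>space M. K < norm (Z \<omega>)} \<le> \<epsilon>"
proof -
  let ?A = "\<lambda>n::nat. {\<omega>\<in>space M. real n < norm (Z \<omega>)}"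
  have "(\<lambda>n. prob (?A n)) \<longlonglongrightarrow> prob (\<Inter>n. ?A n)"
  proof (rule finite_Lim_measure_decseq)
    show "range ?A \<subseteq> events" by auto
    show "decseq ?A" unfolding decseq_def by (intro allI impI Collect_mono) (meson le_less_trans of_nat_le_iff)
  qed
  moreover have "(\<Inter>n. ?A n) = {}"
  proof -
    have "\<exists>n. \<omega> \<notin> ?A n" for \<omega>
      using reals_Archimedean2[of "norm (Z \<omega>)"] by (auto simp: not_less intro: less_imp_le)
    thus ?thesis by blast
  qed
  ultimately have "(\<lambda>n. prob (?A n)) \<longlonglongrightarrow> 0" by simp
  from order_tendstoD(2)[OF this e] have "\<forall>\<^sub>F n in sequentially. prob (?A n) < \<epsilon>" .
  with eventually_gt_at_top[of 0] have "\<forall>\<^sub>F n in sequentially. n > 0 \<and> prob (?A n) < \<epsilon>"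
    by eventually_elim simp
  from eventually_happens'[OF sequentially_bot this]
  obtain n where n: "n > 0" "prob (?A n) < \<epsilon>" by (elim exE conjE)
  show thesis
    by (rule that[of "real n"]) (use n in auto)
qed

lemma (in prob_space) expectation_diff_le:
  fixes f g :: "'a \<Rightarrow> real"
  assumes [measurable]: "f \<in> borel_measurable M" "g \<in> borel_measurable M" and A: "A \<in> events"
    and B: "\<And>\<omega>. \<bar>f \<omega>\<bar> \<le> B" "\<And>\<omega>. \<bar>g \<omega>\<bar> \<le> C"
    and close: "\<And>\<omega>. \<omega> \<in> space M \<Longrightarrow> \<omega> \<notin> A \<Longrightarrow> \<bar>f \<omega> - g \<omega>\<bar> \<le> \<eta>" and \<eta>: "\<eta> \<ge> 0"
  shows "\<bar>expectation f - expectation g\<bar> \<le> \<eta> + (B + C) * prob A"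
proof -
  have i: "integrable M f" "integrable M g"
    using integrable_const_bound[of f B] integrable_const_bound[of g C] B by auto
  have "\<bar>expectation f - expectation g\<bar> = \<bar>expectation (\<lambda>\<omega>. f \<omega> - g \<omega>)\<bar>" using i by simp
  also have "\<dots> \<le> expectation (\<lambda>\<omega>. \<bar>f \<omega> - g \<omega>\<bar>)" by (rule integral_abs_bound)
  also have "\<dots> \<le> expectation (\<lambda>\<omega>. \<eta> + (B + C) * indicator A \<omega>)"
  proof (rule integral_mono)
    show "\<bar>f \<omega> - g \<omega>\<bar> \<le> \<eta> + (B + C) * indicator A \<omega>" if "\<omega> \<in> space M" for \<omega>
      using close[OF that] B(1)[of \<omega>] B(2)[of \<omega>] \<eta> by (auto simp: indicator_def)
  qed (use i A in \<open>auto simp: emeasure_eq_measure\<close>)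
  also have "\<dots> = \<eta> + (B + C) * prob A"
    using A by (subst Bochner_Integration.integral_add) (auto simp: emeasure_eq_measure prob_space)
  finally show ?thesis .
qed

lemma trig_poly_expectation_tendsto:
  fixes Y :: "nat \<Rightarrow> 'a \<Rightarrow> 'v::euclidean_space"
  assumes "prob_space M" "prob_space N"
    and [measurable]: "\<And>n. Y n \<in> borel_measurable M" "Z \<in> borel_measurable N"
    and char: "\<And>a. (\<lambda>n. \<integral>\<omega>. iexp (a \<bullet> Y n \<omega>) \<partial>M) \<longlonglongrightarrow> (\<integral>\<omega>. iexp (a \<bullet> Z \<omega>) \<partial>N)"
    and g: "trig_poly g"
  shows "(\<lambda>n. \<integral>\<omega>. g (Y n \<omega>) \<partial>M) \<longlonglongrightarrow> (\<integral>\<omega>. g (Z \<omega>) \<partial>N)"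
proof -
  interpret M: prob_space M by fact
  interpret N: prob_space N by fact
  have iM: "integrable M (\<lambda>\<omega>. iexp (a \<bullet> Y n \<omega>))" for a n
    by (rule M.integrable_const_bound[of _ 1]) auto
  have iN: "integrable N (\<lambda>\<omega>. iexp (a \<bullet> Z \<omega>))" for a
    by (rule N.integrable_const_bound[of _ 1]) auto
  have int: "integrable M (\<lambda>\<omega>. f (Y n \<omega>))" "integrable N (\<lambda>\<omega>. f (Z \<omega>))" if f: "trig_poly f" for f n
  proof -
    have [measurable]: "f \<in> borel_measurable borel"
      using trig_poly_continuous[OF f] by (rule borel_measurable_continuous_onI)
    obtain C where C: "\<And>x. \<bar>f x\<bar> \<le> C" using trig_poly_bounded[OF f] by blast
    show "integrable M (\<lambda>\<omega>. f (Y n \<omega>))" by (rule M.integrable_const_bound[of _ C]) (auto simp: C)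
    show "integrable N (\<lambda>\<omega>. f (Z \<omega>))" by (rule N.integrable_const_bound[of _ C]) (auto simp: C)
  qed
  show ?thesis using g
  proof induction
    case (cos a)
    have "(\<integral>\<omega>. cos (a \<bullet> Y n \<omega>) \<partial>M) = Re (\<integral>\<omega>. iexp (a \<bullet> Y n \<omega>) \<partial>M)" for n
      using integral_Re[OF iM[of a n]] by (simp add: Re_exp)
    moreover have "(\<integral>\<omega>. cos (a \<bullet> Z \<omega>) \<partial>N) = Re (\<integral>\<omega>. iexp (a \<bullet> Z \<omega>) \<partial>N)"
      using integral_Re[OF iN[of a]] by (simp add: Re_exp)
    ultimately show ?case using tendsto_Re[OF char[of a]] by simp
  next
    case (sin a)
    have "(\<integral>\<omega>. sin (a \<bullet> Y n \<omega>) \<partial>M) = Im (\<integral>\<omega>. iexp (a \<bullet> Y n \<omega>) \<partial>M)" for n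
      using integral_Im[OF iM[of a n]] by (simp add: Im_exp)
    moreover have "(\<integral>\<omega>. sin (a \<bullet> Z \<omega>) \<partial>N) = Im (\<integral>\<omega>. iexp (a \<bullet> Z \<omega>) \<partial>N)"
      using integral_Im[OF iN[of a]] by (simp add: Im_exp)
    ultimately show ?case using tendsto_Im[OF char[of a]] by simp
  next
    case (add f g)
    thus ?case by (simp add: int tendsto_add)
  next
    case (scale f c)
    thus ?case by (simp add: int tendsto_mult_left)
  qed
qed

text \<open>Replace \<open>f\<close> by a trigonometric polynomial that is close to it on a large ball and bounded by about the
  same constant outside. The ball carries almost all mass of every \<open>Y n\<close> and of \<open>Z\<close>, and the expectation
  of a trigonometric polynomial converges by assumption.\<close>

lemma levy_continuity_tight:
  fixes Y :: "nat \<Rightarrow> 'a \<Rightarrow> 'v::euclidean_space"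
  assumes "prob_space M" "prob_space N"
    and Y [measurable]: "\<And>n. Y n \<in> borel_measurable M" and Z [measurable]: "Z \<in> borel_measurable N"
    and char: "\<And>a. (\<lambda>n. \<integral>\<omega>. iexp (a \<bullet> Y n \<omega>) \<partial>M) \<longlonglongrightarrow> (\<integral>\<omega>. iexp (a \<bullet> Z \<omega>) \<partial>N)"
    and tight: "\<And>\<epsilon>. \<epsilon> > 0 \<Longrightarrow> \<exists>K. \<forall>\<^sub>F n in sequentially. measure M {\<omega>\<in>space M. K < norm (Y n \<omega>)} \<le> \<epsilon>"
  shows "converges_in_distribution M Y N Z"
  unfolding converges_in_distribution_def
proof (intro conjI allI impI Y Z)
  interpret M: prob_space M by fact
  interpret N: prob_space N by fact
  fix f :: "'v \<Rightarrow> real" assume f: "continuous_on UNIV f \<and> bounded (range f)"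
  have [measurable]: "f \<in> borel_measurable borel"
    using f by (auto intro: borel_measurable_continuous_onI)
  obtain B where B: "B > 0" "\<And>x. \<bar>f x\<bar> \<le> B" using f by (auto simp: bounded_pos)
  show "(\<lambda>n. \<integral>\<omega>. f (Y n \<omega>) \<partial>M) \<longlonglongrightarrow> (\<integral>\<omega>. f (Z \<omega>) \<partial>N)"
  proof (rule tendstoI)
    fix e :: real assume e: "e > 0"
    \<comment> \<open>The two approximation errors are \<open>\<epsilon> (2 B + 3)\<close> each, and convergence adds another \<open>\<epsilon>\<close>.\<close>
    define \<epsilon> where "\<epsilon> = min 1 (e / (4 * B + 8))"
    have \<epsilon>: "\<epsilon> > 0" "\<epsilon> \<le> 1" "\<epsilon> \<le> e / (4 * B + 8)"
      using e B(1) by (auto simp: \<epsilon>_def)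
    have \<epsilon>e: "\<epsilon> * (4 * B + 8) \<le> e" using \<epsilon>(3) B(1) by (simp add: pos_le_divide_eq)
    obtain K1 where K1: "\<forall>\<^sub>F n in sequentially. measure M {\<omega>\<in>space M. K1 < norm (Y n \<omega>)} \<le> \<epsilon>"
      using tight[OF \<epsilon>(1)] by blast
    obtain K2 where K2: "measure N {\<omega>\<in>space N. K2 < norm (Z \<omega>)} \<le> \<epsilon>"
      using N.norm_tail[OF Z \<epsilon>(1)] by blast
    obtain g where g: "trig_poly g" "\<And>x. \<bar>g x\<bar> \<le> B + \<epsilon>" "\<And>x. norm x \<le> max K1 K2 \<Longrightarrow> \<bar>f x - g x\<bar> \<le> 2 * \<epsilon>"
      using trig_poly_approximation[of f B \<epsilon> "max K1 K2"] f B \<epsilon>(1) by blast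
    have [measurable]: "g \<in> borel_measurable borel"
      using trig_poly_continuous[OF g(1)] by (rule borel_measurable_continuous_onI)
    have aux: "2 * \<epsilon> + (B + (B + \<epsilon>)) * p \<le> \<epsilon> * (2 * B + 3)" if "p \<le> \<epsilon>" "p \<ge> 0" for p
    proof -
      have "(B + (B + \<epsilon>)) * p \<le> (2 * B + 1) * \<epsilon>" using that B \<epsilon> by (intro mult_mono) auto
      thus ?thesis by (simp add: algebra_simps)
    qed
    have "\<bar>(\<integral>\<omega>. f (Z \<omega>) \<partial>N) - (\<integral>\<omega>. g (Z \<omega>) \<partial>N)\<bar> \<le> 2 * \<epsilon> + (B + (B + \<epsilon>)) * measure N {\<omega>\<in>space N. K2 < norm (Z \<omega>)}"
      using \<epsilon>(1) by (intro N.expectation_diff_le) (auto simp: B g)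
    hence dN: "\<bar>(\<integral>\<omega>. f (Z \<omega>) \<partial>N) - (\<integral>\<omega>. g (Z \<omega>) \<partial>N)\<bar> \<le> \<epsilon> * (2 * B + 3)"
      using aux[OF K2] by simp
    have "\<forall>\<^sub>F n in sequentially. \<bar>(\<integral>\<omega>. g (Y n \<omega>) \<partial>M) - (\<integral>\<omega>. g (Z \<omega>) \<partial>N)\<bar> < \<epsilon>"
      using tendstoD[OF trig_poly_expectation_tendsto[OF assms(1-5) g(1)] \<epsilon>(1)] by (simp add: dist_real_def)
    with K1 show "\<forall>\<^sub>F n in sequentially. dist (\<integral>\<omega>. f (Y n \<omega>) \<partial>M) (\<integral>\<omega>. f (Z \<omega>) \<partial>N) < e"
    proof eventually_elim
      case (elim n)
      have "\<bar>(\<integral>\<omega>. f (Y n \<omega>) \<partial>M) - (\<integral>\<omega>. g (Y n \<omega>) \<partial>M)\<bar> \<le> 2 * \<epsilon> + (B + (B + \<epsilon>)) * measure M {\<omega>\<in>space M. K1 < norm (Y n \<omega>)}"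
        using \<epsilon>(1) by (intro M.expectation_diff_le) (auto simp: B g)
      hence "\<bar>(\<integral>\<omega>. f (Y n \<omega>) \<partial>M) - (\<integral>\<omega>. g (Y n \<omega>) \<partial>M)\<bar> \<le> \<epsilon> * (2 * B + 3)"
        using aux[OF elim(1)] by simp
      moreover have "\<epsilon> * (2 * B + 3) + \<epsilon> * (2 * B + 3) + \<epsilon> < \<epsilon> * (4 * B + 8)"
        using \<epsilon>(1) by (simp add: algebra_simps)
      ultimately show ?case using dN elim(2) \<epsilon>e unfolding dist_real_def by linarith
    qed
  qed
qed

text \<open>A continuous cutoff function lies between the indicators of two tails, so the tails of \<open>Y n\<close> are
  eventually as small as those of the limit.\<close>

lemma converges_in_distribution_tight:
  fixes Y :: "nat \<Rightarrow> 'a \<Rightarrow> 'v::euclidean_space"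
  assumes "prob_space M" "prob_space N" and conv: "converges_in_distribution M Y N Z" and e: "\<epsilon> > 0"
  obtains K where "K > 0" "\<forall>\<^sub>F n in sequentially. measure M {\<omega>\<in>space M. K < norm (Y n \<omega>)} \<le> \<epsilon>"
proof -
  interpret M: prob_space M by fact
  interpret N: prob_space N by fact
  have [measurable]: "Y n \<in> borel_measurable M" "Z \<in> borel_measurable N" for n
    using conv by (auto simp: converges_in_distribution_def)
  obtain K where K: "K > 0" "measure N {\<omega>\<in>space N. K < norm (Z \<omega>)} \<le> \<epsilon> / 2"
    using N.norm_tail[of Z "\<epsilon> / 2"] e by auto
  define g :: "'v \<Rightarrow> real" where "g x = min 1 (max 0 (norm x - K))" for x
  have gc: "continuous_on UNIV g" unfolding g_def[abs_def] by (intro continuous_intros)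
  hence [measurable]: "g \<in> borel_measurable borel" by (rule borel_measurable_continuous_onI)
  have g01: "0 \<le> g x" "g x \<le> 1" for x by (auto simp: g_def)
  have ib: "integrable M (\<lambda>\<omega>. g (Y n \<omega>))" for n
    by (rule M.integrable_const_bound[of _ 1]) (use g01 in auto)
  have ibN: "integrable N (\<lambda>\<omega>. g (Z \<omega>))"
    by (rule N.integrable_const_bound[of _ 1]) (use g01 in auto)
  have "bounded (range g)" by (rule boundedI[of _ 1]) (use g01 in auto)
  hence lim: "(\<lambda>n. \<integral>\<omega>. g (Y n \<omega>) \<partial>M) \<longlonglongrightarrow> (\<integral>\<omega>. g (Z \<omega>) \<partial>N)"
    using conv gc by (auto simp: converges_in_distribution_def)
  have "(\<integral>\<omega>. g (Z \<omega>) \<partial>N) \<le> (\<integral>\<omega>. indicator {\<omega>\<in>space N. K < norm (Z \<omega>)} \<omega> \<partial>N)"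
    by (rule integral_mono[OF ibN]) (simp add: N.emeasure_eq_measure, simp add: g_def indicator_def)
  also have "\<dots> \<le> \<epsilon> / 2" using K(2) by simp
  finally have "(\<integral>\<omega>. g (Z \<omega>) \<partial>N) < \<epsilon>" using e by simp
  from order_tendstoD(2)[OF lim this]
  have "\<forall>\<^sub>F n in sequentially. measure M {\<omega>\<in>space M. K + 1 < norm (Y n \<omega>)} \<le> \<epsilon>"
  proof eventually_elim
    case (elim n)
    have "measure M {\<omega>\<in>space M. K + 1 < norm (Y n \<omega>)} = (\<integral>\<omega>. indicator {\<omega>\<in>space M. K + 1 < norm (Y n \<omega>)} \<omega> \<partial>M)" by simp
    also have "\<dots> \<le> (\<integral>\<omega>. g (Y n \<omega>) \<partial>M)"
      by (rule integral_mono[OF _ ib]) (simp add: M.emeasure_eq_measure, simp add: g_def indicator_def)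
    finally show ?case using elim by simp
  qed
  thus thesis using that[of "K + 1"] K(1) by simp
qed

text \<open>Stronger than uniform continuity on \<open>C\<close>, since \<open>y\<close> need not lie in \<open>C\<close>: in Slutsky's lemma only the
  approximating variable is confined to a compact set.\<close>

lemma continuous_near_compact:
  fixes f :: "'y::metric_space \<Rightarrow> real"
  assumes "continuous_on UNIV f" "compact C" "\<epsilon> > 0"
  shows "\<exists>\<delta>>0. \<forall>x\<in>C. \<forall>y. dist y x < \<delta> \<longrightarrow> \<bar>f y - f x\<bar> < \<epsilon>"
proof (rule ccontr)
  assume neg: "\<not> ?thesis"
  have "\<exists>x y. x \<in> C \<and> dist y x < inverse (real (Suc k)) \<and> \<not> \<bar>f y - f x\<bar> < \<epsilon>" for k
  proof -
    have "inverse (real (Suc k)) > 0" by simp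
    with neg show ?thesis by blast
  qed
  then obtain x y where xy: "\<And>k. x k \<in> C" "\<And>k. dist (y k) (x k) < inverse (real (Suc k))" "\<And>k. \<not> \<bar>f (y k) - f (x k)\<bar> < \<epsilon>"
    by metis
  obtain l r where l: "l \<in> C" "strict_mono (r :: nat \<Rightarrow> nat)" "(x \<circ> r) \<longlonglongrightarrow> l"
    using assms(2) xy(1) unfolding compact_def by blast
  have d0: "(\<lambda>k. dist (y k) (x k)) \<longlonglongrightarrow> 0"
  proof (rule tendsto_sandwich[OF _ _ tendsto_const LIMSEQ_inverse_real_of_nat])
    show "\<forall>\<^sub>F k in sequentially. dist (y k) (x k) \<le> inverse (real (Suc k))"
      by (rule always_eventually) (intro allI less_imp_le xy(2))
  qed simp
  have xl: "(\<lambda>k. x (r k)) \<longlonglongrightarrow> l" using l(3) by (simp add: o_def)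
  have yl: "(\<lambda>k. y (r k)) \<longlonglongrightarrow> l"
  proof (rule tendsto_dist_iff[THEN iffD2])
    have "(\<lambda>k. dist (x (r k)) l) \<longlonglongrightarrow> 0" using xl by (rule tendsto_dist_iff[THEN iffD1])
    moreover have "(\<lambda>k. dist (y (r k)) (x (r k))) \<longlonglongrightarrow> 0"
      using LIMSEQ_subseq_LIMSEQ[OF d0 l(2)] by (simp add: o_def)
    ultimately have lim: "(\<lambda>k. dist (y (r k)) (x (r k)) + dist (x (r k)) l) \<longlonglongrightarrow> 0 + 0"
      by (intro tendsto_add)
    show "(\<lambda>k. dist (y (r k)) l) \<longlonglongrightarrow> 0"
    proof (rule tendsto_sandwich[OF _ _ tendsto_const])
      show "\<forall>\<^sub>F k in sequentially. dist (y (r k)) l \<le> dist (y (r k)) (x (r k)) + dist (x (r k)) l"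
        by (rule always_eventually) (intro allI dist_triangle)
      show "(\<lambda>k. dist (y (r k)) (x (r k)) + dist (x (r k)) l) \<longlonglongrightarrow> 0" using lim by simp
    qed simp
  qed
  have fc: "isCont f l" using assms(1) by (simp add: continuous_on_eq_continuous_at)
  have "(\<lambda>k. f (y (r k)) - f (x (r k))) \<longlonglongrightarrow> f l - f l"
    by (intro tendsto_diff isCont_tendsto_compose[OF fc] xl yl)
  hence "(\<lambda>k. f (y (r k)) - f (x (r k))) \<longlonglongrightarrow> 0" by simp
  from tendstoD[OF this assms(3)] have "\<forall>\<^sub>F k in sequentially. False"
    by eventually_elim (use xy(3) in simp)
  thus False by simp
qed

text \<open>Slutsky's lemma and the continuous mapping theorem at once: \<open>V n\<close> may be compared with \<open>L (Y n)\<close> in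
  probability. By tightness \<open>Y n\<close> stays in a ball, whose image under \<open>L\<close> is compact, and a continuous
  test function oscillates little near a compact set.\<close>

lemma slutsky:
  fixes Y :: "nat \<Rightarrow> 'a \<Rightarrow> 'v::euclidean_space" and L :: "'v \<Rightarrow> 'y::real_normed_vector"
  assumes "prob_space M" "prob_space N" and conv: "converges_in_distribution M Y N Z"
    and L: "continuous_on UNIV L" and V: "\<And>n. V n \<in> borel_measurable M"
    and D: "\<And>n. (\<lambda>\<omega>. V n \<omega> - L (Y n \<omega>)) \<in> borel_measurable M"
    and small: "\<And>\<epsilon>. \<epsilon> > 0 \<Longrightarrow> (\<lambda>n. measure M {\<omega>\<in>space M. \<epsilon> < norm (V n \<omega> - L (Y n \<omega>))}) \<longlonglongrightarrow> 0"
  shows "converges_in_distribution M V N (\<lambda>\<omega>. L (Z \<omega>))"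
  unfolding converges_in_distribution_def
proof (intro conjI allI impI V)
  interpret M: prob_space M by fact
  interpret N: prob_space N by fact
  have [measurable]: "Y n \<in> borel_measurable M" "Z \<in> borel_measurable N" for n
    using conv by (auto simp: converges_in_distribution_def)
  have [measurable]: "L \<in> borel_measurable borel" using L by (rule borel_measurable_continuous_onI)
  note [measurable] = V D
  show "(\<lambda>\<omega>. L (Z \<omega>)) \<in> borel_measurable N" by measurable
  fix f :: "'y \<Rightarrow> real" assume f: "continuous_on UNIV f \<and> bounded (range f)"
  have [measurable]: "f \<in> borel_measurable borel"
    using f by (auto intro: borel_measurable_continuous_onI)
  obtain B where B: "B > 0" "\<And>x. \<bar>f x\<bar> \<le> B" using f by (auto simp: bounded_pos)
  have "continuous_on UNIV (\<lambda>x. f (L x))"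
    using continuous_on_compose[OF L, of f] f by (auto simp: o_def intro: continuous_on_subset)
  moreover have "bounded (range (\<lambda>x. f (L x)))" by (rule boundedI[of _ B]) (auto simp: B)
  ultimately have lim: "(\<lambda>n. \<integral>\<omega>. f (L (Y n \<omega>)) \<partial>M) \<longlonglongrightarrow> (\<integral>\<omega>. f (L (Z \<omega>)) \<partial>N)"
    using conv unfolding converges_in_distribution_def by (elim conjE allE[of _ "\<lambda>x. f (L x)"]) auto
  have "(\<lambda>n. (\<integral>\<omega>. f (V n \<omega>) \<partial>M) - (\<integral>\<omega>. f (L (Y n \<omega>)) \<partial>M)) \<longlonglongrightarrow> 0"
  proof (rule tendstoI)
    fix e :: real assume e: "e > 0"
    define \<epsilon> where "\<epsilon> = e / (4 * B + 2)"
    have \<epsilon>: "\<epsilon> > 0" "\<epsilon> * (4 * B + 2) = e"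
      using e B(1) by (auto simp: \<epsilon>_def field_simps)
    obtain K where K: "\<forall>\<^sub>F n in sequentially. measure M {\<omega>\<in>space M. K < norm (Y n \<omega>)} \<le> \<epsilon>"
      using converges_in_distribution_tight[OF assms(1-3) \<epsilon>(1)] by blast
    have "compact (L ` cball 0 K)" by (intro compact_continuous_image continuous_on_subset[OF L]) auto
    then obtain \<delta> where \<delta>: "\<delta> > 0" "\<And>x y. x \<in> L ` cball 0 K \<Longrightarrow> dist y x < \<delta> \<Longrightarrow> \<bar>f y - f x\<bar> < \<epsilon>"
      using continuous_near_compact[of f "L ` cball 0 K" \<epsilon>] f \<epsilon>(1) by metis
    have "\<forall>\<^sub>F n in sequentially. measure M {\<omega>\<in>space M. \<delta> / 2 < norm (V n \<omega> - L (Y n \<omega>))} < \<epsilon>"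
      using order_tendstoD(2)[OF small[of "\<delta> / 2"] \<epsilon>(1)] \<delta>(1) by simp
    with K show "\<forall>\<^sub>F n in sequentially. dist ((\<integral>\<omega>. f (V n \<omega>) \<partial>M) - (\<integral>\<omega>. f (L (Y n \<omega>)) \<partial>M)) 0 < e"
    proof eventually_elim
      case (elim n)
      let ?A = "{\<omega>\<in>space M. K < norm (Y n \<omega>)}" and ?B = "{\<omega>\<in>space M. \<delta> / 2 < norm (V n \<omega> - L (Y n \<omega>))}"
      have "\<bar>(\<integral>\<omega>. f (V n \<omega>) \<partial>M) - (\<integral>\<omega>. f (L (Y n \<omega>)) \<partial>M)\<bar> \<le> \<epsilon> + (B + B) * measure M (?A \<union> ?B)"
      proof (rule M.expectation_diff_le)
        fix \<omega> assume w: "\<omega> \<in> space M" "\<omega> \<notin> ?A \<union> ?B"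
        hence "L (Y n \<omega>) \<in> L ` cball 0 K" "dist (V n \<omega>) (L (Y n \<omega>)) < \<delta>"
          using \<delta>(1) by (auto simp: dist_norm)
        thus "\<bar>f (V n \<omega>) - f (L (Y n \<omega>))\<bar> \<le> \<epsilon>" using \<delta>(2) by (simp add: less_imp_le)
      qed (use B \<epsilon>(1) in auto)
      also have "measure M (?A \<union> ?B) \<le> measure M ?A + measure M ?B" by (rule measure_Un_le) measurable
      also have "\<dots> \<le> 2 * \<epsilon>" using elim by simp
      finally have "\<bar>(\<integral>\<omega>. f (V n \<omega>) \<partial>M) - (\<integral>\<omega>. f (L (Y n \<omega>)) \<partial>M)\<bar> \<le> \<epsilon> + (B + B) * (2 * \<epsilon>)"
        using B(1) by (simp add: mult_left_mono)
      also have "\<dots> < e" unfolding \<epsilon>(2)[symmetric] using \<epsilon>(1) by (simp add: algebra_simps)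
      finally show ?case by simp
    qed
  qed
  from tendsto_add[OF this lim] show "(\<lambda>n. \<integral>\<omega>. f (V n \<omega>) \<partial>M) \<longlonglongrightarrow> (\<integral>\<omega>. f (L (Z \<omega>)) \<partial>N)" by simp
qed

section \<open>The Gaussian limit matrix\<close>

lemma (in prob_space) gaussian_variable_measurable:
  assumes "gaussian_variable M Y"
  shows "Y \<in> borel_measurable M"
  using assms by (auto simp: gaussian_variable_def dest: distributed_measurable)

lemma (in prob_space) gaussian_variable_square_integrable:
  assumes "gaussian_variable M Y"
  shows "integrable M (\<lambda>\<omega>. (Y \<omega>)\<^sup>2)"
proof -
  note [measurable] = gaussian_variable_measurable[OF assms]
  consider (normal) \<mu> \<sigma> where "\<sigma> > 0" "distributed M lborel Y (normal_density \<mu> \<sigma>)"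
    | (const) \<mu> where "AE \<omega> in M. Y \<omega> = \<mu>"
    using assms by (auto simp: gaussian_variable_def)
  thus ?thesis
  proof cases
    case normal
    have "integrable lborel (\<lambda>x. normal_density \<mu> \<sigma> x * (x - \<mu>)^2)"
      by (rule integrable_normal_moment[OF normal(1)])
    hence "integrable M (\<lambda>\<omega>. (Y \<omega> - \<mu>)^2)"
      using distributed_integrable[OF normal(2), of "\<lambda>x. (x - \<mu>)^2"] by simp
    hence i: "integrable M (\<lambda>\<omega>. 2 * (Y \<omega> - \<mu>)^2 + 2 * \<mu>^2)" by simp
    show ?thesis
    proof (rule Bochner_Integration.integrable_bound[OF i])
      show "AE \<omega> in M. norm ((Y \<omega>)\<^sup>2) \<le> norm (2 * (Y \<omega> - \<mu>)^2 + 2 * \<mu>^2)"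
      proof (rule AE_I2)
        fix \<omega>
        have "(Y \<omega>)\<^sup>2 + (Y \<omega> - 2 * \<mu>)\<^sup>2 = 2 * (Y \<omega> - \<mu>)^2 + 2 * \<mu>^2"
          by (simp add: power2_eq_square algebra_simps)
        hence "(Y \<omega>)\<^sup>2 \<le> 2 * (Y \<omega> - \<mu>)^2 + 2 * \<mu>^2" by (smt (verit) zero_le_power2)
        thus "norm ((Y \<omega>)\<^sup>2) \<le> norm (2 * (Y \<omega> - \<mu>)^2 + 2 * \<mu>^2)" by simp
      qed
    qed simp
  next
    case const
    have "AE \<omega> in M. norm ((Y \<omega>)\<^sup>2) \<le> \<mu>\<^sup>2" using const by eventually_elim simp
    thus ?thesis by (intro integrable_const_bound) auto
  qed
qed

lemma (in prob_space) square_integrable_imp_integrable: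
  fixes Y :: "'a \<Rightarrow> real"
  assumes [measurable]: "Y \<in> borel_measurable M" and i: "integrable M (\<lambda>\<omega>. (Y \<omega>)\<^sup>2)"
  shows "integrable M Y"
proof (rule Bochner_Integration.integrable_bound[of M "\<lambda>\<omega>. (Y \<omega>)\<^sup>2 + 1"])
  have "\<bar>y\<bar> \<le> y\<^sup>2 + 1" for y :: real
  proof -
    have "0 \<le> (\<bar>y\<bar> - 1)\<^sup>2" by simp
    hence "2 * \<bar>y\<bar> \<le> y\<^sup>2 + 1" by (simp add: power2_diff)
    thus ?thesis using abs_ge_zero[of y] by linarith
  qed
  thus "AE \<omega> in M. norm (Y \<omega>) \<le> norm ((Y \<omega>)\<^sup>2 + 1)" by (intro AE_I2) simp
qed (use i in auto)

lemma (in prob_space) square_integrable_mult: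
  fixes Y Z :: "'a \<Rightarrow> real"
  assumes [measurable]: "Y \<in> borel_measurable M" "Z \<in> borel_measurable M"
    and i: "integrable M (\<lambda>\<omega>. (Y \<omega>)\<^sup>2)" "integrable M (\<lambda>\<omega>. (Z \<omega>)\<^sup>2)"
  shows "integrable M (\<lambda>\<omega>. Y \<omega> * Z \<omega>)"
proof (rule Bochner_Integration.integrable_bound[of M "\<lambda>\<omega>. (Y \<omega>)\<^sup>2 + (Z \<omega>)\<^sup>2"])
  have "\<bar>y * z\<bar> \<le> y\<^sup>2 + z\<^sup>2" for y z :: real
  proof -
    have "0 \<le> (\<bar>y\<bar> - \<bar>z\<bar>)\<^sup>2" by simp
    hence "2 * \<bar>y * z\<bar> \<le> y\<^sup>2 + z\<^sup>2" by (simp add: power2_diff abs_mult)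
    thus ?thesis using abs_ge_zero[of "y * z"] by linarith
  qed
  thus "AE \<omega> in M. norm (Y \<omega> * Z \<omega>) \<le> norm ((Y \<omega>)\<^sup>2 + (Z \<omega>)\<^sup>2)" by (intro AE_I2) simp
qed (use i in auto)

lemma (in prob_space) gaussian_characteristic_function:
  assumes g: "gaussian_variable M Y" and mean: "expectation Y = 0"
  shows "(\<integral>\<omega>. iexp (Y \<omega>) \<partial>M) = of_real (exp (- expectation (\<lambda>\<omega>. (Y \<omega>)\<^sup>2) / 2))"
proof -
  note [measurable] = gaussian_variable_measurable[OF g]
  consider (normal) \<mu> \<sigma> where "\<sigma> > 0" "distributed M lborel Y (normal_density \<mu> \<sigma>)"
    | (const) \<mu> where "AE \<omega> in M. Y \<omega> = \<mu>"
    using g by (auto simp: gaussian_variable_def)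
  thus ?thesis
  proof cases
    case normal
    have "\<mu> = 0" using normal_distributed_expectation[OF normal] mean by simp
    hence var: "expectation (\<lambda>\<omega>. (Y \<omega>)\<^sup>2) = \<sigma>\<^sup>2" using normal_distributed_variance[OF normal] mean by simp
    define Y' where "Y' \<omega> = Y \<omega> / \<sigma>" for \<omega>
    have D: "distributed M lborel Y' std_normal_density"
      using normal(2) unfolding normal_standard_normal_convert[OF normal(1)] \<open>\<mu> = 0\<close> by (simp add: Y'_def[abs_def])
    hence d: "distr M lborel Y' = std_normal_distribution" by (simp add: distributed_def)
    have [measurable]: "Y' \<in> borel_measurable M" unfolding Y'_def[abs_def] by measurable
    have "(\<integral>\<omega>. iexp (Y \<omega>) \<partial>M) = (\<integral>\<omega>. iexp (\<sigma> * Y' \<omega>) \<partial>M)" using normal(1) by (simp add: Y'_def)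
    also have "\<dots> = (\<integral>x. iexp (\<sigma> * x) \<partial>distr M lborel Y')" by (rule integral_distr[symmetric]) auto
    also have "\<dots> = char std_normal_distribution \<sigma>" unfolding d char_def ..
    also have "\<dots> = of_real (exp (- \<sigma>\<^sup>2 / 2))" by (simp add: char_std_normal_distribution)
    finally show ?thesis by (simp add: var)
  next
    case const
    have "expectation Y = expectation (\<lambda>_. \<mu>)" using const by (intro integral_cong_AE) auto
    hence "\<mu> = 0" using mean by (simp add: prob_space)
    have "expectation (\<lambda>\<omega>. (Y \<omega>)\<^sup>2) = expectation (\<lambda>_. 0)" using const \<open>\<mu> = 0\<close> by (intro integral_cong_AE) auto
    moreover have "(\<integral>\<omega>. iexp (Y \<omega>) \<partial>M) = (\<integral>\<omega>. 1 \<partial>M)" using const \<open>\<mu> = 0\<close> by (intro integral_cong_AE) auto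
    ultimately show ?thesis by (simp add: prob_space)
  qed
qed

lemma inner_matrix: "(a :: real^'m::finite^'n::finite) \<bullet> b = (\<Sum>i\<in>UNIV. \<Sum>j\<in>UNIV. a $ i $ j * b $ i $ j)"
  by (simp add: inner_vec_def)

context
  fixes N :: "'b measure" and P :: "real^'s^'s::finite" and \<pi> :: "real^'s" and W
  assumes lim: "gaussian_limit_matrix N P \<pi> W"
begin

interpretation N: prob_space N
  using lim by (simp add: gaussian_limit_matrix_def)

lemma gaussian_limit_measurable: "W \<in> borel_measurable N"
  using lim by (simp add: gaussian_limit_matrix_def gaussian_vector_def)

lemma gaussian_limit_inner_gaussian: "gaussian_variable N (\<lambda>\<omega>. a \<bullet> W \<omega>)"
  using lim by (simp add: gaussian_limit_matrix_def gaussian_vector_def)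

lemma gaussian_limit_entry:
  shows "(\<lambda>\<omega>. W \<omega> $ i $ j) \<in> borel_measurable N" "integrable N (\<lambda>\<omega>. (W \<omega> $ i $ j)\<^sup>2)"
proof -
  have "(axis i (axis j 1)) \<bullet> w = w $ i $ j" for w :: "real^'s^'s"
    by (simp add: inner_commute[of "axis i (axis j 1)"] inner_axis)
  with gaussian_limit_inner_gaussian[of "axis i (axis j 1)"]
  have "gaussian_variable N (\<lambda>\<omega>. W \<omega> $ i $ j)" by simp
  thus "(\<lambda>\<omega>. W \<omega> $ i $ j) \<in> borel_measurable N" "integrable N (\<lambda>\<omega>. (W \<omega> $ i $ j)\<^sup>2)"
    by (auto intro: N.gaussian_variable_measurable N.gaussian_variable_square_integrable)
qed

lemma gaussian_limit_inner_mean: "(\<integral>\<omega>. a \<bullet> W \<omega> \<partial>N) = 0"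
proof -
  have "integrable N (\<lambda>\<omega>. W \<omega> $ i $ j)" for i j
    using N.square_integrable_imp_integrable gaussian_limit_entry by blast
  moreover have "(\<integral>\<omega>. W \<omega> $ i $ j \<partial>N) = 0" for i j
    using lim by (simp add: gaussian_limit_matrix_def)
  ultimately show ?thesis by (simp add: inner_matrix)
qed

text \<open>Expanding the square gives a fourfold sum. Different rows are uncorrelated, so it collapses to one
  multinomial variance for each row.\<close>

lemma gaussian_limit_inner_variance:
  "(\<integral>\<omega>. (a \<bullet> W \<omega>)\<^sup>2 \<partial>N)
    = (\<Sum>i\<in>UNIV. 1 / \<pi> $ i * ((\<Sum>j\<in>UNIV. P $ i $ j * (a $ i $ j)\<^sup>2) - (\<Sum>j\<in>UNIV. P $ i $ j * a $ i $ j)\<^sup>2))"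
proof -
  have i2: "integrable N (\<lambda>\<omega>. W \<omega> $ i $ j * W \<omega> $ k $ l)" for i j k l
    by (intro N.square_integrable_mult gaussian_limit_entry)
  have cov: "(\<integral>\<omega>. W \<omega> $ i $ j * W \<omega> $ k $ l \<partial>N) = of_bool (i = k) * (1 / \<pi> $ i) * P $ i $ j * (of_bool (j = l) - P $ i $ l)" for i j k l
  proof -
    have "(\<integral>\<omega>. W \<omega> $ i $ j \<partial>N) = 0" for i j using lim by (simp add: gaussian_limit_matrix_def)
    hence "(\<integral>\<omega>. W \<omega> $ i $ j * W \<omega> $ k $ l \<partial>N) = covariance N (\<lambda>\<omega>. W \<omega> $ i $ j) (\<lambda>\<omega>. W \<omega> $ k $ l)"
      by (simp add: covariance_def)
    also have "\<dots> = of_bool (i = k) * (1 / \<pi> $ i) * P $ i $ j * (of_bool (j = l) - P $ i $ l)"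
      using lim unfolding gaussian_limit_matrix_def by blast
    finally show ?thesis .
  qed
  have "(a \<bullet> w)\<^sup>2 = (\<Sum>i\<in>UNIV. \<Sum>j\<in>UNIV. \<Sum>k\<in>UNIV. \<Sum>l\<in>UNIV. a $ i $ j * a $ k $ l * (w $ i $ j * w $ k $ l))" for w
    unfolding inner_matrix power2_eq_square sum_distrib_left sum_distrib_right
    by (intro sum.cong refl) (simp add: mult_ac)
  hence "(\<integral>\<omega>. (a \<bullet> W \<omega>)\<^sup>2 \<partial>N) = (\<Sum>i\<in>UNIV. \<Sum>j\<in>UNIV. \<Sum>k\<in>UNIV. \<Sum>l\<in>UNIV. a $ i $ j * a $ k $ l *
       (of_bool (i = k) * (1 / \<pi> $ i) * P $ i $ j * (of_bool (j = l) - P $ i $ l)))"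
    by (simp add: Bochner_Integration.integral_sum Bochner_Integration.integrable_sum i2 cov)
  also have "\<dots> = (\<Sum>i\<in>UNIV. \<Sum>j\<in>UNIV. \<Sum>l\<in>UNIV. a $ i $ j * a $ i $ l * ((1 / \<pi> $ i) * P $ i $ j * (of_bool (j = l) - P $ i $ l)))"
  proof (rule sum.cong[OF refl], rule sum.cong[OF refl])
    fix i j
    have "(\<Sum>k\<in>UNIV. \<Sum>l\<in>UNIV. a $ i $ j * a $ k $ l *
       (of_bool (i = k) * (1 / \<pi> $ i) * P $ i $ j * (of_bool (j = l) - P $ i $ l)))
      = (\<Sum>k\<in>UNIV. if k = i then (\<Sum>l\<in>UNIV. a $ i $ j * a $ i $ l * ((1 / \<pi> $ i) * P $ i $ j * (of_bool (j = l) - P $ i $ l))) else 0)"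
      by (intro sum.cong refl) auto
    thus "(\<Sum>k\<in>UNIV. \<Sum>l\<in>UNIV. a $ i $ j * a $ k $ l *
       (of_bool (i = k) * (1 / \<pi> $ i) * P $ i $ j * (of_bool (j = l) - P $ i $ l)))
      = (\<Sum>l\<in>UNIV. a $ i $ j * a $ i $ l * ((1 / \<pi> $ i) * P $ i $ j * (of_bool (j = l) - P $ i $ l)))"
      by simp
  qed
  also have "\<dots> = (\<Sum>i\<in>UNIV. 1 / \<pi> $ i * ((\<Sum>j\<in>UNIV. P $ i $ j * (a $ i $ j)\<^sup>2) - (\<Sum>j\<in>UNIV. P $ i $ j * a $ i $ j)\<^sup>2))"
  proof (intro sum.cong refl)
    fix i
    have "(\<Sum>l\<in>UNIV. a $ i $ j * a $ i $ l * ((1 / \<pi> $ i) * P $ i $ j * (of_bool (j = l) - P $ i $ l)))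
       = 1 / \<pi> $ i * (P $ i $ j * (a $ i $ j)\<^sup>2) - 1 / \<pi> $ i * (P $ i $ j * a $ i $ j * (\<Sum>l\<in>UNIV. P $ i $ l * a $ i $ l))" for j
    proof -
      have "(\<Sum>l\<in>UNIV. a $ i $ j * a $ i $ l * ((1 / \<pi> $ i) * P $ i $ j * (of_bool (j = l) - P $ i $ l)))
        = (\<Sum>l\<in>UNIV. (if l = j then 1 / \<pi> $ i * (P $ i $ j * (a $ i $ j)\<^sup>2) else 0) - 1 / \<pi> $ i * (P $ i $ j * a $ i $ j * (P $ i $ l * a $ i $ l)))"
        by (intro sum.cong refl) (auto simp: power2_eq_square algebra_simps)
      thus ?thesis by (simp add: sum_subtractf sum_distrib_left)
    qed
    thus "(\<Sum>j\<in>UNIV. \<Sum>l\<in>UNIV. a $ i $ j * a $ i $ l * ((1 / \<pi> $ i) * P $ i $ j * (of_bool (j = l) - P $ i $ l)))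
      = 1 / \<pi> $ i * ((\<Sum>j\<in>UNIV. P $ i $ j * (a $ i $ j)\<^sup>2) - (\<Sum>j\<in>UNIV. P $ i $ j * a $ i $ j)\<^sup>2)"
      by (simp only: sum_subtractf sum_distrib_left[symmetric] sum_distrib_right[symmetric] power2_eq_square right_diff_distrib)
  qed
  finally show ?thesis .
qed

lemma gaussian_limit_inner_zero:
  assumes "(\<Sum>i\<in>UNIV. 1 / \<pi> $ i * ((\<Sum>j\<in>UNIV. P $ i $ j * (a $ i $ j)\<^sup>2) - (\<Sum>j\<in>UNIV. P $ i $ j * a $ i $ j)\<^sup>2)) = 0"
  shows "AE \<omega> in N. a \<bullet> W \<omega> = 0"
proof -
  have "integrable N (\<lambda>\<omega>. (a \<bullet> W \<omega>)\<^sup>2)"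
    by (rule N.gaussian_variable_square_integrable[OF gaussian_limit_inner_gaussian])
  hence "AE \<omega> in N. (a \<bullet> W \<omega>)\<^sup>2 = 0"
    using gaussian_limit_inner_variance[of a] assms integral_nonneg_eq_0_iff_AE[of N "\<lambda>\<omega>. (a \<bullet> W \<omega>)\<^sup>2"]
    by simp
  thus ?thesis by simp
qed

text \<open>Row sums, and entries at which \<open>P\<close> vanishes, are linear functionals of \<open>W\<close> with variance zero.\<close>

lemma gaussian_limit_tangent:
  assumes P: "P \<in> stochastic_matrices"
  shows "AE \<omega> in N. W \<omega> \<in> tangent_space P"
proof -
  have row: "AE \<omega> in N. (\<Sum>j\<in>UNIV. W \<omega> $ k $ j) = 0" for k
  proof -
    define a :: "real^'s^'s" where "a = (\<chi> i j. of_bool (i = k))"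
    have "AE \<omega> in N. a \<bullet> W \<omega> = 0"
    proof (rule gaussian_limit_inner_zero, rule sum.neutral, rule ballI)
      fix i
      show "1 / \<pi> $ i * ((\<Sum>j\<in>UNIV. P $ i $ j * (a $ i $ j)\<^sup>2) - (\<Sum>j\<in>UNIV. P $ i $ j * a $ i $ j)\<^sup>2) = 0"
        using P by (cases "i = k") (auto simp: a_def stochastic_matrices_def)
    qed
    moreover have "a \<bullet> w = (\<Sum>j\<in>UNIV. w $ k $ j)" for w
    proof -
      have "a \<bullet> w = (\<Sum>i\<in>UNIV. if i = k then (\<Sum>j\<in>UNIV. w $ k $ j) else 0)"
        unfolding inner_matrix by (intro sum.cong refl) (auto simp: a_def)
      thus ?thesis by simp
    qed
    ultimately show ?thesis by simp
  qed
  have zero: "AE \<omega> in N. P $ k $ l = 0 \<longrightarrow> W \<omega> $ k $ l = 0" for k l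
  proof (cases "P $ k $ l = 0")
    case True
    have e: "axis k (axis l 1) $ i $ j = (of_bool (i = k \<and> j = l) :: real)" for i j
      by (auto simp: axis_def)
    have "AE \<omega> in N. axis k (axis l 1) \<bullet> W \<omega> = 0"
    proof (rule gaussian_limit_inner_zero, rule sum.neutral, rule ballI)
      fix i
      have z: "P $ i $ j * axis k (axis l 1) $ i $ j = 0" for j using True by (auto simp: e)
      hence "P $ i $ j * (axis k (axis l 1) $ i $ j)\<^sup>2 = 0" for j by (metis mult.assoc mult_zero_left power2_eq_square)
      with z show "1 / \<pi> $ i * ((\<Sum>j\<in>UNIV. P $ i $ j * (axis k (axis l 1) $ i $ j)\<^sup>2) - (\<Sum>j\<in>UNIV. P $ i $ j * axis k (axis l 1) $ i $ j)\<^sup>2) = 0"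
        by (simp only: sum.neutral_const) simp
    qed
    moreover have "axis k (axis l 1) \<bullet> w = w $ k $ l" for w :: "real^'s^'s"
      by (simp add: inner_commute[of "axis k (axis l 1)"] inner_axis)
    ultimately show ?thesis by simp
  qed simp
  have "AE \<omega> in N. (\<forall>k. (\<Sum>j\<in>UNIV. W \<omega> $ k $ j) = 0) \<and> (\<forall>k l. P $ k $ l = 0 \<longrightarrow> W \<omega> $ k $ l = 0)"
    using row zero by (simp add: AE_all_countable)
  thus ?thesis
    by eventually_elim (simp add: tangent_space_def vec_eq_iff matrix_vector_mult_def)
qed

end

section \<open>Asymptotic normality of the estimator\<close>

lemma (in prob_space) prob_tendsto_one:
  assumes A: "\<And>n. A n \<in> events" and ae: "AE \<omega> in M. \<forall>\<^sub>F n in sequentially. \<omega> \<in> A n"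
  shows "(\<lambda>n. prob (A n)) \<longlonglongrightarrow> 1"
proof -
  have "(\<lambda>n. expectation (indicator (A n) :: 'a \<Rightarrow> real)) \<longlonglongrightarrow> expectation (\<lambda>_. 1)"
  proof (rule integral_dominated_convergence[where w="\<lambda>_. 1"])
    show "AE \<omega> in M. (\<lambda>n. indicator (A n) \<omega> :: real) \<longlonglongrightarrow> 1"
      using ae
    proof eventually_elim
      case (elim \<omega>)
      hence "\<forall>\<^sub>F n in sequentially. (indicator (A n) \<omega> :: real) = 1" by eventually_elim simp
      thus ?case by (rule tendsto_eventually)
    qed
  qed (use A in \<open>auto simp: indicator_def\<close>)
  thus ?thesis using A by (simp add: prob_space)
qed

text \<open>The \<open>l\<^sup>1\<close> norm bounds the Euclidean norm, so a large norm forces one of finitely many coordinates to be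
  large.\<close>

lemma tight_coordinates:
  fixes Y :: "nat \<Rightarrow> 'a \<Rightarrow> 'v::euclidean_space"
  assumes "prob_space M" and [measurable]: "\<And>n. Y n \<in> borel_measurable M"
    and tight: "\<And>b \<epsilon>. b \<in> Basis \<Longrightarrow> \<epsilon> > 0 \<Longrightarrow> \<exists>K. \<forall>\<^sub>F n in sequentially. measure M {\<omega>\<in>space M. K \<le> \<bar>b \<bullet> Y n \<omega>\<bar>} \<le> \<epsilon>"
    and e: "\<epsilon> > 0"
  shows "\<exists>K. \<forall>\<^sub>F n in sequentially. measure M {\<omega>\<in>space M. K < norm (Y n \<omega>)} \<le> \<epsilon>"
proof -
  interpret prob_space M by fact
  define D where "D = real DIM('v)"
  have D: "D > 0" by (simp add: D_def)
  have "\<forall>b\<in>Basis. \<exists>K. \<forall>\<^sub>F n in sequentially. prob {\<omega>\<in>space M. K \<le> \<bar>b \<bullet> Y n \<omega>\<bar>} \<le> \<epsilon> / D"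
    using tight[of _ "\<epsilon> / D"] e D by simp
  then obtain K where K: "\<And>b. b \<in> Basis \<Longrightarrow> \<forall>\<^sub>F n in sequentially. prob {\<omega>\<in>space M. K b \<le> \<bar>b \<bullet> Y n \<omega>\<bar>} \<le> \<epsilon> / D"
    by (auto simp: bchoice_iff)
  have "\<forall>\<^sub>F n in sequentially. \<forall>b\<in>Basis. prob {\<omega>\<in>space M. K b \<le> \<bar>b \<bullet> Y n \<omega>\<bar>} \<le> \<epsilon> / D"
    using K by (simp add: eventually_ball_finite)
  hence "\<forall>\<^sub>F n in sequentially. prob {\<omega>\<in>space M. (\<Sum>b\<in>Basis. K b) < norm (Y n \<omega>)} \<le> \<epsilon>"
  proof eventually_elim
    case (elim n)
    have "{\<omega>\<in>space M. (\<Sum>b\<in>Basis. K b) < norm (Y n \<omega>)} \<subseteq> (\<Union>b\<in>Basis. {\<omega>\<in>space M. K b \<le> \<bar>b \<bullet> Y n \<omega>\<bar>})"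
    proof (rule subsetI, rule ccontr)
      fix \<omega> assume w: "\<omega> \<in> {\<omega>\<in>space M. (\<Sum>b\<in>Basis. K b) < norm (Y n \<omega>)}"
        and "\<omega> \<notin> (\<Union>b\<in>Basis. {\<omega>\<in>space M. K b \<le> \<bar>b \<bullet> Y n \<omega>\<bar>})"
      hence "\<bar>Y n \<omega> \<bullet> b\<bar> \<le> K b" if "b \<in> Basis" for b using that by (auto simp: inner_commute not_le less_imp_le)
      hence "(\<Sum>b\<in>Basis. \<bar>Y n \<omega> \<bullet> b\<bar>) \<le> (\<Sum>b\<in>Basis. K b)" by (rule sum_mono)
      with norm_le_l1[of "Y n \<omega>"] w show False by simp
    qed
    hence "prob {\<omega>\<in>space M. (\<Sum>b\<in>Basis. K b) < norm (Y n \<omega>)} \<le> prob (\<Union>b\<in>Basis. {\<omega>\<in>space M. K b \<le> \<bar>b \<bullet> Y n \<omega>\<bar>})"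
      by (rule finite_measure_mono) (auto intro!: sets.finite_UN)
    also have "\<dots> \<le> (\<Sum>b\<in>Basis. prob {\<omega>\<in>space M. K b \<le> \<bar>b \<bullet> Y n \<omega>\<bar>})"
      by (rule finite_measure_subadditive_finite) auto
    also have "\<dots> \<le> (\<Sum>b\<in>(Basis :: 'v set). \<epsilon> / D)" using elim by (intro sum_mono) auto
    also have "\<dots> = \<epsilon>" by (simp add: D_def)
    finally show ?case .
  qed
  thus ?thesis by blast
qed

context irreducible_markov_chain
begin

text \<open>The scaled error with the random normalisation \<open>N\<^sub>i(n)\<close> replaced by its asymptotic value \<open>n \<pi>\<^sub>i\<close>. It
  is linear in the noise, so its linear functionals are again normalised sums.\<close>

definition noise_matrix :: "nat \<Rightarrow> 'a \<Rightarrow> real^'s^'s" where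
  "noise_matrix n \<omega> = (\<chi> i j. step_sum X (transition_noise P i j) n \<omega> / (sqrt (real n) * \<pi> $ i))"

text \<open>The centred function whose normalised sum is the functional \<open>a\<close> of the noise matrix.\<close>

definition dual_noise :: "real^'s^'s \<Rightarrow> 's \<Rightarrow> 's \<Rightarrow> real" where
  "dual_noise a x y = (a $ x $ y - (\<Sum>j\<in>UNIV. P $ x $ j * a $ x $ j)) / \<pi> $ x"

lemma centred_dual_noise: "centred P (dual_noise a)"
  unfolding centred_def
proof
  fix i
  have "(\<Sum>j\<in>UNIV. P $ i $ j * dual_noise a i j)
     = ((\<Sum>j\<in>UNIV. P $ i $ j * a $ i $ j) - (\<Sum>j\<in>UNIV. P $ i $ j) * (\<Sum>j\<in>UNIV. P $ i $ j * a $ i $ j)) / \<pi> $ i"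
    unfolding dual_noise_def sum_distrib_right sum_subtractf[symmetric] sum_divide_distrib
    by (intro sum.cong refl) (simp add: right_diff_distrib)
  thus "(\<Sum>j\<in>UNIV. P $ i $ j * dual_noise a i j) = 0" by (simp add: P_row)
qed

lemma inner_noise_matrix: "a \<bullet> noise_matrix n \<omega> = step_sum X (dual_noise a) n \<omega> / sqrt (real n)"
proof -
  have d: "dual_noise a x y = (\<Sum>i\<in>UNIV. \<Sum>j\<in>UNIV. a $ i $ j / \<pi> $ i * transition_noise P i j x y)" for x y
  proof -
    have "(\<Sum>i\<in>UNIV. \<Sum>j\<in>UNIV. a $ i $ j / \<pi> $ i * transition_noise P i j x y)
       = (\<Sum>i\<in>UNIV. if i = x then (\<Sum>j\<in>UNIV. a $ x $ j / \<pi> $ x * (of_bool (y = j) - P $ x $ j)) else 0)"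
      by (intro sum.cong refl) (auto simp: transition_noise_def)
    also have "\<dots> = (\<Sum>j\<in>UNIV. (if j = y then a $ x $ y / \<pi> $ x else 0) - P $ x $ j * a $ x $ j / \<pi> $ x)"
      by simp (intro sum.cong refl, auto simp: right_diff_distrib diff_divide_distrib)
    also have "\<dots> = dual_noise a x y"
      by (simp add: dual_noise_def sum_subtractf diff_divide_distrib sum_divide_distrib)
    finally show ?thesis ..
  qed
  have "step_sum X (dual_noise a) n \<omega> = (\<Sum>i\<in>UNIV. \<Sum>j\<in>UNIV. a $ i $ j / \<pi> $ i * step_sum X (transition_noise P i j) n \<omega>)"
    unfolding step_sum_def d sum_distrib_left
    by (subst sum.swap, rule sum.cong[OF refl], rule sum.swap)
  hence "step_sum X (dual_noise a) n \<omega> / sqrt (real n)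
     = (\<Sum>i\<in>UNIV. \<Sum>j\<in>UNIV. a $ i $ j / \<pi> $ i * step_sum X (transition_noise P i j) n \<omega> / sqrt (real n))"
    by (simp only: sum_divide_distrib)
  also have "\<dots> = a \<bullet> noise_matrix n \<omega>"
    unfolding inner_matrix by (intro sum.cong refl) (simp add: noise_matrix_def)
  finally show ?thesis ..
qed

lemma dual_noise_variance:
  "\<pi> $ i * (\<Sum>j\<in>UNIV. P $ i $ j * (dual_noise a i j)\<^sup>2)
   = 1 / \<pi> $ i * ((\<Sum>j\<in>UNIV. P $ i $ j * (a $ i $ j)\<^sup>2) - (\<Sum>j\<in>UNIV. P $ i $ j * a $ i $ j)\<^sup>2)"
proof -
  define m where "m = (\<Sum>j\<in>UNIV. P $ i $ j * a $ i $ j)"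
  have "(\<Sum>j\<in>UNIV. P $ i $ j * (a $ i $ j - m)\<^sup>2)
     = (\<Sum>j\<in>UNIV. P $ i $ j * (a $ i $ j)\<^sup>2) - 2 * m * (\<Sum>j\<in>UNIV. P $ i $ j * a $ i $ j) + m\<^sup>2 * (\<Sum>j\<in>UNIV. P $ i $ j)"
    unfolding sum_distrib_left sum_subtractf[symmetric] sum.distrib[symmetric]
    by (intro sum.cong refl) (simp add: power2_eq_square algebra_simps)
  also have "\<dots> = (\<Sum>j\<in>UNIV. P $ i $ j * (a $ i $ j)\<^sup>2) - m\<^sup>2"
    by (simp add: P_row m_def[symmetric] power2_eq_square)
  finally have v: "(\<Sum>j\<in>UNIV. P $ i $ j * (a $ i $ j - m)\<^sup>2) = (\<Sum>j\<in>UNIV. P $ i $ j * (a $ i $ j)\<^sup>2) - m\<^sup>2" .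
  have "(\<Sum>j\<in>UNIV. P $ i $ j * (dual_noise a i j)\<^sup>2) = (\<Sum>j\<in>UNIV. P $ i $ j * (a $ i $ j - m)\<^sup>2) / (\<pi> $ i)\<^sup>2"
    unfolding dual_noise_def m_def[symmetric] sum_divide_distrib by (intro sum.cong refl) (simp add: power_divide)
  thus ?thesis using \<pi>_pos[of i] unfolding v unfolding m_def by (simp add: power2_eq_square)
qed

lemma noise_matrix_measurable [measurable]: "noise_matrix n \<in> borel_measurable M"
  by (rule matrix_borel_measurableI) (simp add: noise_matrix_def)

lemma noise_matrix_tight:
  assumes e: "\<epsilon> > 0"
  shows "\<exists>K. \<forall>\<^sub>F n in sequentially. prob {\<omega>\<in>space M. K \<le> \<bar>b \<bullet> noise_matrix n \<omega>\<bar>} \<le> \<epsilon>"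
proof -
  obtain c where c: "c > 0" "\<And>i j. norm (dual_noise b i j) \<le> c" using bounded_on_finite_pairs by blast
  \<comment> \<open>For \<open>l = 1 / sqrt n\<close> the tail bound at the level \<open>K sqrt n\<close> is \<open>2 exp (c\<^sup>2 - K) = \<epsilon>\<close>.\<close>
  define K where "K = c\<^sup>2 - ln (\<epsilon> / 2)"
  obtain n0 :: nat where n0: "real n0 \<ge> c\<^sup>2" using real_arch_simple by blast
  have "\<forall>\<^sub>F n in sequentially. prob {\<omega>\<in>space M. K \<le> \<bar>b \<bullet> noise_matrix n \<omega>\<bar>} \<le> \<epsilon>"
    using eventually_ge_at_top[of n0] eventually_gt_at_top[of 0]
  proof eventually_elim
    case (elim n)
    have s: "sqrt (real n) > 0" "c \<le> sqrt (real n)"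
      using elim n0 c(1) by (auto intro!: real_le_rsqrt order_trans[OF n0])
    have "prob {\<omega>\<in>space M. K * sqrt (real n) \<le> \<bar>step_sum X (dual_noise b) n \<omega>\<bar>}
       \<le> 2 * exp (real n * ((1 / sqrt (real n)) * c)\<^sup>2 - (1 / sqrt (real n)) * (K * sqrt (real n)))"
      using c s by (intro step_sum_tail centred_dual_noise) (auto simp: field_simps)
    also have "real n * ((1 / sqrt (real n)) * c)\<^sup>2 - (1 / sqrt (real n)) * (K * sqrt (real n)) = ln (\<epsilon> / 2)"
      using s elim by (simp add: power_mult_distrib power_divide K_def)
    also have "2 * exp (ln (\<epsilon> / 2)) = \<epsilon>" using e by simp
    also have "{\<omega>\<in>space M. K * sqrt (real n) \<le> \<bar>step_sum X (dual_noise b) n \<omega>\<bar>}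
       = {\<omega>\<in>space M. K \<le> \<bar>b \<bullet> noise_matrix n \<omega>\<bar>}"
      using s by (simp add: inner_noise_matrix abs_divide pos_le_divide_eq)
    finally show ?case .
  qed
  thus ?thesis by blast
qed

lemma noise_matrix_limit:
  assumes W: "gaussian_limit_matrix N P \<pi> W"
  shows "converges_in_distribution M noise_matrix N W"
proof (rule levy_continuity_tight)
  show N: "prob_space N" using W by (simp add: gaussian_limit_matrix_def)
  then interpret N: prob_space N .
  show "W \<in> borel_measurable N" by (rule gaussian_limit_measurable[OF W])
  show "(\<lambda>n. \<integral>\<omega>. iexp (a \<bullet> noise_matrix n \<omega>) \<partial>M) \<longlonglongrightarrow> (\<integral>\<omega>. iexp (a \<bullet> W \<omega>) \<partial>N)" for a
    unfolding inner_noise_matrix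
      N.gaussian_characteristic_function[OF gaussian_limit_inner_gaussian[OF W] gaussian_limit_inner_mean[OF W]]
      gaussian_limit_inner_variance[OF W]
    using step_sum_characteristic_function[OF centred_dual_noise[of a]]
    by (simp only: dual_noise_variance)
  show "\<exists>K. \<forall>\<^sub>F n in sequentially. prob {\<omega>\<in>space M. K < norm (noise_matrix n \<omega>)} \<le> \<epsilon>" if "\<epsilon> > 0" for \<epsilon>
    by (rule tight_coordinates[OF prob_space_axioms noise_matrix_measurable noise_matrix_tight that])
qed (simp_all add: prob_space_axioms)

lemma scaled_error_measurable [measurable]: "scaled_error P X n \<in> borel_measurable M"
  unfolding scaled_error_def[abs_def] by measurable

text \<open>Entrywise, the scaled error is the noise matrix multiplied by \<open>n \<pi>\<^sub>i / N\<^sub>i(n)\<close>.\<close>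

lemma scaled_error_minus_noise_matrix:
  assumes n: "n > 0" and obs: "\<And>i. departure_count X n \<omega> i > 0"
    and c: "\<And>i. \<bar>real n * \<pi> $ i / real (departure_count X n \<omega> i) - 1\<bar> \<le> c"
  shows "norm (scaled_error P X n \<omega> - noise_matrix n \<omega>) \<le> c * norm (noise_matrix n \<omega>)"
proof -
  have c0: "0 \<le> c" using c[of undefined] by linarith
  have e: "(scaled_error P X n \<omega> - noise_matrix n \<omega>) $ i $ j
     = (real n * \<pi> $ i / real (departure_count X n \<omega> i) - 1) * noise_matrix n \<omega> $ i $ j" for i j
  proof -
    have "scaled_error P X n \<omega> $ i $ j = sqrt (real n) * (step_sum X (transition_noise P i j) n \<omega> / real (departure_count X n \<omega> i))"
      using mle_minus_P[OF obs] by (simp add: scaled_error_def)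
    also have "sqrt (real n) = real n / sqrt (real n)" by (rule real_div_sqrt[symmetric]) simp
    also have "real n / sqrt (real n) * (step_sum X (transition_noise P i j) n \<omega> / real (departure_count X n \<omega> i))
       = (real n * \<pi> $ i / real (departure_count X n \<omega> i)) * noise_matrix n \<omega> $ i $ j"
      using \<pi>_pos[of i] by (simp add: noise_matrix_def)
    finally show ?thesis by (simp add: left_diff_distrib)
  qed
  have "norm (scaled_error P X n \<omega> - noise_matrix n \<omega>) \<le> norm (c *\<^sub>R noise_matrix n \<omega>)"
  proof (rule norm_le_componentwise_cart, rule norm_le_componentwise_cart)
    fix i j
    show "norm ((scaled_error P X n \<omega> - noise_matrix n \<omega>) $ i $ j) \<le> norm ((c *\<^sub>R noise_matrix n \<omega>) $ i $ j)"
      unfolding e using c[of i] c0 by (simp add: abs_mult mult_right_mono)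
  qed
  thus ?thesis using c0 by simp
qed

lemma prob_occupation_close:
  assumes "\<eta> > 0"
  shows "(\<lambda>n. prob {\<omega>\<in>space M. \<forall>i. 0 < real (departure_count X n \<omega> i)
      \<and> \<bar>real n * \<pi> $ i / real (departure_count X n \<omega> i) - 1\<bar> \<le> \<eta>}) \<longlonglongrightarrow> 1"
proof (rule prob_tendsto_one)
  show "AE \<omega> in M. \<forall>\<^sub>F n in sequentially. \<omega> \<in> {\<omega>\<in>space M. \<forall>i. 0 < real (departure_count X n \<omega> i)
      \<and> \<bar>real n * \<pi> $ i / real (departure_count X n \<omega> i) - 1\<bar> \<le> \<eta>}"
    using occupation_frequency AE_all_rows_observed AE_space
  proof eventually_elim
    case (elim \<omega>)
    have "\<forall>\<^sub>F n in sequentially. \<bar>real n * \<pi> $ i / real (departure_count X n \<omega> i) - 1\<bar> \<le> \<eta>" for i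
    proof -
      have "(\<lambda>n. \<pi> $ i / (real (departure_count X n \<omega> i) / real n)) \<longlonglongrightarrow> \<pi> $ i / \<pi> $ i"
        using elim \<pi>_pos[of i] by (intro tendsto_divide tendsto_const) auto
      hence "(\<lambda>n. real n * \<pi> $ i / real (departure_count X n \<omega> i)) \<longlonglongrightarrow> 1"
        using \<pi>_pos[of i] by (simp add: mult.commute)
      from tendstoD[OF this assms] show ?thesis by eventually_elim (simp add: dist_real_def)
    qed
    hence "\<forall>\<^sub>F n in sequentially. \<forall>i. \<bar>real n * \<pi> $ i / real (departure_count X n \<omega> i) - 1\<bar> \<le> \<eta>"
      by (simp add: eventually_all_finite)
    with elim(2) show ?case by eventually_elim (use elim(3) in auto)
  qed
qed measurable

text \<open>The noise matrix is tight and the factors \<open>n \<pi>\<^sub>i / N\<^sub>i(n)\<close> tend to one almost surely, so its distance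
  to the scaled error tends to zero in probability.\<close>

theorem scaled_error_limit:
  assumes W: "gaussian_limit_matrix N P \<pi> W"
  shows "converges_in_distribution M (scaled_error P X) N W"
proof -
  have N: "prob_space N" using W by (simp add: gaussian_limit_matrix_def)
  note conv = noise_matrix_limit[OF W]
  have "converges_in_distribution M (scaled_error P X) N (\<lambda>\<omega>. (\<lambda>w. w) (W \<omega>))"
  proof (rule slutsky[OF prob_space_axioms N conv])
    fix \<epsilon> :: real assume e: "\<epsilon> > 0"
    show "(\<lambda>n. prob {\<omega>\<in>space M. \<epsilon> < norm (scaled_error P X n \<omega> - noise_matrix n \<omega>)}) \<longlonglongrightarrow> 0"
    proof (rule tendstoI)
      fix \<delta> :: real assume d: "\<delta> > 0"
      obtain K where K: "K > 0" "\<forall>\<^sub>F n in sequentially. prob {\<omega>\<in>space M. K < norm (noise_matrix n \<omega>)} \<le> \<delta> / 2"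
        using converges_in_distribution_tight[OF prob_space_axioms N conv, of "\<delta> / 2"] d by auto
      define \<eta> where "\<eta> = \<epsilon> / K"
      have \<eta>: "\<eta> > 0" using e K(1) by (simp add: \<eta>_def)
      let ?G = "\<lambda>n. {\<omega>\<in>space M. \<forall>i. 0 < real (departure_count X n \<omega> i)
          \<and> \<bar>real n * \<pi> $ i / real (departure_count X n \<omega> i) - 1\<bar> \<le> \<eta>}"
      have G [measurable]: "?G n \<in> events" for n by measurable
      have "\<forall>\<^sub>F n in sequentially. prob (?G n) > 1 - \<delta> / 2"
        using order_tendstoD(1)[OF prob_occupation_close[OF \<eta>]] d by simp
      with K(2) eventually_gt_at_top[of 0]
      show "\<forall>\<^sub>F n in sequentially. dist (prob {\<omega>\<in>space M. \<epsilon> < norm (scaled_error P X n \<omega> - noise_matrix n \<omega>)}) 0 < \<delta>"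
      proof eventually_elim
        case (elim n)
        let ?T = "{\<omega>\<in>space M. K < norm (noise_matrix n \<omega>)}"
        have "{\<omega>\<in>space M. \<epsilon> < norm (scaled_error P X n \<omega> - noise_matrix n \<omega>)} \<subseteq> ?T \<union> (space M - ?G n)"
        proof (rule subsetI, rule ccontr)
          fix \<omega> assume w: "\<omega> \<in> {\<omega>\<in>space M. \<epsilon> < norm (scaled_error P X n \<omega> - noise_matrix n \<omega>)}"
            and nw: "\<omega> \<notin> ?T \<union> (space M - ?G n)"
          have "norm (scaled_error P X n \<omega> - noise_matrix n \<omega>) \<le> \<eta> * norm (noise_matrix n \<omega>)"
            using w nw elim(2) by (intro scaled_error_minus_noise_matrix) auto
          also have "\<dots> \<le> \<eta> * K" using w nw \<eta> by (intro mult_left_mono) auto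
          also have "\<dots> = \<epsilon>" using K(1) by (simp add: \<eta>_def)
          finally show False using w by simp
        qed
        hence "prob {\<omega>\<in>space M. \<epsilon> < norm (scaled_error P X n \<omega> - noise_matrix n \<omega>)} \<le> prob (?T \<union> (space M - ?G n))"
          by (rule finite_measure_mono) measurable
        also have "\<dots> \<le> prob ?T + prob (space M - ?G n)" by (rule measure_Un_le) measurable
        also have "prob (space M - ?G n) = 1 - prob (?G n)" by (rule prob_compl[OF G])
        finally show ?case using elim by (simp add: dist_real_def)
      qed
    qed
  qed (auto intro: continuous_on_id)
  thus ?thesis by simp
qed

end

section \<open>Iterated Frechet differentials\<close>

text \<open>The common ground of \<open>C\<^sup>r\<close> maps and analytic maps: plain differentiability of all differentials of
  lower order, without continuity of the highest one.\<close>

definition iterated_differentiable_on ::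
    "nat \<Rightarrow> ('a::real_normed_vector \<Rightarrow> 'b::real_normed_vector) \<Rightarrow> 'a set \<Rightarrow> bool" where
  "iterated_differentiable_on r f G \<longleftrightarrow>
     (\<forall>hs x. length hs < r \<longrightarrow> x \<in> G \<longrightarrow> frechet_differential f hs differentiable (at x))"

lemma iterated_differentiable_on_subset:
  "iterated_differentiable_on r f G \<Longrightarrow> m \<le> r \<Longrightarrow> H \<subseteq> G \<Longrightarrow> iterated_differentiable_on m f H"
  unfolding iterated_differentiable_on_def by (meson less_le_trans subsetD)

lemma continuously_imp_iterated_differentiable_on:
  "continuously_frechet_differentiable_on r f U \<Longrightarrow> iterated_differentiable_on r f U"
  by (simp add: iterated_differentiable_on_def continuously_frechet_differentiable_on_def
    differential_differentiable_at_def)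

text \<open>Linearity in each of the first \<open>j\<close> entries of a list, by currying: linear in the head, and
  multilinear in the tail for every fixed head.\<close>

primrec multilinear :: "nat \<Rightarrow> ('a::real_vector list \<Rightarrow> 'b::real_vector) \<Rightarrow> bool" where
  "multilinear 0 F = True"
| "multilinear (Suc j) F \<longleftrightarrow>
     (\<forall>hs. length hs = j \<longrightarrow> linear (\<lambda>h. F (h # hs))) \<and> (\<forall>h. multilinear j (\<lambda>hs. F (h # hs)))"

text \<open>Linear identities in the parameters that hold throughout an open set survive differentiation.\<close>

lemma multilinear_frechet_derivative:
  fixes F :: "'a::real_normed_vector \<Rightarrow> 'a list \<Rightarrow> 'b::real_normed_vector"
  assumes "open G" "\<And>x. x \<in> G \<Longrightarrow> multilinear j (F x)"
    and "\<And>hs x. length hs = j \<Longrightarrow> x \<in> G \<Longrightarrow> (\<lambda>x. F x hs) differentiable (at x)" and "x \<in> G"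
  shows "multilinear j (\<lambda>hs. frechet_derivative (\<lambda>x. F x hs) (at x) h)"
  using assms(2,3)
proof (induction j arbitrary: F)
  case 0 show ?case by simp
next
  case (Suc j)
  have D: "((\<lambda>x. F x (k # hs)) has_derivative frechet_derivative (\<lambda>x. F x (k # hs)) (at x)) (at x)"
    if "length hs = j" for k hs
    using Suc.prems(2)[of "k # hs" x] that assms(4) by (simp add: frechet_derivative_works)
  have lin: "linear (\<lambda>k. F y (k # hs))" if "length hs = j" "y \<in> G" for y hs
    using Suc.prems(1)[OF that(2)] that(1) by simp
  have "linear (\<lambda>k. frechet_derivative (\<lambda>x. F x (k # hs)) (at x) h)" if hs: "length hs = j" for hs
  proof (rule linearI)
    fix k l
    have "((\<lambda>x. F x ((k + l) # hs)) has_derivative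
        (\<lambda>h. frechet_derivative (\<lambda>x. F x (k # hs)) (at x) h + frechet_derivative (\<lambda>x. F x (l # hs)) (at x) h)) (at x)"
      by (rule has_derivative_transform_within_open[OF has_derivative_add[OF D[OF hs] D[OF hs]] assms(1,4)])
         (simp add: linear_add[OF lin[OF hs]])
    thus "frechet_derivative (\<lambda>x. F x ((k + l) # hs)) (at x) h
      = frechet_derivative (\<lambda>x. F x (k # hs)) (at x) h + frechet_derivative (\<lambda>x. F x (l # hs)) (at x) h"
      using fun_cong[OF has_derivative_unique[OF D[OF hs, of "k + l"]], of _ h] by simp
  next
    fix c k
    have "((\<lambda>x. F x ((c *\<^sub>R k) # hs)) has_derivative
        (\<lambda>h. c *\<^sub>R frechet_derivative (\<lambda>x. F x (k # hs)) (at x) h)) (at x)"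
      by (rule has_derivative_transform_within_open[OF has_derivative_scaleR_right[OF D[OF hs]] assms(1,4)])
         (simp add: linear_cmul[OF lin[OF hs]])
    thus "frechet_derivative (\<lambda>x. F x ((c *\<^sub>R k) # hs)) (at x) h = c *\<^sub>R frechet_derivative (\<lambda>x. F x (k # hs)) (at x) h"
      using fun_cong[OF has_derivative_unique[OF D[OF hs, of "c *\<^sub>R k"]], of _ h] by simp
  qed
  moreover have "multilinear j (\<lambda>hs. frechet_derivative (\<lambda>x. F x (k # hs)) (at x) h)" for k
    by (rule Suc.IH) (use Suc.prems in auto)
  ultimately show ?case by simp
qed

text \<open>The newest direction enters linearly because a derivative is linear, the older ones by the preceding
  lemma.\<close>

lemma frechet_differential_multilinear:
  assumes G: "open G" and f: "iterated_differentiable_on r f G" and "j \<le> r" "x \<in> G"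
  shows "multilinear j (\<lambda>hs. frechet_differential f hs x)"
  using assms(3,4)
proof (induction j arbitrary: x)
  case 0 show ?case by simp
next
  case (Suc j)
  have d: "frechet_differential f hs differentiable (at y)" if "length hs = j" "y \<in> G" for hs y
    using f that Suc.prems by (auto simp: iterated_differentiable_on_def)
  have "multilinear j (\<lambda>hs. frechet_derivative (\<lambda>x. frechet_differential f hs x) (at x) h)" for h
    by (rule multilinear_frechet_derivative[OF G]) (use Suc d in auto)
  moreover have "linear (frechet_derivative (frechet_differential f hs) (at x))" if "length hs = j" for hs
    using d[OF that Suc.prems(2)] by (rule linear_frechet_derivative)
  ultimately show ?case by simp
qed

lemma multilinear_replicate_scale:
  "multilinear j F \<Longrightarrow> F (replicate j (c *\<^sub>R h)) = c ^ j *\<^sub>R F (replicate j h)"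
proof (induction j arbitrary: F)
  case (Suc j)
  have "F (c *\<^sub>R h # replicate j (c *\<^sub>R h)) = c ^ j *\<^sub>R F (c *\<^sub>R h # replicate j h)"
    using Suc.IH[of "\<lambda>hs. F (c *\<^sub>R h # hs)"] Suc.prems by simp
  also have "F (c *\<^sub>R h # replicate j h) = c *\<^sub>R F (h # replicate j h)"
    using Suc.prems linear_cmul[of "\<lambda>k. F (k # replicate j h)"] by simp
  finally show ?case by simp
qed simp

lemma multilinear_basis_expansion:
  fixes F :: "'a::euclidean_space list \<Rightarrow> 'b::real_vector"
  assumes "multilinear (Suc j) F" "length hs = j"
  shows "F (h # hs) = (\<Sum>b\<in>Basis. (h \<bullet> b) *\<^sub>R F (b # hs))"
proof -
  have lin: "linear (\<lambda>h. F (h # hs))" using assms by simp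
  have "F (h # hs) = F ((\<Sum>b\<in>Basis. (h \<bullet> b) *\<^sub>R b) # hs)" by (simp add: euclidean_representation)
  also have "\<dots> = (\<Sum>b\<in>Basis. (h \<bullet> b) *\<^sub>R F (b # hs))"
    by (simp only: linear_sum[OF lin] linear_cmul[OF lin])
  finally show ?thesis .
qed

lemma multilinear_replicate_continuous:
  fixes F :: "'a::euclidean_space list \<Rightarrow> 'b::real_normed_vector"
  shows "multilinear j F \<Longrightarrow> continuous_on UNIV (\<lambda>w. F (replicate j w))"
proof (induction j arbitrary: F)
  case (Suc j)
  have "F (replicate (Suc j) w) = (\<Sum>b\<in>Basis. (w \<bullet> b) *\<^sub>R F (b # replicate j w))" for w
    using multilinear_basis_expansion[OF Suc.prems, of "replicate j w" w] by simp
  moreover have "continuous_on UNIV (\<lambda>w. \<Sum>b\<in>Basis. (w \<bullet> b) *\<^sub>R F (b # replicate j w))"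
    using Suc by (intro continuous_intros) auto
  ultimately show ?case by simp
qed simp

text \<open>Expand one argument after the other in the standard basis.\<close>

lemma multilinear_bounded:
  fixes F :: "'a::euclidean_space list \<Rightarrow> 'b::real_normed_vector"
  shows "multilinear j F \<Longrightarrow> \<exists>C\<ge>0. \<forall>hs. length hs = j \<longrightarrow> norm (F hs) \<le> C * (\<Prod>h\<leftarrow>hs. norm h)"
proof (induction j arbitrary: F)
  case 0 thus ?case by (intro exI[of _ "norm (F [])"]) simp
next
  case (Suc j)
  have "\<forall>b\<in>Basis. \<exists>C\<ge>0. \<forall>hs. length hs = j \<longrightarrow> norm (F (b # hs)) \<le> C * (\<Prod>h\<leftarrow>hs. norm h)"
  proof
    fix b :: 'a
    have "multilinear j (\<lambda>hs. F (b # hs))" using Suc.prems by simp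
    thus "\<exists>C\<ge>0. \<forall>hs. length hs = j \<longrightarrow> norm (F (b # hs)) \<le> C * (\<Prod>h\<leftarrow>hs. norm h)" by (rule Suc.IH)
  qed
  from bchoice[OF this] obtain C where C': "\<forall>b\<in>Basis. C b \<ge> 0 \<and>
      (\<forall>hs. length hs = j \<longrightarrow> norm (F (b # hs)) \<le> C b * (\<Prod>h\<leftarrow>hs. norm h))" ..
  have C0: "C b \<ge> 0" if "b \<in> Basis" for b
    by (rule conjunct1[OF bspec[OF C' that]])
  have C1: "norm (F (b # hs)) \<le> C b * (\<Prod>h\<leftarrow>hs. norm h)" if "b \<in> Basis" "length hs = j" for b hs
    by (rule mp[OF spec[OF conjunct2[OF bspec[OF C' that(1)]]] that(2)])
  have main: "norm (F (h # hs)) \<le> (\<Sum>b\<in>Basis. C b) * (norm h * (\<Prod>h\<leftarrow>hs. norm h))" if hs: "length hs = j" for h hs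
  proof -
    have "norm (F (h # hs)) \<le> (\<Sum>b\<in>Basis. \<bar>h \<bullet> b\<bar> * norm (F (b # hs)))"
      by (subst multilinear_basis_expansion[OF Suc.prems hs], rule order_trans[OF norm_sum]) simp
    also have "\<dots> \<le> (\<Sum>b\<in>Basis. norm h * (C b * (\<Prod>h\<leftarrow>hs. norm h)))"
      by (intro sum_mono mult_mono Basis_le_norm C1 hs) simp_all
    also have "\<dots> = (\<Sum>b\<in>Basis. C b) * (norm h * (\<Prod>h\<leftarrow>hs. norm h))"
      by (simp add: sum_distrib_right sum_distrib_left mult_ac)
    finally show ?thesis .
  qed
  hence "\<forall>hs. length hs = Suc j \<longrightarrow> norm (F hs) \<le> (\<Sum>b\<in>Basis. C b) * (\<Prod>h\<leftarrow>hs. norm h)"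
  proof (intro allI impI)
    fix hs :: "'a list" assume "length hs = Suc j"
    then obtain k ks where k: "hs = k # ks" "length ks = j" by (auto simp: length_Suc_conv)
    show "norm (F hs) \<le> (\<Sum>b\<in>Basis. C b) * (\<Prod>h\<leftarrow>hs. norm h)"
      using main[OF k(2), of k] by (simp add: k(1))
  qed
  thus ?case using C0 by (intro exI[of _ "\<Sum>b\<in>Basis. C b"] conjI sum_nonneg)
qed

text \<open>Continuity of the \<open>r\<close>-th differential in operator norm: its increment is approximated by the
  \<open>(r+1)\<close>-st differential in the direction \<open>y - x\<close>, which is \<open>O(norm (y - x))\<close> by multilinearity.\<close>

lemma continuously_frechet_differentiable_on_Suc:
  fixes f :: "'a::euclidean_space \<Rightarrow> 'b::real_normed_vector"
  assumes "open U" and f: "continuously_frechet_differentiable_on (Suc r) f U"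
  shows "continuously_frechet_differentiable_on r f U"
  unfolding continuously_frechet_differentiable_on_def
proof (intro ballI conjI allI impI)
  fix x assume x: "x \<in> U"
  show "differential_differentiable_at j f x" if "j < r" for j
    using f x that by (simp add: continuously_frechet_differentiable_on_def)
  have d: "differential_differentiable_at r f x"
    using f x by (simp add: continuously_frechet_differentiable_on_def)
  obtain C where C: "C \<ge> 0" "\<forall>hs. length hs = Suc r \<longrightarrow> norm (frechet_differential f hs x) \<le> C * (\<Prod>h\<leftarrow>hs. norm h)"
    using multilinear_bounded[OF frechet_differential_multilinear[OF assms(1) continuously_imp_iterated_differentiable_on[OF f] order_refl x]]
    by (elim exE conjE)
  show "differential_continuous_at r f x"
    unfolding differential_continuous_at_def
  proof (intro allI impI)
    fix \<epsilon> :: real assume e: "\<epsilon> > 0"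
    define \<delta> where "\<delta> = \<epsilon> / (1 + C)"
    have \<delta>: "\<delta> > 0" "(1 + C) * \<delta> = \<epsilon>" using e C(1) by (auto simp: \<delta>_def)
    have "\<forall>\<^sub>F y in at x. \<forall>hs. length hs = r \<longrightarrow>
        norm (frechet_differential f hs y - frechet_differential f hs x - frechet_differential f ((y - x) # hs) x)
          \<le> 1 * norm (y - x) * (\<Prod>h\<leftarrow>hs. norm h)"
      by (rule mp[OF spec[OF conjunct2[OF d[unfolded differential_differentiable_at_def]], of 1] zero_less_one])
    moreover have "\<forall>\<^sub>F y in at x. dist y x < \<delta>" using \<delta>(1) by (auto simp: eventually_at)
    ultimately show "\<forall>\<^sub>F y in at x. \<forall>hs. length hs = r \<longrightarrow>
        norm (frechet_differential f hs y - frechet_differential f hs x) \<le> \<epsilon> * (\<Prod>h\<leftarrow>hs. norm h)"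
    proof eventually_elim
      case (elim y)
      show ?case
      proof (intro allI impI)
        fix hs :: "'a list" assume hs: "length hs = r"
        define p where "p = (\<Prod>h\<leftarrow>hs. norm h)"
        have p: "p \<ge> 0" unfolding p_def by (rule prod_list_nonneg) auto
        have "norm (frechet_differential f hs y - frechet_differential f hs x)
          \<le> norm (frechet_differential f hs y - frechet_differential f hs x - frechet_differential f ((y - x) # hs) x)
            + norm (frechet_differential f ((y - x) # hs) x)"
          by (metis diff_add_cancel norm_triangle_ineq)
        also have "\<dots> \<le> 1 * norm (y - x) * p + C * (norm (y - x) * p)"
          using elim(1)[rule_format, OF hs] C(2)[rule_format, of "(y - x) # hs"] hs unfolding p_def
          by (intro add_mono) simp_all
        also have "\<dots> = (1 + C) * norm (y - x) * p" by (simp add: algebra_simps)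
        also have "\<dots> \<le> (1 + C) * \<delta> * p"
          using elim(2) C(1) p by (intro mult_right_mono mult_left_mono) (auto simp: dist_norm)
        finally show "norm (frechet_differential f hs y - frechet_differential f hs x) \<le> \<epsilon> * (\<Prod>h\<leftarrow>hs. norm h)"
          unfolding \<delta>(2) p_def .
      qed
    qed
  qed
qed

lemma continuously_frechet_differentiable_on_mono:
  fixes f :: "'a::euclidean_space \<Rightarrow> 'b::real_normed_vector"
  assumes "open U" "continuously_frechet_differentiable_on r f U" "m \<le> r"
  shows "continuously_frechet_differentiable_on m f U"
  using assms(3,2)
  by (induction rule: inc_induct) (auto intro: continuously_frechet_differentiable_on_Suc[OF assms(1)])

section \<open>Taylor's formula\<close>

text \<open>The derivative of the Taylor remainder of order \<open>r + 1\<close> is the remainder of order \<open>r\<close> of the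
  derivative, so the bound follows by induction from the mean value inequality, which holds in every
  normed space.\<close>

lemma taylor_vector_bound:
  fixes G :: "nat \<Rightarrow> real \<Rightarrow> 'b::real_normed_vector"
  assumes "\<And>j t. j < r \<Longrightarrow> t \<in> {0..1} \<Longrightarrow> (G j has_vector_derivative G (Suc j) t) (at t within {0..1})"
    and "\<And>t. t \<in> {0..1} \<Longrightarrow> norm (G r t - G r 0) \<le> \<epsilon>" and "t \<in> {0..1}"
  shows "norm (G 0 t - (\<Sum>j\<le>r. (t ^ j / fact j) *\<^sub>R G j 0)) \<le> \<epsilon> * t ^ r"
  using assms
proof (induction r arbitrary: G t)
  case 0 thus ?case by simp
next
  case (Suc r)
  have e0: "\<epsilon> \<ge> 0" using Suc.prems(2)[of 0] by simp
  show ?case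
  proof (cases "t = 0")
    case True
    have "(\<Sum>j\<le>Suc r. ((0::real) ^ j / fact j) *\<^sub>R G j 0) = G 0 0"
      by (subst sum.atMost_Suc_shift) simp
    thus ?thesis using True e0 by simp
  next
    case False
    hence t: "0 < t" "t \<le> 1" using Suc.prems(3) by auto
    define H where "H s = G 0 s - (\<Sum>j\<le>Suc r. (s ^ j / fact j) *\<^sub>R G j 0)" for s
    define H' where "H' s = G (Suc 0) s - (\<Sum>j\<le>r. (s ^ j / fact j) *\<^sub>R G (Suc j) 0)" for s
    have H: "(H has_vector_derivative H' s) (at s within {0..1})" if s: "s \<in> {0..1}" for s
    proof -
      have p: "((\<lambda>s. (s ^ Suc j / fact (Suc j)) *\<^sub>R v) has_vector_derivative (s ^ j / fact j) *\<^sub>R v) (at s within {0..1})"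
        for j and v :: 'b
      proof -
        have "((\<lambda>s. s ^ Suc j) has_real_derivative real (Suc j) * s ^ j) (at s within {0..1})"
          using DERIV_power_Suc[OF DERIV_ident, of j s "{0..1}"] by simp
        from DERIV_cdivide[OF this, of "fact (Suc j)"]
        have "((\<lambda>s. s ^ Suc j / fact (Suc j)) has_real_derivative s ^ j / fact j) (at s within {0..1})"
          by (simp add: fact_Suc del: of_nat_Suc power_Suc)
        from has_vector_derivative_scaleR[OF this has_vector_derivative_const[of v]]
        show ?thesis by simp
      qed
      have "((\<lambda>s. G 0 s - (G 0 0 + (\<Sum>j\<le>r. (s ^ Suc j / fact (Suc j)) *\<^sub>R G (Suc j) 0))) has_vector_derivative
          (G (Suc 0) s - (0 + (\<Sum>j\<le>r. (s ^ j / fact j) *\<^sub>R G (Suc j) 0)))) (at s within {0..1})"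
        using Suc.prems(1)[of 0 s] s
        by (intro has_vector_derivative_diff has_vector_derivative_add has_vector_derivative_const has_vector_derivative_sum p) auto
      moreover have "H = (\<lambda>s. G 0 s - (G 0 0 + (\<Sum>j\<le>r. (s ^ Suc j / fact (Suc j)) *\<^sub>R G (Suc j) 0)))"
        unfolding H_def[abs_def] by (subst sum.atMost_Suc_shift) simp
      ultimately show ?thesis by (simp add: H'_def)
    qed
    have H0: "H 0 = 0" unfolding H_def by (subst sum.atMost_Suc_shift) simp
    have H'le: "norm (H' s) \<le> \<epsilon> * s ^ r" if "s \<in> {0..1}" for s
      unfolding H'_def using Suc.prems that by (intro Suc.IH[of "\<lambda>j. G (Suc j)"]) auto
    have "norm (H t - H 0) \<le> \<epsilon> * t ^ r * t - \<epsilon> * t ^ r * 0"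
    proof (rule differentiable_bound_general[OF t(1)])
      have "continuous_on {0..1} H"
        unfolding continuous_on_eq_continuous_within using H by (blast intro: has_vector_derivative_continuous)
      thus "continuous_on {0..t} H" by (rule continuous_on_subset) (use t in auto)
      show "(H has_vector_derivative H' s) (at s)" if "0 < s" "s < t" for s
        using H[of s] that t by (simp add: at_within_Icc_at)
      show "((\<lambda>s. \<epsilon> * t ^ r * s) has_vector_derivative \<epsilon> * t ^ r) (at s)" for s
        by (auto intro!: derivative_eq_intros simp flip: has_real_derivative_iff_has_vector_derivative)
      show "norm (H' s) \<le> \<epsilon> * t ^ r" if "0 < s" "s < t" for s
        using H'le[of s] that t e0 by (intro order_trans[OF H'le]) (auto intro!: mult_left_mono power_mono)
    qed (intro continuous_intros)
    thus ?thesis unfolding H0 unfolding H_def by (simp add: mult_ac)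
  qed
qed

lemma has_vector_derivative_along_line:
  assumes "frechet_differential f hs differentiable (at (x + t *\<^sub>R h))"
  shows "((\<lambda>t. frechet_differential f hs (x + t *\<^sub>R h)) has_vector_derivative frechet_differential f (h # hs) (x + t *\<^sub>R h)) (at t within S)"
proof -
  let ?D = "frechet_derivative (frechet_differential f hs) (at (x + t *\<^sub>R h))"
  have D: "(frechet_differential f hs has_derivative ?D) (at (x + t *\<^sub>R h))"
    using assms by (simp add: frechet_derivative_works)
  have "((\<lambda>t. x + t *\<^sub>R h) has_derivative (\<lambda>s. s *\<^sub>R h)) (at t within S)"
    by (auto intro!: derivative_eq_intros)
  from has_derivative_compose[OF this D]
  have "((\<lambda>t. frechet_differential f hs (x + t *\<^sub>R h)) has_derivative (\<lambda>s. ?D (s *\<^sub>R h))) (at t within S)" .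
  thus ?thesis
    by (simp add: has_vector_derivative_def linear_cmul[OF linear_frechet_derivative[OF assms]])
qed

definition taylor_polynomial ::
    "nat \<Rightarrow> ('a::real_normed_vector \<Rightarrow> 'b::real_normed_vector) \<Rightarrow> 'a \<Rightarrow> 'a \<Rightarrow> 'b" where
  "taylor_polynomial r f x h = (\<Sum>j\<le>r. (1 / fact j) *\<^sub>R frechet_differential f (replicate j h) x)"

text \<open>Along the segment from \<open>x\<close> to \<open>x + h\<close> the successive derivatives are the differentials with all
  arguments equal to \<open>h\<close>.\<close>

lemma taylor_frechet_bound:
  assumes f: "iterated_differentiable_on r f (ball x \<delta>)" and h: "norm h < \<delta>"
    and osc: "\<And>t. t \<in> {0..1} \<Longrightarrow>
      norm (frechet_differential f (replicate r h) (x + t *\<^sub>R h) - frechet_differential f (replicate r h) x) \<le> \<epsilon>"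
  shows "norm (f (x + h) - taylor_polynomial r f x h) \<le> \<epsilon>"
proof -
  let ?G = "\<lambda>j t. frechet_differential f (replicate j h) (x + t *\<^sub>R h)"
  have "norm (?G 0 1 - (\<Sum>j\<le>r. (1 ^ j / fact j) *\<^sub>R ?G j 0)) \<le> \<epsilon> * 1 ^ r"
  proof (rule taylor_vector_bound)
    fix j and t :: real assume j: "j < r" and t: "t \<in> {0..1}"
    have "norm (t *\<^sub>R h) \<le> norm h" using t by (simp add: mult_left_le_one_le)
    hence "x + t *\<^sub>R h \<in> ball x \<delta>" using h by (simp add: dist_norm)
    hence "frechet_differential f (replicate j h) differentiable (at (x + t *\<^sub>R h))"
      using f j by (auto simp: iterated_differentiable_on_def)
    from has_vector_derivative_along_line[OF this]
    show "(?G j has_vector_derivative ?G (Suc j) t) (at t within {0..1})" by simp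
  qed (use osc in auto)
  thus ?thesis by (simp add: taylor_polynomial_def)
qed

lemma taylor_little_o:
  fixes f :: "'a::real_normed_vector \<Rightarrow> 'b::real_normed_vector"
  assumes U: "open U" "x \<in> U" and f: "continuously_frechet_differentiable_on r f U" and e: "\<eta> > 0"
  obtains \<delta> where "\<delta> > 0" "\<And>h. norm h < \<delta> \<Longrightarrow> norm (f (x + h) - taylor_polynomial r f x h) \<le> \<eta> * norm h ^ r"
proof -
  obtain \<delta>1 where \<delta>1: "\<delta>1 > 0" "ball x \<delta>1 \<subseteq> U" using U by (meson open_contains_ball)
  have "\<forall>\<^sub>F y in at x. \<forall>hs. length hs = r \<longrightarrow>
        norm (frechet_differential f hs y - frechet_differential f hs x) \<le> \<eta> * (\<Prod>h\<leftarrow>hs. norm h)"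
    using f U(2) e by (simp add: continuously_frechet_differentiable_on_def differential_continuous_at_def)
  then obtain \<delta>2 where \<delta>2: "\<delta>2 > 0" "\<And>y hs. y \<noteq> x \<Longrightarrow> dist y x < \<delta>2 \<Longrightarrow> length hs = r \<Longrightarrow>
        norm (frechet_differential f hs y - frechet_differential f hs x) \<le> \<eta> * (\<Prod>h\<leftarrow>hs. norm h)"
    unfolding eventually_at by blast
  have f1: "iterated_differentiable_on r f (ball x \<delta>1)"
    using iterated_differentiable_on_subset[OF continuously_imp_iterated_differentiable_on[OF f] order_refl \<delta>1(2)] .
  show thesis
  proof (rule that[of "min \<delta>1 \<delta>2"])
    fix h :: 'a assume h: "norm h < min \<delta>1 \<delta>2"
    show "norm (f (x + h) - taylor_polynomial r f x h) \<le> \<eta> * norm h ^ r"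
    proof (rule taylor_frechet_bound[OF f1])
      fix t :: real assume t: "t \<in> {0..1}"
      have "norm (t *\<^sub>R h) \<le> norm h" using t by (simp add: mult_left_le_one_le)
      hence "dist (x + t *\<^sub>R h) x < \<delta>2" using h by (simp add: dist_norm)
      moreover have "(\<Prod>h\<leftarrow>replicate r h. norm h) = norm h ^ r" by (simp add: prod_list_replicate)
      ultimately show "norm (frechet_differential f (replicate r h) (x + t *\<^sub>R h) - frechet_differential f (replicate r h) x) \<le> \<eta> * norm h ^ r"
        using \<delta>2(2)[of "x + t *\<^sub>R h" "replicate r h"] e by (cases "x + t *\<^sub>R h = x") (auto simp del: map_replicate)
    qed (use h in auto)
  qed (use \<delta>1 \<delta>2 in auto)
qed

section \<open>Differentials in tangential directions\<close>

lemma tangent_space_add: "g \<in> tangent_space P \<Longrightarrow> h \<in> tangent_space P \<Longrightarrow> g + h \<in> tangent_space P"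
  and tangent_space_scale: "h \<in> tangent_space P \<Longrightarrow> c *\<^sub>R h \<in> tangent_space P"
  and tangent_space_zero: "0 \<in> tangent_space P"
  by (auto simp: tangent_space_def matrix_vector_mult_add_rdistrib scaleR_matrix_vector_assoc[symmetric] matrix_vector_mult_0)

text \<open>A small tangent matrix keeps the positive entries of \<open>P\<close> positive, leaves its zero entries and its row
  sums unchanged.\<close>

lemma stochastic_along_tangent:
  fixes P :: "real^'s^'s::finite"
  assumes P: "P \<in> stochastic_matrices"
  obtains \<delta> where "\<delta> > 0" "\<And>H. H \<in> tangent_space P \<Longrightarrow> norm H < \<delta> \<Longrightarrow> P + H \<in> stochastic_matrices"
proof -
  \<comment> \<open>The dummy value 1 at the zero entries keeps the minimum positive.\<close>
  let ?A = "(\<lambda>(i,j). if P $ i $ j = 0 then 1 else P $ i $ j) ` UNIV"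
  have pos: "P $ i $ j \<ge> 0" for i j using P by (simp add: stochastic_matrices_def)
  have Apos: "\<forall>a\<in>?A. a > 0" using pos by (auto simp: less_le)
  have "Min ?A > 0" using Apos by (subst Min_gr_iff) auto
  moreover have "P + H \<in> stochastic_matrices" if H: "H \<in> tangent_space P" "norm H < Min ?A" for H
    unfolding stochastic_matrices_def
  proof (intro CollectI conjI allI)
    fix i j
    have "\<bar>H $ i $ j\<bar> \<le> norm H"
      using Finite_Cartesian_Product.norm_nth_le[of H i] Finite_Cartesian_Product.norm_nth_le[of "H $ i" j] by simp
    moreover have min: "Min ?A \<le> (if P $ i $ j = 0 then 1 else P $ i $ j)"
      by (rule Min_le) (auto intro: image_eqI[of _ _ "(i, j)"])
    moreover have "P $ i $ j = 0 \<Longrightarrow> H $ i $ j = 0" using H(1) by (simp add: tangent_space_def)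
    moreover have "norm H < (if P $ i $ j = 0 then 1 else P $ i $ j)" using H(2) min by (rule less_le_trans)
    ultimately show "0 \<le> (P + H) $ i $ j" by (cases "P $ i $ j = 0") simp_all
  next
    fix i
    have "(\<Sum>j\<in>UNIV. H $ i $ j) = 0"
      using H(1) by (simp add: tangent_space_def vec_eq_iff matrix_vector_mult_def)
    thus "(\<Sum>j\<in>UNIV. (P + H) $ i $ j) = 1" using P by (simp add: sum.distrib stochastic_matrices_def)
  qed
  ultimately show thesis using that by blast
qed

text \<open>The maps agree at all points \<open>P + H\<close> with \<open>H\<close> tangent and small. A directional derivative in a tangent
  direction at such a point only sees points of the same kind, so the differentials agree there too,
  by induction on the number of directions. The induction must therefore run over all these points
  and not only over \<open>P\<close>.\<close>

lemma frechet_differential_eq_tangential: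
  fixes f g :: "real^'s^'s::finite \<Rightarrow> 'b::real_normed_vector"
  assumes P: "P \<in> stochastic_matrices" and G: "open G" "P \<in> G"
    and f: "iterated_differentiable_on r f G" and g: "iterated_differentiable_on r g G"
    and eq: "\<And>Q. Q \<in> G \<inter> stochastic_matrices \<Longrightarrow> f Q = g Q"
    and Hs: "length Hs \<le> r" "set Hs \<subseteq> tangent_space P"
  shows "frechet_differential f Hs P = frechet_differential g Hs P"
proof -
  obtain \<delta>1 where \<delta>1: "\<delta>1 > 0" "\<And>H. H \<in> tangent_space P \<Longrightarrow> norm H < \<delta>1 \<Longrightarrow> P + H \<in> stochastic_matrices"
    using stochastic_along_tangent[OF P] by metis
  obtain \<delta>2 where \<delta>2: "\<delta>2 > 0" "ball P \<delta>2 \<subseteq> G" using G by (meson open_contains_ball)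
  define \<delta> where "\<delta> = min \<delta>1 \<delta>2"
  have inG: "P + H \<in> G" if "norm H < \<delta>" for H using that \<delta>2(2) by (auto simp: \<delta>_def dist_norm)
  have "frechet_differential f Hs (P + H) = frechet_differential g Hs (P + H)"
    if "H \<in> tangent_space P" "norm H < \<delta>" for H
    using Hs that
  proof (induction Hs arbitrary: H)
    case Nil
    thus ?case using eq[of "P + H"] inG \<delta>1(2) by (simp add: \<delta>_def)
  next
    case (Cons h hs)
    let ?F = "\<lambda>t. frechet_differential f hs (P + H + t *\<^sub>R h)"
    let ?K = "\<lambda>t. frechet_differential g hs (P + H + t *\<^sub>R h)"
    have F: "(?F has_vector_derivative frechet_differential f (h # hs) (P + H + 0 *\<^sub>R h)) (at 0)"
      using f Cons.prems inG[of H] by (intro has_vector_derivative_along_line) (simp add: iterated_differentiable_on_def)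
    have K: "(?K has_vector_derivative frechet_differential g (h # hs) (P + H + 0 *\<^sub>R h)) (at 0)"
      using g Cons.prems inG[of H] by (intro has_vector_derivative_along_line) (simp add: iterated_differentiable_on_def)
    have o: "open ((\<lambda>t. norm (H + t *\<^sub>R h)) -` {..<\<delta>})"
      by (rule open_vimage) (auto intro!: continuous_intros)
    have "(?F has_vector_derivative frechet_differential g (h # hs) (P + H + 0 *\<^sub>R h)) (at 0)"
    proof (rule has_vector_derivative_transform_within_open[OF K o])
      fix t assume "t \<in> (\<lambda>t. norm (H + t *\<^sub>R h)) -` {..<\<delta>}"
      hence "norm (H + t *\<^sub>R h) < \<delta>" by simp
      thus "?K t = ?F t"
        using Cons.IH[of "H + t *\<^sub>R h"] Cons.prems by (simp add: tangent_space_add tangent_space_scale add.assoc)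
    qed (use Cons.prems in simp)
    from vector_derivative_unique_at[OF F this] show ?case by simp
  qed
  from this[OF tangent_space_zero] show ?thesis using \<delta>1 \<delta>2 by (simp add: \<delta>_def)
qed

text \<open>The first differential at \<open>P\<close> in a tangent direction is the derivative along a line that consists of
  stochastic matrices near \<open>P\<close>; this covers maps that are differentiable at \<open>P\<close> only.\<close>

lemma differentiable_eq_tangential:
  fixes f g :: "real^'s^'s::finite \<Rightarrow> 'b::real_normed_vector"
  assumes P: "P \<in> stochastic_matrices" and G: "open G" "P \<in> G"
    and f: "f differentiable (at P)" and g: "g differentiable (at P)"
    and eq: "\<And>Q. Q \<in> G \<inter> stochastic_matrices \<Longrightarrow> f Q = g Q"
    and h: "h \<in> tangent_space P"
  shows "frechet_differential f [h] P = frechet_differential g [h] P"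
proof -
  obtain \<delta>1 where \<delta>1: "\<delta>1 > 0" "\<And>H. H \<in> tangent_space P \<Longrightarrow> norm H < \<delta>1 \<Longrightarrow> P + H \<in> stochastic_matrices"
    using stochastic_along_tangent[OF P] by metis
  obtain \<delta>2 where \<delta>2: "\<delta>2 > 0" "ball P \<delta>2 \<subseteq> G" using G by (meson open_contains_ball)
  have nil: "frechet_differential k [] = k" for k :: "real^'s^'s \<Rightarrow> 'b" by (rule ext) simp
  have F: "((\<lambda>t. f (P + t *\<^sub>R h)) has_vector_derivative frechet_differential f [h] P) (at 0)"
    using has_vector_derivative_along_line[of f "[]" P 0 h UNIV] f by (simp add: nil)
  have K: "((\<lambda>t. g (P + t *\<^sub>R h)) has_vector_derivative frechet_differential g [h] P) (at 0)"
    using has_vector_derivative_along_line[of g "[]" P 0 h UNIV] g by (simp add: nil)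
  have o: "open ((\<lambda>t. norm (t *\<^sub>R h)) -` {..<min \<delta>1 \<delta>2})"
    by (rule open_vimage) (auto intro!: continuous_intros)
  have "((\<lambda>t. f (P + t *\<^sub>R h)) has_vector_derivative frechet_differential g [h] P) (at 0)"
  proof (rule has_vector_derivative_transform_within_open[OF K o])
    fix t assume "t \<in> (\<lambda>t. norm (t *\<^sub>R h)) -` {..<min \<delta>1 \<delta>2}"
    hence t: "norm (t *\<^sub>R h) < \<delta>1" "norm (t *\<^sub>R h) < \<delta>2" by auto
    have "P + t *\<^sub>R h \<in> G" using t(2) \<delta>2(2) by (auto simp: dist_norm)
    moreover have "P + t *\<^sub>R h \<in> stochastic_matrices" by (rule \<delta>1(2)[OF tangent_space_scale[OF h] t(1)])
    ultimately show "g (P + t *\<^sub>R h) = f (P + t *\<^sub>R h)" using eq by simp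
  qed (use \<delta>1 \<delta>2 in auto)
  from vector_derivative_unique_at[OF F this] show ?thesis .
qed

section \<open>Coordinates in a finite-dimensional normed space\<close>

text \<open>The coordinate functionals of a basis are bounded: on the compact set of coefficient vectors of \<open>l\<^sup>1\<close>
  norm one, the norm of the linear combination has a positive minimum \<open>m\<close>, by linear independence.
  Coefficient vectors are sequences, as functions on the natural numbers carry the product topology
  and its Borel sets.\<close>

lemma finite_dim_coordinates:
  assumes "\<exists>B::'y::real_normed_vector set. finite B \<and> span B = UNIV"
  shows "\<exists>(d::nat) (b::nat \<Rightarrow> 'y) (c::nat \<Rightarrow> 'y \<Rightarrow> real).
    (\<forall>v. (\<Sum>k<d. c k v *\<^sub>R b k) = v) \<and> (\<forall>k<d. bounded_linear (c k))"
proof -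
  obtain B0 :: "'y set" where B0: "finite B0" "span B0 = UNIV" using assms by blast
  obtain B where B: "B \<subseteq> B0" "independent B" "B0 \<subseteq> span B"
    using maximal_independent_subset[of B0] by blast
  have fin: "finite B" using B(1) B0(1) finite_subset by blast
  have spn: "span B = UNIV" using B(3) B0(2) by (metis span_mono span_span top.extremum_uniqueI)
  obtain b where b: "bij_betw b {..<card B} B"
    using ex_bij_betw_nat_finite[OF fin] by (auto simp: atLeast0LessThan)
  define d where "d = card B"
  define c where "c k v = representation B v (b k)" for k v
  have bB: "b k \<in> B" if "k < d" for k using b that by (auto simp: bij_betw_def d_def)
  have exp: "(\<Sum>k<d. c k v *\<^sub>R b k) = v" for v
  proof -
    have "(\<Sum>k<d. c k v *\<^sub>R b k) = (\<Sum>w\<in>B. representation B v w *\<^sub>R w)"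
      unfolding c_def d_def by (rule sum.reindex_bij_betw[OF b])
    also have "\<dots> = v" by (rule sum_representation_eq[OF B(2)]) (use spn fin in auto)
    finally show ?thesis .
  qed
  define S where "S x = (\<Sum>k<d. x k *\<^sub>R b k)" for x :: "nat \<Rightarrow> real"
  have Scont: "continuous_on UNIV S" unfolding S_def[abs_def]
    by (intro continuous_intros continuous_on_product_coordinates)
  have S0: "x k = 0" if "S x = 0" "k < d" for x k
  proof -
    define u where "u w = x (the_inv_into {..<d} b w)" for w
    have inj: "inj_on b {..<d}" using b by (simp add: bij_betw_def d_def)
    have ub: "u (b k) = x k" if "k < d" for k using that by (simp add: u_def the_inv_into_f_f[OF inj])
    have "(\<Sum>w\<in>B. u w *\<^sub>R w) = (\<Sum>k<d. u (b k) *\<^sub>R b k)"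
      unfolding d_def by (rule sum.reindex_bij_betw[OF b, symmetric])
    also have "\<dots> = S x" unfolding S_def by (intro sum.cong refl) (simp add: ub)
    finally have "(\<Sum>w\<in>B. u w *\<^sub>R w) = 0" using that by simp
    hence "u (b k) = 0" using independentD[OF B(2) fin order_refl _ bB[OF that(2)]] by blast
    thus ?thesis using ub that by simp
  qed
  define Q where "Q = PiE UNIV (\<lambda>k::nat. if k < d then {-1..1::real} else {0})"
  define K where "K = Q \<inter> {x. (\<Sum>k<d. \<bar>x k\<bar>) = 1}"
  have "compact Q"
  proof -
    have "compactin (product_topology (\<lambda>i::nat. euclidean) UNIV) Q"
      unfolding Q_def compactin_PiE by auto
    thus ?thesis by (simp add: euclidean_product_topology)
  qed
  moreover have "closed {x :: nat \<Rightarrow> real. (\<Sum>k<d. \<bar>x k\<bar>) = 1}"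
    by (intro closed_Collect_eq continuous_intros continuous_on_product_coordinates)
  ultimately have K: "compact K" unfolding K_def by (rule compact_Int_closed)
  have "\<exists>m>0. \<forall>x\<in>K. m \<le> norm (S x)"
  proof (cases "K = {}")
    case True thus ?thesis by (intro exI[of _ 1]) simp
  next
    case False
    have "continuous_on K (\<lambda>x. norm (S x))" by (intro continuous_on_norm continuous_on_subset[OF Scont]) simp
    from continuous_attains_inf[OF K False this]
    obtain x where x: "x \<in> K" "\<forall>y\<in>K. norm (S x) \<le> norm (S y)" by blast
    have "S x \<noteq> 0"
    proof
      assume "S x = 0"
      hence "(\<Sum>k<d. \<bar>x k\<bar>) = 0" using S0[OF \<open>S x = 0\<close>] by simp
      thus False using x(1) by (simp add: K_def)
    qed
    thus ?thesis using x(2) by (intro exI[of _ "norm (S x)"]) simp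
  qed
  then obtain m where m: "m > 0" "\<forall>x\<in>K. m \<le> norm (S x)" by (elim exE conjE)
  have bnd: "m * \<bar>c k v\<bar> \<le> norm v" if k: "k < d" for k v
  proof -
    define s where "s = (\<Sum>k<d. \<bar>c k v\<bar>)"
    have sk: "\<bar>c j v\<bar> \<le> s" if "j < d" for j unfolding s_def using that by (intro member_le_sum) auto
    show ?thesis
    proof (cases "s = 0")
      case True thus ?thesis using sk[OF k] by simp
    next
      case False
      hence s: "s > 0" using sk[OF k] by linarith
      define x where "x j = (if j < d then c j v / s else 0)" for j
      have xj: "x j \<in> (if j < d then {-1..1} else {0})" for j
        using sk[of j] s by (auto simp: x_def divide_le_eq le_divide_eq abs_le_iff)
      have "(\<Sum>j<d. \<bar>x j\<bar>) = 1"
      proof -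
        have "(\<Sum>j<d. \<bar>x j\<bar>) = (\<Sum>j<d. \<bar>c j v\<bar> / s)" by (intro sum.cong refl) (use s in \<open>simp add: x_def\<close>)
        also have "\<dots> = 1" unfolding sum_divide_distrib[symmetric] s_def[symmetric] using s by simp
        finally show ?thesis .
      qed
      moreover have "x \<in> Q" unfolding Q_def by (rule PiE_I) (rule xj, simp)
      ultimately have "x \<in> K" by (simp add: K_def)
      hence "m \<le> norm (S x)" using m(2) by blast
      also have "S x = (1 / s) *\<^sub>R (\<Sum>j<d. c j v *\<^sub>R b j)"
        unfolding S_def scaleR_sum_right by (intro sum.cong refl) (simp add: x_def)
      also have "norm \<dots> = norm v / s" using s by (simp add: exp)
      finally have "m * s \<le> norm v" using s by (simp add: pos_le_divide_eq)
      moreover have "m * \<bar>c k v\<bar> \<le> m * s" using sk[OF k] m(1) by (intro mult_left_mono) auto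
      ultimately show ?thesis by linarith
    qed
  qed
  have "bounded_linear (c k)" if k: "k < d" for k
  proof (rule bounded_linear_intro[where K="1 / m"])
    show "c k (v + w) = c k v + c k w" for v w
      unfolding c_def using B(2) spn by (simp add: representation_add)
    show "c k (r *\<^sub>R v) = r *\<^sub>R c k v" for r v
      unfolding c_def using B(2) spn by (simp add: representation_scale)
    show "norm (c k v) \<le> norm v * (1 / m)" for v
      using bnd[OF k, of v] m(1) by (simp add: field_simps)
  qed
  with exp show ?thesis by blast
qed

text \<open>In a general normed space the difference of measurable maps need not be measurable. Here it is a
  continuous function of measurable real coordinates.\<close>

lemma finite_dim_borel_measurable_diff:
  fixes f g :: "'a \<Rightarrow> 'y::real_normed_vector"
  assumes fd: "\<exists>B::'y set. finite B \<and> span B = UNIV"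
    and [measurable]: "f \<in> borel_measurable M" "g \<in> borel_measurable M"
  shows "(\<lambda>\<omega>. f \<omega> - g \<omega>) \<in> borel_measurable M"
proof -
  obtain d :: nat and b :: "nat \<Rightarrow> 'y" and c where bc: "\<And>v. (\<Sum>k<d. c k v *\<^sub>R b k) = v" "\<And>k. k < d \<Longrightarrow> bounded_linear (c k)"
    using finite_dim_coordinates[OF fd] by (elim exE conjE) (use that in auto)
  have cm: "c k \<in> borel_measurable borel" if "k < d" for k
    using bc(2)[OF that] by (intro borel_measurable_continuous_onI linear_continuous_on)
  have u: "(\<lambda>\<omega>. if k < d then c k (f \<omega>) - c k (g \<omega>) else 0) \<in> borel_measurable M" for k
  proof (cases "k < d")
    case True
    note [measurable] = cm[OF True]
    show ?thesis using True by simp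
  qed simp
  define S where "S x = (\<Sum>k<d. x k *\<^sub>R b k)" for x :: "nat \<Rightarrow> real"
  have "continuous_on UNIV S" unfolding S_def[abs_def]
    by (intro continuous_intros continuous_on_product_coordinates)
  hence S: "S \<in> borel_measurable borel" by (rule borel_measurable_continuous_onI)
  have "(\<lambda>\<omega>. S (\<lambda>k. if k < d then c k (f \<omega>) - c k (g \<omega>) else 0)) \<in> borel_measurable M"
    by (rule measurable_compose[OF measurable_coordinatewise_then_product[OF u] S])
  moreover have "S (\<lambda>k. if k < d then c k (f \<omega>) - c k (g \<omega>) else 0) = f \<omega> - g \<omega>" for \<omega>
  proof -
    have "S (\<lambda>k. if k < d then c k (f \<omega>) - c k (g \<omega>) else 0) = (\<Sum>k<d. c k (f \<omega>) *\<^sub>R b k - c k (g \<omega>) *\<^sub>R b k)"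
      unfolding S_def by (intro sum.cong refl) (simp add: scaleR_diff_left)
    thus ?thesis by (simp add: sum_subtractf bc(1))
  qed
  ultimately show ?thesis by simp
qed

lemma finite_dim_abs_summable_on:
  fixes f :: "'i \<Rightarrow> 'y::real_normed_vector"
  assumes fd: "\<exists>B::'y set. finite B \<and> span B = UNIV" and "(\<lambda>i. norm (f i)) summable_on I"
  shows "f summable_on I"
proof -
  obtain d :: nat and b :: "nat \<Rightarrow> 'y" and c where bc: "\<And>v. (\<Sum>k<d. c k v *\<^sub>R b k) = v" "\<And>k. k < d \<Longrightarrow> bounded_linear (c k)"
    using finite_dim_coordinates[OF fd] by (elim exE conjE) (use that in auto)
  have "(\<lambda>i. c k (f i) *\<^sub>R b k) summable_on I" if k: "k < d" for k
  proof -
    obtain C where C: "\<And>v. norm (c k v) \<le> norm v * C"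
      using bounded_linear.bounded[OF bc(2)[OF k]] by blast
    have "(\<lambda>i. norm (c k (f i))) summable_on I"
    proof (rule summable_on_comparison_test)
      show "(\<lambda>i. norm (f i) * C) summable_on I" by (rule summable_on_cmult_left[OF assms(2)])
    qed (use C in auto)
    hence "(\<lambda>i. c k (f i)) summable_on I" by (rule abs_summable_summable)
    thus ?thesis
      using summable_on_bounded_linear[OF bounded_linear_scaleR_left[of "b k"]] by blast
  qed
  hence "(\<lambda>i. \<Sum>k<m. c k (f i) *\<^sub>R b k) summable_on I" if "m \<le> d" for m
    using that by (induction m) (auto intro: summable_on_add)
  from this[of d] show ?thesis by (simp add: bc(1))
qed

section \<open>Termwise differentiation\<close>

lemma has_sum_difference:
  fixes f g :: "'i \<Rightarrow> 'b::real_normed_vector"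
  assumes "(f has_sum a) I" "(g has_sum b) I"
  shows "((\<lambda>i. f i - g i) has_sum (a - b)) I"
  using has_sum_add[OF assms(1) has_sum_scaleR[OF assms(2), of "-1"]] by simp

text \<open>Split off a finite partial sum whose complement has derivative bounds of small total mass. The finite
  part is differentiable; the increments of the other terms are controlled by the mean value
  inequality, uniformly in their number.\<close>

lemma has_derivative_infinite_sum:
  fixes g :: "'i \<Rightarrow> 'a::real_normed_vector \<Rightarrow> 'b::real_normed_vector"
  assumes G: "open G" "convex G" "x \<in> G"
    and g: "\<And>i y. i \<in> I \<Longrightarrow> y \<in> G \<Longrightarrow> (g i has_derivative g' i y) (at y)"
    and bound: "\<And>i y h. i \<in> I \<Longrightarrow> y \<in> G \<Longrightarrow> norm (g' i y h) \<le> m i * norm h"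
    and m0: "\<And>i. i \<in> I \<Longrightarrow> 0 \<le> m i" and m: "m summable_on I"
    and f: "\<And>y. y \<in> G \<Longrightarrow> ((\<lambda>i. g i y) has_sum f y) I"
    and D: "\<And>h. ((\<lambda>i. g' i x h) has_sum D h) I"
  shows "(f has_derivative D) (at x)"
proof -
  have lin: "linear (g' i x)" if "i \<in> I" for i
    using g[OF that G(3)] by (rule has_derivative_linear)
  obtain S where S: "(m has_sum S) I" using m by (auto simp: summable_on_def)
  have bl: "bounded_linear D"
  proof (rule bounded_linear_intro[where K=S])
    fix h k :: 'a
    have "((\<lambda>i. g' i x h + g' i x k) has_sum D h + D k) I" by (intro has_sum_add D)
    moreover have "((\<lambda>i. g' i x h + g' i x k) has_sum D (h + k)) I"
      using D[of "h + k"] by (rule has_sum_cong[THEN iffD1, rotated]) (simp add: linear_add[OF lin])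
    ultimately show "D (h + k) = D h + D k" by (rule has_sum_unique[rotated])
  next
    fix c :: real and h :: 'a
    have "((\<lambda>i. c *\<^sub>R g' i x h) has_sum c *\<^sub>R D h) I" by (intro has_sum_scaleR D)
    moreover have "((\<lambda>i. c *\<^sub>R g' i x h) has_sum D (c *\<^sub>R h)) I"
      using D[of "c *\<^sub>R h"] by (rule has_sum_cong[THEN iffD1, rotated]) (simp add: linear_cmul[OF lin])
    ultimately show "D (c *\<^sub>R h) = c *\<^sub>R D h" by (rule has_sum_unique[rotated])
  next
    fix h :: 'a
    have "((\<lambda>i. m i * norm h) has_sum S * norm h) I" by (rule has_sum_cmult_left[OF S])
    from norm_infsum_le[OF D this] bound[OF _ G(3)] show "norm (D h) \<le> norm h * S" by (simp add: mult.commute)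
  qed
  show ?thesis
    unfolding has_derivative_at_alt
  proof (intro conjI bl allI impI)
    fix e :: real assume e: "e > 0"
    obtain F where F: "finite F" "F \<subseteq> I" "dist (sum m F) S \<le> e / 4"
      using has_sum_finite_approximation[OF S, of "e / 4"] e by auto
    have rest: "(m has_sum (S - sum m F)) (I - F)"
      using F by (intro has_sum_Diff S has_sum_finite)
    have restle: "S - sum m F \<le> e / 4" using F(3) unfolding dist_real_def by linarith
    have "((\<lambda>y. \<Sum>i\<in>F. g i y) has_derivative (\<lambda>h. \<Sum>i\<in>F. g' i x h)) (at x)"
      using F(2) G(3) by (intro has_derivative_sum g) auto
    from this[unfolded has_derivative_at_alt, THEN conjunct2, rule_format, OF half_gt_zero[OF e]]
    obtain d1 where d1: "d1 > 0" "\<forall>y. norm (y - x) < d1 \<longrightarrow>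
        norm ((\<Sum>i\<in>F. g i y) - (\<Sum>i\<in>F. g i x) - (\<Sum>i\<in>F. g' i x (y - x))) \<le> e / 2 * norm (y - x)"
      by (elim exE conjE)
    obtain d2 where d2: "d2 > 0" "ball x d2 \<subseteq> G" using G by (meson open_contains_ball)
    show "\<exists>d>0. \<forall>y. norm (y - x) < d \<longrightarrow> norm (f y - f x - D (y - x)) \<le> e * norm (y - x)"
    proof (intro exI[of _ "min d1 d2"] conjI allI impI)
      fix y assume y: "norm (y - x) < min d1 d2"
      have yG: "y \<in> G" using y d2(2) by (auto simp: dist_norm norm_minus_commute)
      define r where "r i = g i y - g i x - g' i x (y - x)" for i
      have r: "(r has_sum (f y - f x - D (y - x))) I"
        unfolding r_def[abs_def] by (intro has_sum_difference f D yG G(3))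
      have r2: "(r has_sum (f y - f x - D (y - x) - sum r F)) (I - F)"
        using F by (intro has_sum_Diff r has_sum_finite)
      have rle: "norm (r i) \<le> m i * (2 * norm (y - x))" if "i \<in> I - F" for i
      proof -
        have i: "i \<in> I" using that by simp
        have "norm (g i y - g i x) \<le> m i * norm (y - x)"
        proof (rule differentiable_bound[OF G(2)])
          show "(g i has_derivative g' i z) (at z within G)" if "z \<in> G" for z
            using g[OF i that] by (rule has_derivative_at_withinI)
          show "onorm (g' i z) \<le> m i" if "z \<in> G" for z
            by (rule onorm_bound) (use bound[OF i that] m0[OF i] in auto)
        qed (use yG G(3) in auto)
        moreover have "norm (g' i x (y - x)) \<le> m i * norm (y - x)" by (rule bound[OF i G(3)])
        ultimately show ?thesis unfolding r_def
          using norm_triangle_ineq4[of "g i y - g i x" "g' i x (y - x)"] by simp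
      qed
      have "norm (f y - f x - D (y - x) - sum r F) \<le> (S - sum m F) * (2 * norm (y - x))"
        by (rule norm_infsum_le[OF r2 has_sum_cmult_left[OF rest] rle])
      also have "\<dots> \<le> e / 4 * (2 * norm (y - x))" using restle by (intro mult_right_mono) auto
      finally have "norm (f y - f x - D (y - x) - sum r F) \<le> e / 2 * norm (y - x)" by simp
      moreover have "norm (sum r F) \<le> e / 2 * norm (y - x)"
        using d1(2)[rule_format, of y] y by (simp add: r_def sum_subtractf)
      ultimately show "norm (f y - f x - D (y - x)) \<le> e * norm (y - x)"
        using norm_triangle_ineq[of "f y - f x - D (y - x) - sum r F" "sum r F"] by simp
    qed (use d1 d2 in auto)
  qed
qed

section \<open>Power series in several variables\<close>

abbreviation multi_indices :: "('a::euclidean_space \<Rightarrow> nat) set" where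
  "multi_indices \<equiv> PiE Basis (\<lambda>_. UNIV)"

definition multi_degree :: "('a::euclidean_space \<Rightarrow> nat) \<Rightarrow> nat" where
  "multi_degree \<alpha> = (\<Sum>b\<in>Basis. \<alpha> b)"

definition monomial :: "('a::euclidean_space \<Rightarrow> nat) \<Rightarrow> 'a \<Rightarrow> real" where
  "monomial \<alpha> h = (\<Prod>b\<in>Basis. (h \<bullet> b) ^ \<alpha> b)"

text \<open>Convergence on the ball of radius \<open>R\<close> together with Cauchy-type estimates for the coefficients. The
  estimates are what termwise differentiation needs, and they are inherited by the derivatives.\<close>

definition power_series_at ::
    "('a::euclidean_space \<Rightarrow> 'b::real_normed_vector) \<Rightarrow> 'a \<Rightarrow> real \<Rightarrow> (('a \<Rightarrow> nat) \<Rightarrow> 'b) \<Rightarrow> real \<Rightarrow> bool" where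
  "power_series_at f x R c C \<longleftrightarrow> R > 0 \<and>
     (\<forall>\<alpha>\<in>multi_indices. norm (c \<alpha>) \<le> C / R ^ multi_degree \<alpha>) \<and>
     (\<forall>h. norm h < R \<longrightarrow> ((\<lambda>\<alpha>. monomial \<alpha> h *\<^sub>R c \<alpha>) has_sum f (x + h)) multi_indices)"

lemma monomial_le: "\<bar>monomial \<alpha> h\<bar> \<le> norm h ^ multi_degree \<alpha>"
proof -
  have "\<bar>monomial \<alpha> h\<bar> = (\<Prod>b\<in>Basis. \<bar>h \<bullet> b\<bar> ^ \<alpha> b)" by (simp add: monomial_def abs_prod power_abs)
  also have "\<dots> \<le> (\<Prod>b\<in>Basis. norm h ^ \<alpha> b)" by (intro prod_mono) (auto intro!: power_mono Basis_le_norm)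
  also have "\<dots> = norm h ^ multi_degree \<alpha>" by (simp add: multi_degree_def power_sum)
  finally show ?thesis .
qed

lemma monomial_scale: "monomial \<alpha> (t *\<^sub>R h) = t ^ multi_degree \<alpha> * monomial \<alpha> h"
  by (simp add: monomial_def multi_degree_def power_mult_distrib prod.distrib power_sum)

lemma summable_geometric_multi_indices:
  assumes "0 \<le> q" "q < (1::real)"
  shows "(\<lambda>\<alpha>. q ^ multi_degree \<alpha>) summable_on (multi_indices :: ('a::euclidean_space \<Rightarrow> nat) set)"
proof -
  have "Infinite_Set_Sum.abs_summable_on (\<lambda>\<alpha>. \<Prod>b\<in>Basis. q ^ \<alpha> b) (multi_indices :: ('a \<Rightarrow> nat) set)"
  proof (rule abs_summable_on_prod_PiE)
    show "Infinite_Set_Sum.abs_summable_on (\<lambda>n. q ^ n) (UNIV :: nat set)"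
      using assms by (simp add: abs_summable_on_nat_iff' summable_geometric power_abs)
  qed auto
  hence "(\<lambda>\<alpha>. norm (\<Prod>b\<in>Basis. q ^ \<alpha> b)) summable_on (multi_indices :: ('a \<Rightarrow> nat) set)"
    by (rule abs_summable_equivalent[THEN iffD2])
  thus ?thesis using assms(1) by (simp add: multi_degree_def power_sum abs_prod)
qed

lemma has_sum_bounded_terms:
  fixes f :: "'i \<Rightarrow> 'b::real_normed_vector"
  assumes "(f has_sum s) I"
  shows "\<exists>C\<ge>0. \<forall>i\<in>I. norm (f i) \<le> C"
proof -
  have "\<forall>\<^sub>F Y in finite_subsets_at_top I. dist (sum f Y) s < 1"
    using assms unfolding has_sum_def by (rule tendstoD) simp
  then obtain X where X: "finite X" "X \<subseteq> I"
      "\<forall>Y. finite Y \<and> X \<subseteq> Y \<and> Y \<subseteq> I \<longrightarrow> dist (sum f Y) s < 1"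
    unfolding eventually_finite_subsets_at_top by (elim exE conjE)
  have n0: "0 \<le> (\<Sum>j\<in>X. norm (f j))" by (intro sum_nonneg) auto
  have "norm (f i) \<le> 2 + (\<Sum>j\<in>X. norm (f j))" if i: "i \<in> I" for i
  proof (cases "i \<in> X")
    case True
    hence "norm (f i) \<le> (\<Sum>j\<in>X. norm (f j))" using X(1) by (intro member_le_sum) auto
    thus ?thesis by simp
  next
    case False
    have "f i = sum f (insert i X) - sum f X" using False X(1) by simp
    hence "norm (f i) = dist (sum f (insert i X)) (sum f X)" by (simp add: dist_norm)
    also have "\<dots> \<le> dist (sum f (insert i X)) s + dist (sum f X) s" by (rule dist_triangle2)
    also have "\<dots> \<le> 1 + 1"
    proof (intro add_mono less_imp_le)
      show "dist (sum f (insert i X)) s < 1" by (rule X(3)[rule_format]) (use X(1,2) i in auto)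
      show "dist (sum f X) s < 1" by (rule X(3)[rule_format]) (use X(1,2) in auto)
    qed
    finally show ?thesis using n0 by simp
  qed
  thus ?thesis using n0 by (intro exI[of _ "2 + (\<Sum>j\<in>X. norm (f j))"]) auto
qed

text \<open>The terms of a convergent sum are bounded. At a point \<open>z\<close> with all coordinates equal to \<open>r\<close>, the
  monomial of degree \<open>n\<close> is \<open>r ^ n\<close>, which yields the estimate of the coefficients.\<close>

lemma real_analytic_imp_power_series:
  fixes f :: "'a::euclidean_space \<Rightarrow> 'b::real_normed_vector"
  assumes "real_analytic_at f x"
  shows "\<exists>R c C. power_series_at f x R c C"
proof -
  obtain c and \<rho> :: real where c: "\<rho> > 0" "\<forall>y\<in>ball x \<rho>.
      ((\<lambda>\<alpha>. (\<Prod>b\<in>Basis. ((y - x) \<bullet> b) ^ \<alpha> b) *\<^sub>R c \<alpha>) has_sum f y) multi_indices"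
    using assms unfolding real_analytic_at_def by (elim exE conjE)
  have hs: "((\<lambda>\<alpha>. monomial \<alpha> h *\<^sub>R c \<alpha>) has_sum f (x + h)) multi_indices" if "norm h < \<rho>" for h
    using c(2)[rule_format, of "x + h"] that by (simp add: monomial_def dist_norm)
  \<comment> \<open>A cube of half side \<open>r\<close> lies in the ball of radius \<open>\<rho>\<close>.\<close>
  define r where "r = \<rho> / (2 * real DIM('a))"
  have r: "0 < r" "real DIM('a) * r < \<rho>" "r \<le> \<rho>"
  proof -
    have d: "real DIM('a) \<ge> 1" by (simp add: Suc_leI)
    show "0 < r" "real DIM('a) * r < \<rho>" using c(1) d by (auto simp: r_def)
    have "\<rho> / (2 * real DIM('a)) \<le> \<rho> / 1" using c(1) d
      by (intro divide_left_mono) (linarith, auto)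
    thus "r \<le> \<rho>" by (simp add: r_def)
  qed
  define z :: 'a where "z = (\<Sum>b\<in>Basis. r *\<^sub>R b)"
  have zb: "z \<bullet> b = r" if "b \<in> Basis" for b using that by (simp add: z_def inner_sum_left_Basis)
  have "norm z \<le> (\<Sum>b\<in>Basis. \<bar>z \<bullet> b\<bar>)" by (rule norm_le_l1)
  also have "\<dots> = real DIM('a) * r" using r(1) by (simp add: zb)
  finally have "norm z < \<rho>" using r(2) by simp
  from has_sum_bounded_terms[OF hs[OF this]]
  obtain C where C: "\<forall>\<alpha>\<in>multi_indices. norm (monomial \<alpha> z *\<^sub>R c \<alpha>) \<le> C" by (elim exE conjE)
  have mz: "monomial \<alpha> z = r ^ multi_degree \<alpha>" for \<alpha>
    by (simp add: monomial_def multi_degree_def zb power_sum)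
  have "norm (c \<alpha>) \<le> C / r ^ multi_degree \<alpha>" if "\<alpha> \<in> multi_indices" for \<alpha>
    using bspec[OF C that] r(1) by (simp add: mz pos_le_divide_eq mult.commute)
  hence "power_series_at f x r c C"
    unfolding power_series_at_def using r hs by auto
  thus ?thesis by blast
qed

lemma has_sum_finite_sum:
  fixes f :: "'k \<Rightarrow> 'i \<Rightarrow> 'b::real_normed_vector"
  assumes "finite A" "\<And>i. i \<in> A \<Longrightarrow> (f i has_sum s i) I"
  shows "((\<lambda>x. \<Sum>i\<in>A. f i x) has_sum (\<Sum>i\<in>A. s i)) I"
  using assms by (induction rule: finite_induct) (auto intro: has_sum_add)

lemma power_series_term_le:
  assumes "norm (c \<alpha>) \<le> C / R ^ multi_degree \<alpha>"
  shows "norm (monomial \<alpha> h *\<^sub>R c \<alpha>) \<le> C * (norm h / R) ^ multi_degree \<alpha>"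
proof -
  have "norm (monomial \<alpha> h *\<^sub>R c \<alpha>) = \<bar>monomial \<alpha> h\<bar> * norm (c \<alpha>)" by simp
  also have "\<dots> \<le> norm h ^ multi_degree \<alpha> * (C / R ^ multi_degree \<alpha>)"
    using assms by (intro mult_mono monomial_le) auto
  finally show ?thesis by (simp add: power_divide mult.commute)
qed

lemma power_series_cong:
  assumes "power_series_at f x R c C" "\<And>y. y \<in> ball x R \<Longrightarrow> f y = g y"
  shows "power_series_at g x R c C"
proof -
  have "f (x + h) = g (x + h)" if "norm h < R" for h using assms(2)[of "x + h"] that by (simp add: dist_norm)
  with assms(1) show ?thesis by (auto simp: power_series_at_def)
qed

lemma power_series_sum:
  fixes f :: "'i \<Rightarrow> 'a::euclidean_space \<Rightarrow> 'b::real_normed_vector"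
  assumes "finite A" "\<And>i. i \<in> A \<Longrightarrow> power_series_at (f i) x R (c i) (C i)" "R > 0"
  shows "power_series_at (\<lambda>y. \<Sum>i\<in>A. s i *\<^sub>R f i y) x R (\<lambda>\<alpha>. \<Sum>i\<in>A. s i *\<^sub>R c i \<alpha>) (\<Sum>i\<in>A. \<bar>s i\<bar> * C i)"
  unfolding power_series_at_def
proof (intro conjI ballI allI impI assms(3))
  fix \<alpha> :: "'a \<Rightarrow> nat" assume a: "\<alpha> \<in> multi_indices"
  have "norm (\<Sum>i\<in>A. s i *\<^sub>R c i \<alpha>) \<le> (\<Sum>i\<in>A. \<bar>s i\<bar> * norm (c i \<alpha>))" by (rule order_trans[OF norm_sum]) simp
  also have "\<dots> \<le> (\<Sum>i\<in>A. \<bar>s i\<bar> * (C i / R ^ multi_degree \<alpha>))"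
    using assms(2) a by (intro sum_mono mult_left_mono) (auto simp: power_series_at_def)
  finally show "norm (\<Sum>i\<in>A. s i *\<^sub>R c i \<alpha>) \<le> (\<Sum>i\<in>A. \<bar>s i\<bar> * C i) / R ^ multi_degree \<alpha>"
    by (simp add: sum_divide_distrib)
next
  fix h :: 'a assume h: "norm h < R"
  have "((\<lambda>\<alpha>. \<Sum>i\<in>A. s i *\<^sub>R (monomial \<alpha> h *\<^sub>R c i \<alpha>)) has_sum (\<Sum>i\<in>A. s i *\<^sub>R f i (x + h))) multi_indices"
    using assms(2) h by (intro has_sum_finite_sum assms(1) has_sum_scaleR) (auto simp: power_series_at_def)
  thus "((\<lambda>\<alpha>. monomial \<alpha> h *\<^sub>R (\<Sum>i\<in>A. s i *\<^sub>R c i \<alpha>)) has_sum (\<Sum>i\<in>A. s i *\<^sub>R f i (x + h))) multi_indices"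
    by (simp add: scaleR_sum_right mult.commute)
qed

text \<open>The coefficients of the partial derivative in the direction of the basis vector \<open>b\<close>.\<close>

definition coefficient_shift :: "'a \<Rightarrow> (('a \<Rightarrow> nat) \<Rightarrow> 'b::real_vector) \<Rightarrow> ('a \<Rightarrow> nat) \<Rightarrow> 'b" where
  "coefficient_shift b c \<beta> = real (Suc (\<beta> b)) *\<^sub>R c (\<beta>(b := Suc (\<beta> b)))"

definition monomial_partial :: "'a::euclidean_space \<Rightarrow> ('a \<Rightarrow> nat) \<Rightarrow> 'a \<Rightarrow> real" where
  "monomial_partial b \<alpha> z = real (\<alpha> b) * (z \<bullet> b) ^ (\<alpha> b - 1) * (\<Prod>k\<in>Basis - {b}. (z \<bullet> k) ^ \<alpha> k)"

lemma monomial_has_derivative: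
  "(monomial \<alpha> has_derivative (\<lambda>h. \<Sum>b\<in>Basis. (h \<bullet> b) * monomial_partial b \<alpha> z)) (at z)"
proof -
  have "((\<lambda>z. \<Prod>b\<in>Basis. (z \<bullet> b) ^ \<alpha> b) has_derivative
     (\<lambda>h. \<Sum>b\<in>Basis. (of_nat (\<alpha> b) * (h \<bullet> b) * (z \<bullet> b) ^ (\<alpha> b - 1)) * (\<Prod>k\<in>Basis - {b}. (z \<bullet> k) ^ \<alpha> k))) (at z)"
    by (intro has_derivative_prod has_derivative_power bounded_linear_imp_has_derivative bounded_linear_inner_left)
  thus ?thesis by (simp add: monomial_def[abs_def] monomial_partial_def mult_ac)
qed

lemma monomial_partial_le:
  assumes b: "b \<in> Basis"
  shows "\<bar>monomial_partial b \<alpha> z\<bar> \<le> real (\<alpha> b) * norm z ^ (multi_degree \<alpha> - 1)"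
proof (cases "\<alpha> b = 0")
  case True thus ?thesis by (simp add: monomial_partial_def)
next
  case False
  have deg: "multi_degree \<alpha> - 1 = (\<alpha> b - 1) + (\<Sum>k\<in>Basis - {b}. \<alpha> k)"
    using False b by (simp add: multi_degree_def sum.remove[OF finite_Basis b])
  have "\<bar>monomial_partial b \<alpha> z\<bar> = real (\<alpha> b) * (\<bar>z \<bullet> b\<bar> ^ (\<alpha> b - 1) * (\<Prod>k\<in>Basis - {b}. \<bar>z \<bullet> k\<bar> ^ \<alpha> k))"
    by (simp add: monomial_partial_def abs_mult abs_prod power_abs)
  also have "\<dots> \<le> real (\<alpha> b) * (norm z ^ (\<alpha> b - 1) * (\<Prod>k\<in>Basis - {b}. norm z ^ \<alpha> k))"
    using b by (intro mult_left_mono mult_mono prod_mono conjI power_mono Basis_le_norm) (auto intro!: prod_nonneg)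
  also have "\<dots> = real (\<alpha> b) * norm z ^ (multi_degree \<alpha> - 1)"
    unfolding deg by (simp add: power_add power_sum)
  finally show ?thesis .
qed

lemma monomial_partial_shift:
  assumes b: "b \<in> Basis"
  shows "monomial_partial b (\<beta>(b := Suc (\<beta> b))) z = real (Suc (\<beta> b)) * monomial \<beta> z"
proof -
  have "(\<Prod>k\<in>Basis - {b}. (z \<bullet> k) ^ (\<beta>(b := Suc (\<beta> b))) k) = (\<Prod>k\<in>Basis - {b}. (z \<bullet> k) ^ \<beta> k)"
    by (intro prod.cong refl) auto
  thus ?thesis by (simp add: monomial_partial_def monomial_def prod.remove[OF finite_Basis b])
qed

lemma multi_degree_shift:
  assumes b: "b \<in> Basis"
  shows "multi_degree (\<beta>(b := Suc (\<beta> b))) = Suc (multi_degree \<beta>)"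
proof -
  have "(\<Sum>k\<in>Basis - {b}. (\<beta>(b := Suc (\<beta> b))) k) = (\<Sum>k\<in>Basis - {b}. \<beta> k)"
    by (intro sum.cong refl) auto
  thus ?thesis by (simp add: multi_degree_def sum.remove[OF finite_Basis b])
qed

text \<open>Multi-indices with \<open>\<alpha> b = 0\<close> do not contribute to the partial derivative, and the others are the
  shifts of arbitrary multi-indices.\<close>

lemma has_sum_partial_iff_shift:
  assumes b: "b \<in> (Basis :: 'a::euclidean_space set)"
  shows "((\<lambda>\<alpha>. monomial_partial b \<alpha> z *\<^sub>R c \<alpha>) has_sum s) multi_indices \<longleftrightarrow>
    ((\<lambda>\<beta>. monomial \<beta> z *\<^sub>R coefficient_shift b c \<beta>) has_sum s) multi_indices"
proof -
  let ?\<sigma> = "\<lambda>\<beta>::'a \<Rightarrow> nat. \<beta>(b := Suc (\<beta> b))"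
  have inj: "inj_on ?\<sigma> multi_indices"
  proof (rule inj_onI)
    fix \<alpha> \<beta> :: "'a \<Rightarrow> nat" assume e: "?\<sigma> \<alpha> = ?\<sigma> \<beta>"
    show "\<alpha> = \<beta>"
    proof
      fix k show "\<alpha> k = \<beta> k" using fun_cong[OF e, of k] by (cases "k = b") auto
    qed
  qed
  have img: "\<alpha> \<in> ?\<sigma> ` multi_indices \<longleftrightarrow> \<alpha> b \<noteq> 0" if a: "\<alpha> \<in> multi_indices" for \<alpha> :: "'a \<Rightarrow> nat"
  proof
    assume "\<alpha> b \<noteq> 0"
    hence "\<alpha> = ?\<sigma> (\<alpha>(b := \<alpha> b - 1))" by (auto simp: fun_eq_iff)
    moreover have "\<alpha>(b := \<alpha> b - 1) \<in> multi_indices" using a b by (auto simp: PiE_def extensional_def)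
    ultimately show "\<alpha> \<in> ?\<sigma> ` multi_indices" by (rule image_eqI)
  qed auto
  have sub: "?\<sigma> ` multi_indices \<subseteq> multi_indices" using b by (auto simp: PiE_def extensional_def)
  have "((\<lambda>\<alpha>. monomial_partial b \<alpha> z *\<^sub>R c \<alpha>) has_sum s) multi_indices \<longleftrightarrow>
     ((\<lambda>\<alpha>. monomial_partial b \<alpha> z *\<^sub>R c \<alpha>) has_sum s) (?\<sigma> ` multi_indices)"
  proof (rule has_sum_cong_neutral)
    fix \<alpha> assume "\<alpha> \<in> multi_indices - ?\<sigma> ` multi_indices"
    hence "\<alpha> b = 0" using img[of \<alpha>] by blast
    thus "monomial_partial b \<alpha> z *\<^sub>R c \<alpha> = 0" by (simp add: monomial_partial_def)
  qed (use sub in auto)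
  also have "\<dots> \<longleftrightarrow> (((\<lambda>\<alpha>. monomial_partial b \<alpha> z *\<^sub>R c \<alpha>) \<circ> ?\<sigma>) has_sum s) multi_indices"
    by (rule has_sum_reindex[OF inj])
  also have "\<dots> \<longleftrightarrow> ((\<lambda>\<beta>. monomial \<beta> z *\<^sub>R coefficient_shift b c \<beta>) has_sum s) multi_indices"
    by (rule has_sum_cong) (simp add: monomial_partial_shift[OF b] coefficient_shift_def mult.commute)
  finally show ?thesis .
qed

lemma of_nat_mult_half_power_le: "real n * (1/2) ^ n \<le> 2 * (3/4) ^ n"
proof -
  have "1 + real n * (1/2) \<le> (1 + 1/2) ^ n" by (rule Bernoulli_inequality) simp
  hence "real n \<le> 2 * (3/2) ^ n" by simp
  hence "real n * (1/2) ^ n \<le> 2 * (3/2) ^ n * (1/2) ^ n" by (rule mult_right_mono) simp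
  also have "\<dots> = 2 * (3/4) ^ n" by (simp flip: power_mult_distrib)
  finally show ?thesis .
qed

text \<open>Halving the radius turns the estimate \<open>C / R ^ n\<close> into a geometric series, which absorbs the factor
  that differentiation produces: \<open>\<beta> b + 1 \<le> 2 ^ n\<close> for the coefficients, and the total degree
  for the termwise bounds.\<close>

lemma power_series_derivative:
  fixes f :: "'a::euclidean_space \<Rightarrow> 'b::real_normed_vector"
  assumes fd: "\<exists>B::'b set. finite B \<and> span B = UNIV" and f: "power_series_at f x R c C"
  shows "\<exists>F. (\<forall>b\<in>Basis. power_series_at (F b) x (R / 2) (coefficient_shift b c) (C / R)) \<and>
    (\<forall>y\<in>ball x (R / 2). (f has_derivative (\<lambda>h. \<Sum>b\<in>Basis. (h \<bullet> b) *\<^sub>R F b y)) (at y))"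
proof -
  have R: "R > 0" and c: "\<And>\<alpha>. \<alpha> \<in> multi_indices \<Longrightarrow> norm (c \<alpha>) \<le> C / R ^ multi_degree \<alpha>"
    and fs: "\<And>h. norm h < R \<Longrightarrow> ((\<lambda>\<alpha>. monomial \<alpha> h *\<^sub>R c \<alpha>) has_sum f (x + h)) multi_indices"
    using f by (auto simp: power_series_at_def)
  have C0: "C \<ge> 0"
  proof -
    have "restrict (\<lambda>_. 0) Basis \<in> (multi_indices :: ('a \<Rightarrow> nat) set)" by auto
    from order_trans[OF norm_ge_zero c[OF this]] show ?thesis by (simp add: multi_degree_def)
  qed
  define F where "F b y = (\<Sum>\<^sub>\<infinity>\<beta>\<in>multi_indices. monomial \<beta> (y - x) *\<^sub>R coefficient_shift b c \<beta>)" for b y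
  have shift: "norm (coefficient_shift b c \<beta>) \<le> (C / R) / (R / 2) ^ multi_degree \<beta>"
    if b: "b \<in> Basis" and \<beta>: "\<beta> \<in> multi_indices" for b \<beta>
  proof -
    have "\<beta>(b := Suc (\<beta> b)) \<in> multi_indices" using b \<beta> by (auto simp: PiE_def extensional_def)
    hence n: "norm (c (\<beta>(b := Suc (\<beta> b)))) \<le> C / R ^ Suc (multi_degree \<beta>)"
      using c multi_degree_shift[OF b, of \<beta>] by metis
    have "Suc (\<beta> b) \<le> 2 ^ \<beta> b" by (simp add: Suc_leI)
    also have "(2::nat) ^ \<beta> b \<le> 2 ^ multi_degree \<beta>"
      by (rule power_increasing) (auto simp: multi_degree_def b intro: member_le_sum)
    finally have "real (Suc (\<beta> b)) \<le> 2 ^ multi_degree \<beta>" by (metis of_nat_le_iff of_nat_numeral of_nat_power)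
    hence "norm (coefficient_shift b c \<beta>) \<le> 2 ^ multi_degree \<beta> * (C / R ^ Suc (multi_degree \<beta>))"
      unfolding coefficient_shift_def norm_scaleR using n by (intro mult_mono) auto
    also have "\<dots> = (C / R) / (R / 2) ^ multi_degree \<beta>" using R by (simp add: power_divide field_simps)
    finally show ?thesis .
  qed
  have Fs: "((\<lambda>\<beta>. monomial \<beta> h *\<^sub>R coefficient_shift b c \<beta>) has_sum F b (x + h)) multi_indices"
    if b: "b \<in> Basis" and h: "norm h < R / 2" for b h
  proof -
    have "(\<lambda>\<beta>. norm (monomial \<beta> h *\<^sub>R coefficient_shift b c \<beta>)) summable_on multi_indices"
    proof (rule summable_on_comparison_test)
      show "(\<lambda>\<beta>. (C / R) * (norm h / (R / 2)) ^ multi_degree \<beta>) summable_on (multi_indices :: ('a \<Rightarrow> nat) set)"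
        using h R by (intro summable_on_cmult_right summable_geometric_multi_indices) auto
      show "norm (monomial \<beta> h *\<^sub>R coefficient_shift b c \<beta>) \<le> (C / R) * (norm h / (R / 2)) ^ multi_degree \<beta>"
        if "\<beta> \<in> multi_indices" for \<beta> by (rule power_series_term_le[where c="coefficient_shift b c" and C="C / R" and R="R / 2", OF shift[OF b that]])
    qed simp
    from finite_dim_abs_summable_on[OF fd this] show ?thesis by (simp add: F_def)
  qed
  have P1: "power_series_at (F b) x (R / 2) (coefficient_shift b c) (C / R)" if "b \<in> Basis" for b
    unfolding power_series_at_def using R shift[OF that] Fs[OF that] by auto
  have P2: "(f has_derivative (\<lambda>h. \<Sum>b\<in>Basis. (h \<bullet> b) *\<^sub>R F b y)) (at y)" if y: "y \<in> ball x (R / 2)" for y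
  proof (rule has_derivative_infinite_sum[where I=multi_indices and G="ball x (R / 2)"
        and g="\<lambda>\<alpha> y. monomial \<alpha> (y - x) *\<^sub>R c \<alpha>" and m="\<lambda>\<alpha>. 4 * C / R * (3/4) ^ multi_degree \<alpha>"
        and g'="\<lambda>\<alpha> y h. (\<Sum>b\<in>Basis. (h \<bullet> b) * monomial_partial b \<alpha> (y - x)) *\<^sub>R c \<alpha>"])
    fix \<alpha> :: "'a \<Rightarrow> nat" and z assume \<alpha>: "\<alpha> \<in> multi_indices" and z: "z \<in> ball x (R / 2)"
    have "((\<lambda>y. y - x) has_derivative (\<lambda>h. h)) (at z)" by (auto intro!: derivative_eq_intros)
    from has_derivative_compose[OF this monomial_has_derivative]
    have "((\<lambda>y. monomial \<alpha> (y - x)) has_derivative (\<lambda>h. \<Sum>b\<in>Basis. (h \<bullet> b) * monomial_partial b \<alpha> (z - x))) (at z)" .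
    thus "((\<lambda>y. monomial \<alpha> (y - x) *\<^sub>R c \<alpha>) has_derivative
        (\<lambda>h. (\<Sum>b\<in>Basis. (h \<bullet> b) * monomial_partial b \<alpha> (z - x)) *\<^sub>R c \<alpha>)) (at z)"
      by (rule has_derivative_scaleR_left)
    fix h :: 'a
    define n where "n = multi_degree \<alpha>"
    have nz: "norm (z - x) \<le> R / 2" using z by (simp add: dist_norm norm_minus_commute)
    have "\<bar>\<Sum>b\<in>Basis. (h \<bullet> b) * monomial_partial b \<alpha> (z - x)\<bar> \<le> (\<Sum>b\<in>Basis. norm h * (real (\<alpha> b) * norm (z - x) ^ (n - 1)))"
      unfolding n_def
    proof (rule order_trans[OF sum_abs], rule sum_mono)
      fix b :: 'a assume b: "b \<in> Basis"
      show "\<bar>(h \<bullet> b) * monomial_partial b \<alpha> (z - x)\<bar> \<le> norm h * (real (\<alpha> b) * norm (z - x) ^ (multi_degree \<alpha> - 1))"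
        unfolding abs_mult by (intro mult_mono Basis_le_norm[OF b] monomial_partial_le[OF b]) auto
    qed
    also have "\<dots> = norm h * (real n * norm (z - x) ^ (n - 1))"
      by (simp add: n_def multi_degree_def sum_distrib_left sum_distrib_right mult_ac)
    also have "\<dots> \<le> norm h * (real n * (R / 2) ^ (n - 1))"
      by (intro mult_left_mono power_mono nz) auto
    finally have "norm ((\<Sum>b\<in>Basis. (h \<bullet> b) * monomial_partial b \<alpha> (z - x)) *\<^sub>R c \<alpha>)
        \<le> (norm h * (real n * (R / 2) ^ (n - 1))) * (C / R ^ n)"
      unfolding norm_scaleR n_def using c[OF \<alpha>] R by (intro mult_mono) auto
    also have "\<dots> = norm h * (2 * C / R) * (real n * (1/2) ^ n)"
    proof (cases n)
      case (Suc k)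
      thus ?thesis using R by (simp add: power_divide field_simps)
    qed simp
    also have "\<dots> \<le> norm h * (2 * C / R) * (2 * (3/4) ^ n)"
      using C0 R by (intro mult_left_mono of_nat_mult_half_power_le) auto
    finally show "norm ((\<Sum>b\<in>Basis. (h \<bullet> b) * monomial_partial b \<alpha> (z - x)) *\<^sub>R c \<alpha>)
        \<le> 4 * C / R * (3/4) ^ multi_degree \<alpha> * norm h"
      by (simp add: n_def mult_ac)
  next
    show "(\<lambda>\<alpha>. 4 * C / R * (3/4) ^ multi_degree \<alpha>) summable_on (multi_indices :: ('a \<Rightarrow> nat) set)"
      by (intro summable_on_cmult_right summable_geometric_multi_indices) auto
    show "((\<lambda>\<alpha>. monomial \<alpha> (z - x) *\<^sub>R c \<alpha>) has_sum f z) multi_indices" if "z \<in> ball x (R / 2)" for z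
      using fs[of "z - x"] that R by (simp add: dist_norm norm_minus_commute)
    fix h :: 'a
    have "((\<lambda>\<alpha>. \<Sum>b\<in>Basis. (h \<bullet> b) *\<^sub>R (monomial_partial b \<alpha> (y - x) *\<^sub>R c \<alpha>)) has_sum (\<Sum>b\<in>Basis. (h \<bullet> b) *\<^sub>R F b y)) multi_indices"
    proof (intro has_sum_finite_sum has_sum_scaleR finite_Basis)
      fix b :: 'a assume b: "b \<in> Basis"
      show "((\<lambda>\<alpha>. monomial_partial b \<alpha> (y - x) *\<^sub>R c \<alpha>) has_sum F b y) multi_indices"
        using Fs[OF b, of "y - x"] y unfolding has_sum_partial_iff_shift[OF b]
        by (simp add: dist_norm norm_minus_commute)
    qed
    thus "((\<lambda>\<alpha>. (\<Sum>b\<in>Basis. (h \<bullet> b) * monomial_partial b \<alpha> (y - x)) *\<^sub>R c \<alpha>) has_sum (\<Sum>b\<in>Basis. (h \<bullet> b) *\<^sub>R F b y)) multi_indices"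
      by (simp add: scaleR_sum_left)
  qed (use y C0 R in auto)
  show ?thesis by (intro exI[of _ F] conjI ballI P1 P2)
qed

text \<open>The radius shrinks with the order of the differential. This does no harm, since for each order only
  a neighbourhood of \<open>x\<close> is needed.\<close>

lemma frechet_differential_power_series:
  fixes f :: "'a::euclidean_space \<Rightarrow> 'b::real_normed_vector"
  assumes fd: "\<exists>B::'b set. finite B \<and> span B = UNIV" and f: "power_series_at f x R c C"
  shows "\<exists>c' C'. power_series_at (frechet_differential f hs) x (R / 2 ^ length hs) c' C'"
proof (induction hs)
  case Nil
  have "frechet_differential f [] = f" by (rule ext) simp
  thus ?case using f by auto
next
  case (Cons h hs)
  define S where "S = R / 2 ^ length hs"
  obtain c' C' where c': "power_series_at (frechet_differential f hs) x S c' C'"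
    using Cons by (auto simp: S_def)
  obtain F where F: "\<forall>b\<in>Basis. power_series_at (F b) x (S / 2) (coefficient_shift b c') (C' / S)"
    "\<forall>y\<in>ball x (S / 2). (frechet_differential f hs has_derivative (\<lambda>h. \<Sum>b\<in>Basis. (h \<bullet> b) *\<^sub>R F b y)) (at y)"
    using power_series_derivative[OF fd c'] by (elim exE conjE)
  have S: "S / 2 > 0" using c' by (simp add: power_series_at_def)
  have "power_series_at (\<lambda>y. \<Sum>b\<in>Basis. (h \<bullet> b) *\<^sub>R F b y) x (S / 2)
     (\<lambda>\<alpha>. \<Sum>b\<in>Basis. (h \<bullet> b) *\<^sub>R coefficient_shift b c' \<alpha>) (\<Sum>b\<in>Basis. \<bar>h \<bullet> b\<bar> * (C' / S))"
    using F(1) S by (intro power_series_sum) auto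
  hence "power_series_at (frechet_differential f (h # hs)) x (S / 2)
     (\<lambda>\<alpha>. \<Sum>b\<in>Basis. (h \<bullet> b) *\<^sub>R coefficient_shift b c' \<alpha>) (\<Sum>b\<in>Basis. \<bar>h \<bullet> b\<bar> * (C' / S))"
  proof (rule power_series_cong)
    fix y assume "y \<in> ball x (S / 2)"
    from frechet_derivative_at[OF bspec[OF F(2) this]]
    show "(\<Sum>b\<in>Basis. (h \<bullet> b) *\<^sub>R F b y) = frechet_differential f (h # hs) y" by (simp add: fun_eq_iff)
  qed
  moreover have "S / 2 = R / 2 ^ length (h # hs)" by (simp add: S_def)
  ultimately show ?case by metis
qed

lemma power_series_iterated_differentiable_on:
  fixes f :: "'a::euclidean_space \<Rightarrow> 'b::real_normed_vector"
  assumes fd: "\<exists>B::'b set. finite B \<and> span B = UNIV" and f: "power_series_at f x R c C"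
  shows "iterated_differentiable_on r f (ball x (R / 2 ^ r))"
  unfolding iterated_differentiable_on_def
proof (intro allI impI)
  fix hs :: "'a list" and y assume l: "length hs < r" and y: "y \<in> ball x (R / 2 ^ r)"
  define S where "S = R / 2 ^ length hs"
  obtain c' C' where "power_series_at (frechet_differential f hs) x S c' C'"
    using frechet_differential_power_series[OF fd f] unfolding S_def by blast
  from power_series_derivative[OF fd this]
  obtain F where F: "\<forall>y\<in>ball x (S / 2). (frechet_differential f hs has_derivative (\<lambda>h. \<Sum>b\<in>Basis. (h \<bullet> b) *\<^sub>R F b y)) (at y)"
    by (elim exE conjE)
  have R: "R > 0" using f by (simp add: power_series_at_def)
  have "(2::real) ^ Suc (length hs) \<le> 2 ^ r" using l by (intro power_increasing) auto
  hence "R / 2 ^ r \<le> R / 2 ^ Suc (length hs)" using R by (intro divide_left_mono) auto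
  also have "\<dots> = S / 2" by (simp add: S_def)
  finally have "y \<in> ball x (S / 2)" using y unfolding mem_ball by linarith
  from bspec[OF F this] show "frechet_differential f hs differentiable (at y)" unfolding differentiable_def by blast
qed

section \<open>The Taylor series of an analytic map\<close>

text \<open>A polynomial of degree at most \<open>r\<close> that is \<open>o(t ^ r)\<close> at the origin vanishes: dropping its leading
  term leaves a polynomial of lower degree that is still small enough.\<close>

lemma vector_polynomial_zero:
  fixes v :: "nat \<Rightarrow> 'b::real_normed_vector"
  assumes "\<And>\<eta>. \<eta> > 0 \<Longrightarrow> \<exists>\<delta>>0. \<forall>t. 0 < t \<longrightarrow> t < \<delta> \<longrightarrow> norm (\<Sum>j\<le>r. t ^ j *\<^sub>R v j) \<le> \<eta> * t ^ r"
    and "j \<le> r"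
  shows "v j = 0"
  using assms
proof (induction r arbitrary: j)
  case 0
  have "norm (v 0) \<le> 0"
  proof (rule field_le_epsilon)
    fix e :: real assume "e > 0"
    from 0(1)[OF this] obtain \<delta> where \<delta>: "\<delta> > 0" "\<forall>t. 0 < t \<longrightarrow> t < \<delta> \<longrightarrow> norm (\<Sum>j\<le>0. t ^ j *\<^sub>R v j) \<le> e * t ^ 0"
      by (elim exE conjE)
    from \<delta>(2)[rule_format, of "\<delta> / 2"] \<delta>(1) show "norm (v 0) \<le> 0 + e" by simp
  qed
  thus ?case using 0(2) by simp
next
  case (Suc r)
  have low: "v j = 0" if "j \<le> r" for j
  proof (rule Suc.IH[OF _ that])
    fix \<eta> :: real assume \<eta>: "\<eta> > 0"
    from Suc.prems(1)[OF zero_less_one] obtain \<delta> where \<delta>: "\<delta> > 0"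
        "\<forall>t. 0 < t \<longrightarrow> t < \<delta> \<longrightarrow> norm (\<Sum>j\<le>Suc r. t ^ j *\<^sub>R v j) \<le> 1 * t ^ Suc r"
      by (elim exE conjE)
    define n where "n = 1 + norm (v (Suc r))"
    have n: "n > 0" unfolding n_def by (rule add_pos_nonneg) auto
    show "\<exists>\<delta>>0. \<forall>t. 0 < t \<longrightarrow> t < \<delta> \<longrightarrow> norm (\<Sum>j\<le>r. t ^ j *\<^sub>R v j) \<le> \<eta> * t ^ r"
    proof (intro exI[of _ "min \<delta> (\<eta> / n)"] conjI allI impI)
      fix t assume t: "0 < t" "t < min \<delta> (\<eta> / n)"
      have "(\<Sum>j\<le>r. t ^ j *\<^sub>R v j) = (\<Sum>j\<le>Suc r. t ^ j *\<^sub>R v j) - t ^ Suc r *\<^sub>R v (Suc r)" by simp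
      hence "norm (\<Sum>j\<le>r. t ^ j *\<^sub>R v j) \<le> norm (\<Sum>j\<le>Suc r. t ^ j *\<^sub>R v j) + norm (t ^ Suc r *\<^sub>R v (Suc r))"
        by (simp only: norm_triangle_ineq4)
      also have "\<dots> \<le> 1 * t ^ Suc r + t ^ Suc r * norm (v (Suc r))"
        using \<delta>(2)[rule_format, of t] t by (intro add_mono) (auto simp: abs_mult)
      also have "\<dots> = (t * n) * t ^ r" by (simp add: n_def algebra_simps)
      also have "\<dots> \<le> \<eta> * t ^ r" using t n by (intro mult_right_mono) (auto simp: pos_less_divide_eq less_imp_le)
      finally show "norm (\<Sum>j\<le>r. t ^ j *\<^sub>R v j) \<le> \<eta> * t ^ r" .
    qed (use \<delta>(1) \<eta> n in auto)
  qed
  have "norm (v (Suc r)) \<le> 0"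
  proof (rule field_le_epsilon)
    fix e :: real assume "e > 0"
    from Suc.prems(1)[OF this] obtain \<delta> where \<delta>: "\<delta> > 0"
        "\<forall>t. 0 < t \<longrightarrow> t < \<delta> \<longrightarrow> norm (\<Sum>j\<le>Suc r. t ^ j *\<^sub>R v j) \<le> e * t ^ Suc r"
      by (elim exE conjE)
    define t where "t = \<delta> / 2"
    have t: "0 < t" "t < \<delta>" using \<delta>(1) by (auto simp: t_def)
    have "t ^ Suc r * norm (v (Suc r)) \<le> t ^ Suc r * e"
      using \<delta>(2)[rule_format, OF t] t(1) by (simp add: low abs_mult mult_ac)
    thus "norm (v (Suc r)) \<le> 0 + e" using t(1) by (simp del: power_Suc)
  qed
  thus ?case using low Suc.prems(2) by (cases "j = Suc r") auto
qed

text \<open>The part of degree \<open>j\<close> of a power series: grouping by total degree turns a series over multi-indices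
  into a series over natural numbers.\<close>

definition homogeneous_part ::
    "(('a::euclidean_space \<Rightarrow> nat) \<Rightarrow> 'b::real_normed_vector) \<Rightarrow> nat \<Rightarrow> 'a \<Rightarrow> 'b" where
  "homogeneous_part c j h = (\<Sum>\<alpha> | \<alpha> \<in> multi_indices \<and> multi_degree \<alpha> = j. monomial \<alpha> h *\<^sub>R c \<alpha>)"

lemma finite_multi_degree: "finite {\<alpha> :: 'a::euclidean_space \<Rightarrow> nat. \<alpha> \<in> multi_indices \<and> multi_degree \<alpha> = j}"
proof (rule finite_subset)
  show "{\<alpha> :: 'a \<Rightarrow> nat. \<alpha> \<in> multi_indices \<and> multi_degree \<alpha> = j} \<subseteq> PiE Basis (\<lambda>_. {..j})"
  proof
    fix \<alpha> :: "'a \<Rightarrow> nat" assume a: "\<alpha> \<in> {\<alpha>. \<alpha> \<in> multi_indices \<and> multi_degree \<alpha> = j}"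
    have "\<alpha> b \<le> j" if "b \<in> Basis" for b
      using a member_le_sum[OF that, of \<alpha>] by (simp add: multi_degree_def)
    thus "\<alpha> \<in> PiE Basis (\<lambda>_. {..j})" using a by (auto simp: PiE_def)
  qed
qed (auto intro: finite_PiE)

lemma homogeneous_part_scale: "homogeneous_part c j (t *\<^sub>R h) = t ^ j *\<^sub>R homogeneous_part c j h"
  unfolding homogeneous_part_def scaleR_sum_right by (intro sum.cong refl) (simp add: monomial_scale)

lemma homogeneous_part_sums:
  assumes f: "power_series_at f x R c C" and h: "norm h < R"
  shows "((\<lambda>j. homogeneous_part c j h) has_sum f (x + h)) UNIV"
proof -
  let ?M = "\<lambda>j. {\<alpha> :: 'a \<Rightarrow> nat. \<alpha> \<in> multi_indices \<and> multi_degree \<alpha> = j}"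
  let ?p = "\<lambda>\<alpha> :: 'a \<Rightarrow> nat. (multi_degree \<alpha>, \<alpha>)"
  have inj: "inj_on ?p multi_indices" by (rule inj_onI) simp
  have img: "?p ` multi_indices = Sigma UNIV ?M" by auto
  have "((\<lambda>\<alpha>. monomial \<alpha> h *\<^sub>R c \<alpha>) has_sum f (x + h)) multi_indices"
    using f h by (simp add: power_series_at_def)
  hence "(((\<lambda>(j, \<alpha>). monomial \<alpha> h *\<^sub>R c \<alpha>) \<circ> ?p) has_sum f (x + h)) multi_indices"
    by (simp add: o_def)
  hence "((\<lambda>(j, \<alpha>). monomial \<alpha> h *\<^sub>R c \<alpha>) has_sum f (x + h)) (Sigma UNIV ?M)"
    unfolding img[symmetric] has_sum_reindex[OF inj] .
  thus ?thesis
    by (rule has_sum_SigmaD) (simp add: homogeneous_part_def has_sum_finite finite_multi_degree)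
qed

lemma homogeneous_part_bound:
  fixes f :: "'a::euclidean_space \<Rightarrow> 'b::real_normed_vector"
  assumes f: "power_series_at f x R c C"
  shows "\<exists>K\<ge>0. \<forall>j h. norm (homogeneous_part c j h) \<le> K * (2 * norm h / R) ^ j"
proof -
  have R: "R > 0" and c: "\<And>\<alpha>. \<alpha> \<in> multi_indices \<Longrightarrow> norm (c \<alpha>) \<le> C / R ^ multi_degree \<alpha>"
    using f by (auto simp: power_series_at_def)
  have C0: "C \<ge> 0"
  proof -
    have "restrict (\<lambda>_. 0) Basis \<in> (multi_indices :: ('a \<Rightarrow> nat) set)" by auto
    from order_trans[OF norm_ge_zero c[OF this]] show ?thesis by (simp add: multi_degree_def)
  qed
  define Q where "Q = (\<Sum>\<^sub>\<infinity>\<alpha>\<in>(multi_indices :: ('a \<Rightarrow> nat) set). (1/2::real) ^ multi_degree \<alpha>)"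
  have Q0: "Q \<ge> 0" unfolding Q_def by (rule infsum_nonneg) simp
  have "norm (homogeneous_part c j h) \<le> (C * Q) * (2 * norm h / R) ^ j" for j h
  proof -
    let ?M = "{\<alpha> :: 'a \<Rightarrow> nat. \<alpha> \<in> multi_indices \<and> multi_degree \<alpha> = j}"
    have "norm (homogeneous_part c j h) \<le> (\<Sum>\<alpha>\<in>?M. C * (norm h / R) ^ multi_degree \<alpha>)"
      unfolding homogeneous_part_def
      by (rule sum_norm_le, rule power_series_term_le[where c=c and C=C and R=R, OF c]) simp
    also have "\<dots> = (\<Sum>\<alpha>\<in>?M. (C * (2 * norm h / R) ^ j) * (1/2) ^ multi_degree \<alpha>)"
      by (intro sum.cong refl) (auto simp: power_divide power_mult_distrib)
    also have "\<dots> = (C * (2 * norm h / R) ^ j) * (\<Sum>\<alpha>\<in>?M. (1/2) ^ multi_degree \<alpha>)"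
      by (simp only: sum_distrib_left)
    also have "\<dots> \<le> (C * (2 * norm h / R) ^ j) * Q"
      unfolding Q_def using C0 R
      by (intro mult_left_mono finite_sum_le_infsum summable_geometric_multi_indices finite_multi_degree) auto
    finally show ?thesis by (simp add: mult_ac)
  qed
  thus ?thesis using C0 Q0 by (intro exI[of _ "C * Q"]) simp
qed

text \<open>For \<open>norm h < R / 4\<close> the homogeneous parts are dominated by a geometric series of ratio at most
  \<open>1 / 2\<close> that is proportional to \<open>norm h ^ j\<close> in degree \<open>j\<close>; its tail inherits the lowest power.\<close>

lemma homogeneous_part_expansion:
  fixes f :: "'a::euclidean_space \<Rightarrow> 'b::real_normed_vector"
  assumes f: "power_series_at f x R c C"
  shows "\<exists>K\<ge>0. \<forall>h. norm h < R / 4 \<longrightarrow>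
     summable (\<lambda>j. norm (homogeneous_part c j h)) \<and> (\<lambda>j. homogeneous_part c j h) sums f (x + h) \<and>
     (\<forall>r. norm (f (x + h) - (\<Sum>j\<le>r. homogeneous_part c j h)) \<le> K * (4 * norm h / R) ^ Suc r)"
proof -
  have R: "R > 0" using f by (simp add: power_series_at_def)
  obtain K where K: "K \<ge> 0" "\<forall>j h. norm (homogeneous_part c j h) \<le> K * (2 * norm h / R) ^ j"
    using homogeneous_part_bound[OF f] by (elim exE conjE)
  have main: "summable (\<lambda>j. norm (homogeneous_part c j h)) \<and> (\<lambda>j. homogeneous_part c j h) sums f (x + h) \<and>
     (\<forall>r. norm (f (x + h) - (\<Sum>j\<le>r. homogeneous_part c j h)) \<le> (2 * K) * (4 * norm h / R) ^ Suc r)"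
    if h: "norm h < R / 4" for h
  proof (intro conjI allI)
    define t where "t = 2 * norm h / R"
    have t: "0 \<le> t" "t \<le> 1/2" using h R by (auto simp: t_def field_simps)
    have Kt: "norm (homogeneous_part c j h) \<le> K * t ^ j" for j using K(2) by (simp add: t_def)
    show "summable (\<lambda>j. norm (homogeneous_part c j h))"
    proof (rule summable_comparison_test'[where N=0])
      show "summable (\<lambda>j. K * t ^ j)" using t by (intro summable_mult summable_geometric) simp
    qed (use Kt in simp)
    have hs: "((\<lambda>j. homogeneous_part c j h) has_sum f (x + h)) UNIV"
      using h R by (intro homogeneous_part_sums[OF f]) simp
    show "(\<lambda>j. homogeneous_part c j h) sums f (x + h)" by (rule has_sum_imp_sums[OF hs])
    fix r
    have "((\<lambda>j. homogeneous_part c j h) has_sum (f (x + h) - (\<Sum>j\<le>r. homogeneous_part c j h))) (UNIV - {..r})"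
      by (intro has_sum_Diff hs has_sum_finite) auto
    hence d: "((\<lambda>j. if j \<le> r then 0 else homogeneous_part c j h) has_sum (f (x + h) - (\<Sum>j\<le>r. homogeneous_part c j h))) UNIV"
      by (rule has_sum_cong_neutral[THEN iffD1, rotated 3]) auto
    have "((\<lambda>j. (1/2::real) ^ j) has_sum 2) UNIV"
      using geometric_sums[of "1/2::real"] by (intro norm_summable_imp_has_sum) (auto simp: summable_geometric)
    from has_sum_cmult_right[OF this, of "K * (2 * t) ^ Suc r"]
    have g: "((\<lambda>j. K * (2 * t) ^ Suc r * (1/2) ^ j) has_sum (K * (2 * t) ^ Suc r * 2)) UNIV" .
    have "norm (f (x + h) - (\<Sum>j\<le>r. homogeneous_part c j h)) \<le> K * (2 * t) ^ Suc r * 2"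
    proof (rule norm_infsum_le[OF d g])
      fix j :: nat
      show "norm (if j \<le> r then 0 else homogeneous_part c j h) \<le> K * (2 * t) ^ Suc r * (1/2) ^ j"
      proof (cases "j \<le> r")
        case True thus ?thesis using K(1) t by simp
      next
        case False
        then obtain k where k: "j = Suc r + k" using le_Suc_ex[of "Suc r" j] by auto
        have "norm (homogeneous_part c j h) \<le> K * t ^ j" by (rule Kt)
        also have "\<dots> = K * (t ^ Suc r * t ^ k)" by (simp only: k power_add)
        also have "\<dots> \<le> K * (t ^ Suc r * (1/2) ^ k)"
          using K(1) t by (intro mult_left_mono power_mono) auto
        also have "\<dots> = K * (2 * t) ^ Suc r * (1/2) ^ j"
        proof -
          have "(2 * t) ^ Suc r * (1/2) ^ j = ((2 * t) ^ Suc r * (1/2) ^ Suc r) * (1/2) ^ k" by (simp only: k power_add mult.assoc)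
          also have "(2 * t) ^ Suc r * (1/2) ^ Suc r = t ^ Suc r" unfolding power_mult_distrib[symmetric] by simp
          finally show ?thesis by (simp only: mult.assoc)
        qed
        finally show ?thesis using False by simp
      qed
    qed
    also have "\<dots> = (2 * K) * (4 * norm h / R) ^ Suc r" by (simp add: t_def)
    finally show "norm (f (x + h) - (\<Sum>j\<le>r. homogeneous_part c j h)) \<le> (2 * K) * (4 * norm h / R) ^ Suc r" .
  qed
  show ?thesis by (intro exI[of _ "2 * K"] conjI allI impI main) (use K(1) in auto)
qed

text \<open>Along the ray \<open>t *\<^sub>R h\<close> both the Taylor polynomial and the truncated power series approximate \<open>f\<close> up
  to \<open>o(t ^ r)\<close>, and both are polynomials in \<open>t\<close> of degree \<open>r\<close>; hence they have the same
  coefficients.\<close>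

lemma frechet_differential_eq_homogeneous_part:
  fixes f :: "'a::euclidean_space \<Rightarrow> 'b::real_normed_vector"
  assumes fd: "\<exists>B::'b set. finite B \<and> span B = UNIV" and f: "power_series_at f x R c C"
  shows "(1 / fact j) *\<^sub>R frechet_differential f (replicate j h) x = homogeneous_part c j h"
proof -
  define r where "r = j"
  have R: "R > 0" using f by (simp add: power_series_at_def)
  define T where "T j = (1 / fact j) *\<^sub>R frechet_differential f (replicate j h) x" for j
  define \<rho> where "\<rho> = R / 2 ^ Suc r"
  have \<rho>: "\<rho> > 0" using R by (simp add: \<rho>_def)
  have it: "iterated_differentiable_on (Suc r) f (ball x \<rho>)"
    unfolding \<rho>_def by (rule power_series_iterated_differentiable_on[OF fd f])
  have ml: "multilinear i (\<lambda>hs. frechet_differential f hs y)" if "y \<in> ball x \<rho>" "i \<le> Suc r" for y i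
    by (rule frechet_differential_multilinear[OF open_ball it that(2,1)])
  have sc: "frechet_differential f (replicate i (t *\<^sub>R h)) y = t ^ i *\<^sub>R frechet_differential f (replicate i h) y"
    if "y \<in> ball x \<rho>" "i \<le> Suc r" for y i t
    using multilinear_replicate_scale[OF ml[OF that]] .
  obtain K where K: "K \<ge> 0" "\<forall>h. norm h < R / 4 \<longrightarrow>
     summable (\<lambda>j. norm (homogeneous_part c j h)) \<and> (\<lambda>j. homogeneous_part c j h) sums f (x + h) \<and>
     (\<forall>r. norm (f (x + h) - (\<Sum>j\<le>r. homogeneous_part c j h)) \<le> K * (4 * norm h / R) ^ Suc r)"
    using homogeneous_part_expansion[OF f] by (elim exE conjE)
  define n where "n = 1 + norm h"
  have n: "n > 0" "norm h \<le> n" unfolding n_def by (auto intro: add_pos_nonneg)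
  define L where "L = 1 + K * (4 * n / R) ^ Suc r"
  have L: "L > 0" using K(1) n R by (auto simp: L_def intro!: add_pos_nonneg)
  have "homogeneous_part c r h - T r = 0"
  proof (rule vector_polynomial_zero[where r=r])
    fix \<eta> :: real assume \<eta>: "\<eta> > 0"
    have "frechet_differential f (replicate r h) differentiable (at x)"
      using it \<rho> by (auto simp: iterated_differentiable_on_def)
    hence "isCont (frechet_differential f (replicate r h)) x" by (rule differentiable_imp_continuous_within)
    then obtain \<delta> where \<delta>: "\<delta> > 0" "\<And>y. dist y x < \<delta> \<Longrightarrow>
        dist (frechet_differential f (replicate r h) y) (frechet_differential f (replicate r h) x) < \<eta> / 2"
      unfolding continuous_at_eps_delta using half_gt_zero[OF \<eta>] by metis
    define m where "m = min (min \<delta> \<rho>) (R / 4)"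
    have m: "m > 0" "m \<le> \<delta>" "m \<le> \<rho>" "m \<le> R / 4" using \<delta>(1) \<rho> R by (auto simp: m_def)
    show "\<exists>\<delta>>0. \<forall>t. 0 < t \<longrightarrow> t < \<delta> \<longrightarrow> norm (\<Sum>j\<le>r. t ^ j *\<^sub>R (homogeneous_part c j h - T j)) \<le> \<eta> * t ^ r"
    proof (intro exI[of _ "min (m / n) (\<eta> / (2 * L))"] conjI allI impI)
      fix t assume t: "0 < t" "t < min (m / n) (\<eta> / (2 * L))"
      have "t * norm h \<le> t * n" using t n by (intro mult_left_mono) auto
      also have "\<dots> < m" using t n by (simp add: pos_less_divide_eq)
      finally have th: "norm (t *\<^sub>R h) < m" using t by simp
      have P: "norm (f (x + t *\<^sub>R h) - taylor_polynomial r f x (t *\<^sub>R h)) \<le> \<eta> / 2 * t ^ r"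
      proof (rule taylor_frechet_bound)
        show "iterated_differentiable_on r f (ball x \<rho>)"
          by (rule iterated_differentiable_on_subset[OF it]) auto
        fix s :: real assume s: "s \<in> {0..1}"
        have "norm (s *\<^sub>R t *\<^sub>R h) = s * norm (t *\<^sub>R h)" by (subst norm_scaleR) (use s in simp)
        also have "\<dots> \<le> 1 * norm (t *\<^sub>R h)" using s by (intro mult_right_mono) auto
        finally have "norm (s *\<^sub>R t *\<^sub>R h) \<le> norm (t *\<^sub>R h)" by simp
        hence ns: "norm (s *\<^sub>R t *\<^sub>R h) < m" using th by linarith
        hence y: "x + s *\<^sub>R t *\<^sub>R h \<in> ball x \<rho>" "dist (x + s *\<^sub>R t *\<^sub>R h) x < \<delta>"
          using m by (auto simp: dist_norm)
        have "norm (frechet_differential f (replicate r (t *\<^sub>R h)) (x + s *\<^sub>R t *\<^sub>R h) - frechet_differential f (replicate r (t *\<^sub>R h)) x)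
          = t ^ r * dist (frechet_differential f (replicate r h) (x + s *\<^sub>R t *\<^sub>R h)) (frechet_differential f (replicate r h) x)"
          using sc[OF y(1), of r t] sc[of x r t] \<rho> t by (simp add: dist_norm flip: scaleR_diff_right)
        also have "\<dots> \<le> t ^ r * (\<eta> / 2)" using \<delta>(2)[OF y(2)] t by (intro mult_left_mono) auto
        finally show "norm (frechet_differential f (replicate r (t *\<^sub>R h)) (x + s *\<^sub>R t *\<^sub>R h) - frechet_differential f (replicate r (t *\<^sub>R h)) x)
          \<le> \<eta> / 2 * t ^ r" by (simp add: mult.commute)
      qed (use th m in auto)
      have H: "norm (f (x + t *\<^sub>R h) - (\<Sum>j\<le>r. homogeneous_part c j (t *\<^sub>R h))) \<le> L * t * t ^ r"
      proof -
        have "norm (f (x + t *\<^sub>R h) - (\<Sum>j\<le>r. homogeneous_part c j (t *\<^sub>R h))) \<le> K * (4 * norm (t *\<^sub>R h) / R) ^ Suc r"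
          using K(2)[rule_format, of "t *\<^sub>R h"] th m by auto
        also have "\<dots> \<le> K * (4 * (t * n) / R) ^ Suc r"
          using K(1) R t n by (intro mult_left_mono power_mono divide_right_mono) auto
        also have "4 * (t * n) / R = t * (4 * n / R)" by simp
        also have "K * (t * (4 * n / R)) ^ Suc r = (K * (4 * n / R) ^ Suc r) * (t * t ^ r)"
          unfolding power_mult_distrib by simp
        also have "\<dots> \<le> L * (t * t ^ r)" using t by (intro mult_right_mono) (auto simp: L_def)
        finally show ?thesis by (simp add: mult.assoc)
      qed
      have "(\<Sum>j\<le>r. t ^ j *\<^sub>R (homogeneous_part c j h - T j))
        = (\<Sum>j\<le>r. homogeneous_part c j (t *\<^sub>R h)) - taylor_polynomial r f x (t *\<^sub>R h)"
      proof -
        have "(1 / fact j) *\<^sub>R frechet_differential f (replicate j (t *\<^sub>R h)) x = t ^ j *\<^sub>R T j" if "j \<le> r" for j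
          using sc[of x j t] that \<rho> by (simp add: T_def)
        thus ?thesis
          by (simp add: taylor_polynomial_def homogeneous_part_scale scaleR_diff_right sum_subtractf)
      qed
      also have "\<dots> = (f (x + t *\<^sub>R h) - taylor_polynomial r f x (t *\<^sub>R h)) - (f (x + t *\<^sub>R h) - (\<Sum>j\<le>r. homogeneous_part c j (t *\<^sub>R h)))"
        by simp
      also have "norm \<dots> \<le> \<eta> / 2 * t ^ r + L * t * t ^ r"
        by (rule order_trans[OF norm_triangle_ineq4 add_mono[OF P H]])
      also have "\<dots> \<le> \<eta> / 2 * t ^ r + \<eta> / 2 * t ^ r"
      proof (intro add_left_mono mult_right_mono)
        have "t < \<eta> / (2 * L)" using t by simp
        thus "L * t \<le> \<eta> / 2" using L by (simp add: pos_less_divide_eq field_simps)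
      qed (use t in auto)
      finally show "norm (\<Sum>j\<le>r. t ^ j *\<^sub>R (homogeneous_part c j h - T j)) \<le> \<eta> * t ^ r" by simp
    qed (use m n \<eta> L in auto)
  qed simp
  thus ?thesis by (simp add: r_def T_def)
qed

lemma analytic_iterated_differentiable_on:
  fixes f :: "'a::euclidean_space \<Rightarrow> 'b::real_normed_vector"
  assumes fd: "\<exists>B::'b set. finite B \<and> span B = UNIV" and f: "real_analytic_at f x"
  shows "\<exists>\<delta>>0. iterated_differentiable_on r f (ball x \<delta>)"
proof -
  obtain R c C where ps: "power_series_at f x R c C" using real_analytic_imp_power_series[OF f] by (elim exE)
  hence "R / 2 ^ r > 0" by (simp add: power_series_at_def)
  with power_series_iterated_differentiable_on[OF fd ps, of r] show ?thesis by blast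
qed

lemma analytic_taylor_series:
  fixes f :: "'a::euclidean_space \<Rightarrow> 'b::real_normed_vector"
  assumes fd: "\<exists>B::'b set. finite B \<and> span B = UNIV" and f: "real_analytic_at f x"
  shows "\<exists>s>0. \<exists>K\<ge>0. \<forall>h. norm h < s \<longrightarrow>
     summable (\<lambda>j. norm ((1 / fact j) *\<^sub>R frechet_differential f (replicate j h) x)) \<and>
     (\<lambda>j. (1 / fact j) *\<^sub>R frechet_differential f (replicate j h) x) sums f (x + h) \<and>
     (\<forall>r. norm (f (x + h) - taylor_polynomial r f x h) \<le> K * (norm h / s) ^ Suc r)"
proof -
  obtain R c C where ps: "power_series_at f x R c C" using real_analytic_imp_power_series[OF f] by (elim exE)
  have R: "R / 4 > 0" using ps by (simp add: power_series_at_def)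
  obtain K where K: "K \<ge> 0" "\<forall>h. norm h < R / 4 \<longrightarrow>
     summable (\<lambda>j. norm (homogeneous_part c j h)) \<and> (\<lambda>j. homogeneous_part c j h) sums f (x + h) \<and>
     (\<forall>r. norm (f (x + h) - (\<Sum>j\<le>r. homogeneous_part c j h)) \<le> K * (4 * norm h / R) ^ Suc r)"
    using homogeneous_part_expansion[OF ps] by (elim exE conjE)
  have e: "4 * norm h / R = norm h / (R / 4)" for h :: 'a using R by simp
  show ?thesis
    unfolding taylor_polynomial_def frechet_differential_eq_homogeneous_part[OF fd ps]
    by (rule exI[of _ "R / 4"], rule conjI[OF R], rule exI[of _ K]) (use K in \<open>simp only: e simp_thms\<close>)
qed

section \<open>Plug-in estimators\<close>

lemma closed_stochastic_matrices: "closed (stochastic_matrices :: (real^'s^'s::finite) set)"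
proof -
  have e: "stochastic_matrices = (\<Inter>i. \<Inter>j. {Q :: real^'s^'s. 0 \<le> Q $ i $ j}) \<inter> (\<Inter>i. {Q. (\<Sum>j\<in>UNIV. Q $ i $ j) = 1})"
    by (auto simp: stochastic_matrices_def)
  moreover have "closed {Q :: real^'s^'s. 0 \<le> Q $ i $ j}" for i j
    by (intro closed_Collect_le continuous_intros)
  moreover have "closed {Q :: real^'s^'s. (\<Sum>j\<in>UNIV. Q $ i $ j) = 1}" for i
    by (intro closed_Collect_eq continuous_intros)
  ultimately show ?thesis unfolding e by (intro closed_Int closed_INT ballI)
qed

lemma sqrt_power_eq_powr: "sqrt (real n) ^ j = real n powr (real j / 2)" if "n > 0"
  using that by (simp add: powr_half_sqrt[symmetric] powr_powr flip: powr_realpow)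

lemma scaleR_borel_measurable:
  fixes f :: "'a \<Rightarrow> 'y::real_normed_vector"
  assumes "f \<in> borel_measurable M"
  shows "(\<lambda>\<omega>. c *\<^sub>R f \<omega>) \<in> borel_measurable M"
proof -
  have "(\<lambda>v::'y. c *\<^sub>R v) \<in> borel_measurable borel"
    by (intro borel_measurable_continuous_onI continuous_intros)
  from measurable_compose[OF assms this] show ?thesis .
qed

lemma taylor_term_replicate:
  assumes n: "n > 0" and ml: "multilinear j (\<lambda>hs. frechet_differential f hs p)"
  shows "taylor_term f p n (sqrt (real n) *\<^sub>R h) j = (1 / fact j) *\<^sub>R frechet_differential f (replicate j h) p"
proof -
  have "real n powr (real j / 2) \<noteq> 0" using n by simp
  thus ?thesis
    unfolding taylor_term_def multilinear_replicate_scale[OF ml] sqrt_power_eq_powr[OF n] by simp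
qed

context irreducible_markov_chain
begin

lemma mle_prob_tendsto_one:
  assumes V: "open V" "P \<in> V"
  shows "(\<lambda>n. prob {\<omega>\<in>space M. mle X n \<omega> \<in> V \<inter> stochastic_matrices}) \<longlonglongrightarrow> 1"
proof (rule prob_tendsto_one)
  have [measurable]: "V \<inter> stochastic_matrices \<in> sets borel"
    by (intro sets.Int borel_open borel_closed V closed_stochastic_matrices)
  show "{\<omega>\<in>space M. mle X n \<omega> \<in> V \<inter> stochastic_matrices} \<in> events" for n by measurable
  show "AE \<omega> in M. \<forall>\<^sub>F n in sequentially. \<omega> \<in> {\<omega>\<in>space M. mle X n \<omega> \<in> V \<inter> stochastic_matrices}"
    using mle_strongly_consistent AE_all_rows_observed AE_space
  proof eventually_elim
    case (elim \<omega>)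
    have "\<forall>\<^sub>F n in sequentially. mle X n \<omega> \<in> V" by (rule topological_tendstoD[OF elim(1) V])
    with elim(2) show ?case by eventually_elim (use elim(3) in \<open>auto intro: mle_stochastic\<close>)
  qed
qed

lemma plug_in_strongly_consistent:
  assumes T: "plug_in_estimator M X U \<phi> T" and U: "open U" "P \<in> U"
    and rep: "\<forall>Q\<in>U \<inter> stochastic_matrices. \<Phi> Q = \<phi> Q" and cont: "isCont \<Phi> P"
  shows "AE \<omega> in M. (\<lambda>n. T n \<omega>) \<longlonglongrightarrow> \<phi> P"
  using mle_strongly_consistent AE_all_rows_observed AE_space
proof eventually_elim
  case (elim \<omega>)
  have "\<forall>\<^sub>F n in sequentially. mle X n \<omega> \<in> U" by (rule topological_tendstoD[OF elim(1) U])
  with elim(2) have ev: "\<forall>\<^sub>F n in sequentially. \<Phi> (mle X n \<omega>) = T n \<omega>"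
  proof eventually_elim
    case (elim n)
    hence "mle X n \<omega> \<in> U \<inter> stochastic_matrices" by (auto intro: mle_stochastic)
    thus ?case using T rep \<open>\<omega> \<in> space M\<close> by (simp add: plug_in_estimator_def)
  qed
  have "(\<lambda>n. \<Phi> (mle X n \<omega>)) \<longlonglongrightarrow> \<Phi> P" by (rule isCont_tendsto_compose[OF cont elim(1)])
  hence "(\<lambda>n. T n \<omega>) \<longlonglongrightarrow> \<Phi> P" by (rule Lim_transform_eventually[OF _ ev])
  thus ?case using bspec[OF rep, of P] U(2) stochastic by simp
qed

lemma norm_mle_minus_P_power:
  assumes "n > 0"
  shows "norm (mle X n \<omega> - P) ^ r = norm (scaled_error P X n \<omega>) ^ r * real n powr (- (real r / 2))"
  unfolding scaled_error_def norm_scaleR power_mult_distrib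
  using assms by (simp add: sqrt_power_eq_powr powr_minus)

text \<open>Outside an event of small probability the estimator is stochastic and close to \<open>P\<close>, and the scaled
  error is at most \<open>K\<close>. There the deterministic bound applies with \<open>h = W\<^sub>n / sqrt n\<close>, so that
  \<open>norm h ^ r \<le> K ^ r * n powr (- r / 2)\<close>.\<close>

lemma remainder_tail:
  fixes \<Phi> :: "real^'s^'s \<Rightarrow> 'y::real_normed_vector"
  assumes T: "plug_in_estimator M X U \<phi> T" and U: "open U" "P \<in> U"
    and rep: "\<forall>Q\<in>U \<inter> stochastic_matrices. \<Phi> Q = \<phi> Q"
    and meas: "\<And>n. (\<lambda>\<omega>. T n \<omega> - A (mle X n \<omega> - P)) \<in> borel_measurable M"
    and \<delta>: "\<delta> > 0" "\<forall>h. norm h < \<delta> \<longrightarrow> norm (\<Phi> (P + h) - A h) \<le> \<eta> * norm h ^ r" and \<eta>: "\<eta> > 0"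
    and K: "K > 0" "\<forall>\<^sub>F n in sequentially. prob {\<omega>\<in>space M. K < norm (scaled_error P X n \<omega>)} \<le> \<epsilon>" and \<epsilon>: "\<epsilon> > 0"
  shows "\<forall>\<^sub>F n in sequentially.
    prob {\<omega>\<in>space M. norm (T n \<omega> - A (mle X n \<omega> - P)) > \<eta> * K ^ r * real n powr (- (real r / 2))} \<le> 2 * \<epsilon>"
proof -
  define V where "V = U \<inter> ball P \<delta>"
  have V: "open V" "P \<in> V" using U \<delta> by (auto simp: V_def)
  have [measurable]: "V \<inter> stochastic_matrices \<in> sets borel"
    by (intro sets.Int borel_open borel_closed V closed_stochastic_matrices)
  note [measurable] = meas
  let ?G = "\<lambda>n. {\<omega>\<in>space M. mle X n \<omega> \<in> V \<inter> stochastic_matrices}"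
  have G [measurable]: "?G n \<in> events" for n by measurable
  have "\<forall>\<^sub>F n in sequentially. prob (?G n) > 1 - \<epsilon>"
    using order_tendstoD(1)[OF mle_prob_tendsto_one[OF V]] \<epsilon> by simp
  with K(2) eventually_gt_at_top[of 0] show ?thesis
  proof eventually_elim
    case (elim n)
    let ?B = "{\<omega>\<in>space M. norm (T n \<omega> - A (mle X n \<omega> - P)) > \<eta> * K ^ r * real n powr (- (real r / 2))}"
    let ?T = "{\<omega>\<in>space M. K < norm (scaled_error P X n \<omega>)}"
    have "?B \<subseteq> ?T \<union> (space M - ?G n)"
    proof (rule subsetI, rule ccontr)
      fix \<omega> assume w: "\<omega> \<in> ?B" and nw: "\<omega> \<notin> ?T \<union> (space M - ?G n)"
      define h where "h = mle X n \<omega> - P"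
      have m: "mle X n \<omega> \<in> V" "mle X n \<omega> \<in> stochastic_matrices" and sK: "norm (scaled_error P X n \<omega>) \<le> K"
        using w nw by auto
      have "T n \<omega> = \<phi> (mle X n \<omega>)" using T w m by (auto simp: plug_in_estimator_def V_def)
      also have "\<dots> = \<Phi> (P + h)" using bspec[OF rep, of "mle X n \<omega>"] m by (simp add: h_def V_def)
      finally have "norm (T n \<omega> - A h) \<le> \<eta> * norm h ^ r"
        using \<delta>(2)[rule_format, of h] m(1) by (simp add: V_def h_def dist_norm norm_minus_commute)
      also have "\<dots> = \<eta> * (norm (scaled_error P X n \<omega>) ^ r * real n powr (- (real r / 2)))"
        unfolding h_def norm_mle_minus_P_power[OF elim(2)] ..
      also have "\<dots> \<le> \<eta> * (K ^ r * real n powr (- (real r / 2)))"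
        using \<eta> sK by (intro mult_left_mono mult_right_mono power_mono) auto
      finally show False using w by (simp add: h_def mult.assoc)
    qed
    hence "prob ?B \<le> prob (?T \<union> (space M - ?G n))" by (rule finite_measure_mono) measurable
    also have "\<dots> \<le> prob ?T + prob (space M - ?G n)" by (rule measure_Un_le) measurable
    also have "prob (space M - ?G n) = 1 - prob (?G n)" by (rule prob_compl[OF G])
    finally show ?case using elim by simp
  qed
qed

context
  fixes N :: "'b measure" and W U and \<phi> \<Phi> :: "real^'s^'s \<Rightarrow> 'y::real_normed_vector" and T
  assumes W: "gaussian_limit_matrix N P \<pi> W"
    and fd: "\<exists>B::'y set. finite B \<and> span B = UNIV"
    and U: "open U" "P \<in> U"
    and rep: "\<forall>Q\<in>U \<inter> stochastic_matrices. \<Phi> Q = \<phi> Q"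
    and T: "plug_in_estimator M X U \<phi> T" and T_meas: "\<And>n. T n \<in> borel_measurable M"
begin

lemma prob_space_limit: "prob_space N"
  using W by (simp add: gaussian_limit_matrix_def)

lemma remainder_measurable:
  fixes A :: "real^'s^'s \<Rightarrow> 'y"
  assumes A: "continuous_on UNIV A"
  shows "(\<lambda>\<omega>. T n \<omega> - A (mle X n \<omega> - P)) \<in> borel_measurable M"
    and "(\<lambda>\<omega>. T n \<omega> - A (scaled_error P X n \<omega>)) \<in> borel_measurable M"
proof -
  have A: "A \<in> borel_measurable borel" using A by (rule borel_measurable_continuous_onI)
  have "(\<lambda>\<omega>. mle X n \<omega> - P) \<in> borel_measurable M" by measurable
  from measurable_compose[OF this A] measurable_compose[OF scaled_error_measurable A]
  show "(\<lambda>\<omega>. T n \<omega> - A (mle X n \<omega> - P)) \<in> borel_measurable M"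
    "(\<lambda>\<omega>. T n \<omega> - A (scaled_error P X n \<omega>)) \<in> borel_measurable M"
    by (auto intro: finite_dim_borel_measurable_diff[OF fd T_meas])
qed

lemma scaled_error_tight:
  assumes "\<epsilon> > 0"
  obtains K where "K > 0" "\<forall>\<^sub>F n in sequentially. prob {\<omega>\<in>space M. K < norm (scaled_error P X n \<omega>)} \<le> \<epsilon>"
  using converges_in_distribution_tight[OF prob_space_axioms prob_space_limit scaled_error_limit[OF W] assms] .

lemma remainder_little_o_p:
  assumes A: "continuous_on UNIV A"
    and H: "\<And>\<eta>. \<eta> > 0 \<Longrightarrow> \<exists>\<delta>>0. \<forall>h. norm h < \<delta> \<longrightarrow> norm (\<Phi> (P + h) - A h) \<le> \<eta> * norm h ^ r"
  shows "little_o_p M (\<lambda>n \<omega>. T n \<omega> - A (mle X n \<omega> - P)) (\<lambda>n. real n powr (- (real r / 2)))"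
  unfolding little_o_p_def
proof (intro conjI allI impI remainder_measurable(1)[OF A])
  fix \<epsilon> :: real assume e: "\<epsilon> > 0"
  show "(\<lambda>n. prob {\<omega>\<in>space M. norm (T n \<omega> - A (mle X n \<omega> - P)) > \<epsilon> * real n powr (- (real r / 2))}) \<longlonglongrightarrow> 0"
  proof (rule tendstoI)
    fix d :: real assume "d > 0"
    hence d: "d / 4 > 0" by simp
    obtain K where K: "K > 0" "\<forall>\<^sub>F n in sequentially. prob {\<omega>\<in>space M. K < norm (scaled_error P X n \<omega>)} \<le> d / 4"
      using scaled_error_tight[OF d] .
    define \<eta> where "\<eta> = \<epsilon> / K ^ r"
    have \<eta>: "\<eta> > 0" "\<eta> * K ^ r = \<epsilon>" using e K(1) by (auto simp: \<eta>_def)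
    obtain \<delta> where \<delta>: "\<delta> > 0" "\<forall>h. norm h < \<delta> \<longrightarrow> norm (\<Phi> (P + h) - A h) \<le> \<eta> * norm h ^ r"
      using H[OF \<eta>(1)] by (elim exE conjE)
    from remainder_tail[OF T U rep remainder_measurable(1)[OF A] \<delta> \<eta>(1) K d]
    show "\<forall>\<^sub>F n in sequentially. dist (prob {\<omega>\<in>space M. norm (T n \<omega> - A (mle X n \<omega> - P)) > \<epsilon> * real n powr (- (real r / 2))}) 0 < d"
      unfolding \<eta>(2) by eventually_elim (use \<open>d > 0\<close> in simp)
  qed
qed

lemma remainder_big_O_p:
  assumes A: "continuous_on UNIV A"
    and \<delta>: "\<delta> > 0" "\<forall>h. norm h < \<delta> \<longrightarrow> norm (\<Phi> (P + h) - A h) \<le> C * norm h ^ r" and C: "C > 0"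
  shows "big_O_p M (\<lambda>n \<omega>. T n \<omega> - A (mle X n \<omega> - P)) (\<lambda>n. real n powr (- (real r / 2)))"
  unfolding big_O_p_def
proof (intro conjI allI impI remainder_measurable(1)[OF A])
  fix \<epsilon> :: real assume "\<epsilon> > 0"
  hence e: "\<epsilon> / 2 > 0" by simp
  obtain K where K: "K > 0" "\<forall>\<^sub>F n in sequentially. prob {\<omega>\<in>space M. K < norm (scaled_error P X n \<omega>)} \<le> \<epsilon> / 2"
    using scaled_error_tight[OF e] .
  from remainder_tail[OF T U rep remainder_measurable(1)[OF A] \<delta> C K e]
  show "\<exists>C>0. \<forall>\<^sub>F n in sequentially. prob {\<omega>\<in>space M. norm (T n \<omega> - A (mle X n \<omega> - P)) > C * real n powr (- (real r / 2))} \<le> \<epsilon>"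
    using C K(1) by (intro exI[of _ "C * K ^ r"]) simp
qed

text \<open>The common form of the limit theorems: \<open>A\<close> approximates \<open>\<Phi>\<close> to the order \<open>m\<close> at \<open>P\<close>, and the rescaled
  statistic differs from \<open>L (W\<^sub>n)\<close> by the rescaled remainder, which tends to zero in probability.\<close>

lemma delta_method:
  assumes A: "continuous_on UNIV A" and L: "continuous_on UNIV L"
    and H: "\<And>\<eta>. \<eta> > 0 \<Longrightarrow> \<exists>\<delta>>0. \<forall>h. norm h < \<delta> \<longrightarrow> norm (\<Phi> (P + h) - A h) \<le> \<eta> * norm h ^ m"
    and V: "\<And>n. V n \<in> borel_measurable M"
    and eq: "\<And>n \<omega>. n > 0 \<Longrightarrow> V n \<omega> - L (scaled_error P X n \<omega>) = real n powr (real m / 2) *\<^sub>R (T n \<omega> - A (mle X n \<omega> - P))"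
  shows "converges_in_distribution M V N (\<lambda>\<omega>. L (W \<omega>))"
proof (rule slutsky[OF prob_space_axioms prob_space_limit scaled_error_limit[OF W] L V])
  have Lm: "L \<in> borel_measurable borel" using L by (rule borel_measurable_continuous_onI)
  show "(\<lambda>\<omega>. V n \<omega> - L (scaled_error P X n \<omega>)) \<in> borel_measurable M" for n
    by (rule finite_dim_borel_measurable_diff[OF fd V measurable_compose[OF scaled_error_measurable Lm]])
  fix \<epsilon> :: real assume e: "\<epsilon> > 0"
  have "(\<lambda>n. prob {\<omega>\<in>space M. norm (T n \<omega> - A (mle X n \<omega> - P)) > \<epsilon> * real n powr (- (real m / 2))}) \<longlonglongrightarrow> 0"
    using remainder_little_o_p[OF A H] e by (simp add: little_o_p_def)
  moreover have "\<forall>\<^sub>F n in sequentially. prob {\<omega>\<in>space M. norm (T n \<omega> - A (mle X n \<omega> - P)) > \<epsilon> * real n powr (- (real m / 2))}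
      = prob {\<omega>\<in>space M. \<epsilon> < norm (V n \<omega> - L (scaled_error P X n \<omega>))}"
    using eventually_gt_at_top[of 0]
  proof eventually_elim
    case (elim n)
    hence "real n powr (real m / 2) > 0" by simp
    hence "norm (T n \<omega> - A (mle X n \<omega> - P)) > \<epsilon> * real n powr (- (real m / 2)) \<longleftrightarrow> \<epsilon> < norm (V n \<omega> - L (scaled_error P X n \<omega>))" for \<omega>
      unfolding eq[OF elim] norm_scaleR by (simp add: powr_minus field_simps)
    thus ?case by simp
  qed
  ultimately show "(\<lambda>n. prob {\<omega>\<in>space M. \<epsilon> < norm (V n \<omega> - L (scaled_error P X n \<omega>))}) \<longlonglongrightarrow> 0"
    by (rule Lim_transform_eventually)
qed

lemma delta_method_first_order:
  assumes diff: "\<Phi> differentiable (at P)"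
  shows "converges_in_distribution M (\<lambda>n \<omega>. sqrt (real n) *\<^sub>R (T n \<omega> - \<phi> P)) N (\<lambda>\<omega>. frechet_derivative \<Phi> (at P) (W \<omega>))"
proof (rule delta_method[where m=1 and A="\<lambda>h. \<Phi> P + frechet_derivative \<Phi> (at P) h"])
  let ?D = "frechet_derivative \<Phi> (at P)"
  have D: "(\<Phi> has_derivative ?D) (at P)" using diff by (simp add: frechet_derivative_works)
  have bl: "bounded_linear ?D" using D by (rule has_derivative_bounded_linear)
  show L: "continuous_on UNIV ?D" by (rule linear_continuous_on[OF bl])
  show "continuous_on UNIV (\<lambda>h. \<Phi> P + ?D h)" by (intro continuous_on_add continuous_on_const L)
  fix \<eta> :: real assume "\<eta> > 0"
  with D obtain \<delta> where \<delta>: "\<delta> > 0" "\<forall>y. norm (y - P) < \<delta> \<longrightarrow> norm (\<Phi> y - \<Phi> P - ?D (y - P)) \<le> \<eta> * norm (y - P)"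
    unfolding has_derivative_at_alt by blast
  have "norm (\<Phi> (P + h) - (\<Phi> P + ?D h)) \<le> \<eta> * norm h ^ 1" if "norm h < \<delta>" for h
    using \<delta>(2)[rule_format, of "P + h"] that by (simp add: diff_diff_eq)
  with \<delta>(1) show "\<exists>\<delta>>0. \<forall>h. norm h < \<delta> \<longrightarrow> norm (\<Phi> (P + h) - (\<Phi> P + ?D h)) \<le> \<eta> * norm h ^ 1" by blast
next
  have "(\<lambda>\<omega>. T n \<omega> - \<phi> P) \<in> borel_measurable M" for n
    by (rule finite_dim_borel_measurable_diff[OF fd T_meas]) simp
  thus "(\<lambda>\<omega>. sqrt (real n) *\<^sub>R (T n \<omega> - \<phi> P)) \<in> borel_measurable M" for n
    by (rule scaleR_borel_measurable)
  fix n :: nat and \<omega> assume n: "n > 0"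
  let ?D = "frechet_derivative \<Phi> (at P)"
  have "?D (scaled_error P X n \<omega>) = sqrt (real n) *\<^sub>R ?D (mle X n \<omega> - P)"
    unfolding scaled_error_def by (rule linear_cmul[OF linear_frechet_derivative[OF diff]])
  moreover have "\<Phi> P = \<phi> P" using bspec[OF rep, of P] U(2) stochastic by simp
  ultimately show "sqrt (real n) *\<^sub>R (T n \<omega> - \<phi> P) - ?D (scaled_error P X n \<omega>)
      = real n powr (real 1 / 2) *\<^sub>R (T n \<omega> - (\<Phi> P + ?D (mle X n \<omega> - P)))"
    using n by (simp add: powr_half_sqrt algebra_simps)
qed

context
  fixes r :: nat
  assumes ml: "\<And>j. j \<le> r \<Longrightarrow> multilinear j (\<lambda>hs. frechet_differential \<Phi> hs P)"
begin

lemma differential_continuous: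
  "j \<le> r \<Longrightarrow> continuous_on UNIV (\<lambda>w. frechet_differential \<Phi> (replicate j w) P)"
  by (rule multilinear_replicate_continuous[OF ml])

lemma taylor_polynomial_continuous: "m \<le> r \<Longrightarrow> continuous_on UNIV (taylor_polynomial m \<Phi> P)"
  unfolding taylor_polynomial_def[abs_def]
  by (intro continuous_on_sum continuous_on_scaleR continuous_on_const differential_continuous) auto

lemma taylor_sum_continuous:
  assumes "S \<subseteq> {..r}"
  shows "continuous_on UNIV (\<lambda>w. \<phi> P + (\<Sum>j\<in>S. taylor_term \<Phi> P n w j))"
  unfolding taylor_term_def using assms
  by (intro continuous_on_add continuous_on_sum continuous_on_scaleR continuous_on_const differential_continuous) auto

text \<open>The powers of \<open>n\<close> in the expansion cancel the powers of \<open>sqrt n\<close> that the scaled error carries.\<close>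

lemma taylor_sum_eq:
  assumes n: "n > 0" and m: "m \<le> r"
  shows "\<phi> P + (\<Sum>j=1..m. taylor_term \<Phi> P n (scaled_error P X n \<omega>) j) = taylor_polynomial m \<Phi> P (mle X n \<omega> - P)"
proof -
  have "taylor_polynomial m \<Phi> P (mle X n \<omega> - P) = \<Phi> P + (\<Sum>j=1..m. (1 / fact j) *\<^sub>R frechet_differential \<Phi> (replicate j (mle X n \<omega> - P)) P)"
    unfolding taylor_polynomial_def atMost_atLeast0 by (subst sum.atLeast_Suc_atMost) simp_all
  also have "\<Phi> P = \<phi> P" using bspec[OF rep, of P] U(2) stochastic by simp
  also have "(\<Sum>j=1..m. (1 / fact j) *\<^sub>R frechet_differential \<Phi> (replicate j (mle X n \<omega> - P)) P)
     = (\<Sum>j=1..m. taylor_term \<Phi> P n (scaled_error P X n \<omega>) j)"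
  proof (intro sum.cong refl)
    fix j assume "j \<in> {1..m}"
    hence "multilinear j (\<lambda>hs. frechet_differential \<Phi> hs P)" using ml[of j] m by simp
    from taylor_term_replicate[OF n this, symmetric]
    show "(1 / fact j) *\<^sub>R frechet_differential \<Phi> (replicate j (mle X n \<omega> - P)) P = taylor_term \<Phi> P n (scaled_error P X n \<omega>) j"
      unfolding scaled_error_def .
  qed
  finally show ?thesis ..
qed

lemma taylor_remainder_measurable:
  assumes "S \<subseteq> {..r}"
  shows "(\<lambda>\<omega>. T n \<omega> - (\<phi> P + (\<Sum>j\<in>S. taylor_term \<Phi> P n (scaled_error P X n \<omega>) j))) \<in> borel_measurable M"
  by (rule remainder_measurable(2)[OF taylor_sum_continuous[OF assms]])

lemma taylor_little_o_p:
  assumes H: "\<And>\<eta>. \<eta> > 0 \<Longrightarrow> \<exists>\<delta>>0. \<forall>h. norm h < \<delta> \<longrightarrow> norm (\<Phi> (P + h) - taylor_polynomial r \<Phi> P h) \<le> \<eta> * norm h ^ r"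
  shows "little_o_p M (\<lambda>n \<omega>. T n \<omega> - (\<phi> P + (\<Sum>j=1..r. taylor_term \<Phi> P n (scaled_error P X n \<omega>) j)))
          (\<lambda>n. real n powr (- (real r / 2)))"
  unfolding little_o_p_def
proof (intro conjI allI impI)
  show "(\<lambda>\<omega>. T n \<omega> - (\<phi> P + (\<Sum>j=1..r. taylor_term \<Phi> P n (scaled_error P X n \<omega>) j))) \<in> borel_measurable M" for n
    by (rule taylor_remainder_measurable) auto
  fix \<epsilon> :: real assume e: "\<epsilon> > 0"
  have "(\<lambda>n. prob {\<omega>\<in>space M. norm (T n \<omega> - taylor_polynomial r \<Phi> P (mle X n \<omega> - P)) > \<epsilon> * real n powr (- (real r / 2))}) \<longlonglongrightarrow> 0"
    using remainder_little_o_p[OF taylor_polynomial_continuous[OF order_refl] H] e by (simp add: little_o_p_def)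
  thus "(\<lambda>n. prob {\<omega>\<in>space M. norm (T n \<omega> - (\<phi> P + (\<Sum>j=1..r. taylor_term \<Phi> P n (scaled_error P X n \<omega>) j))) > \<epsilon> * real n powr (- (real r / 2))}) \<longlonglongrightarrow> 0"
    by (rule Lim_transform_eventually)
       (rule eventually_mono[OF eventually_gt_at_top[of 0]], simp only: taylor_sum_eq[OF _ order_refl])
qed

lemma taylor_big_O_p:
  assumes \<delta>: "\<delta> > 0" "\<forall>h. norm h < \<delta> \<longrightarrow> norm (\<Phi> (P + h) - taylor_polynomial r \<Phi> P h) \<le> C * norm h ^ Suc r" and C: "C > 0"
  shows "big_O_p M (\<lambda>n \<omega>. T n \<omega> - (\<phi> P + (\<Sum>j=1..r. taylor_term \<Phi> P n (scaled_error P X n \<omega>) j)))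
          (\<lambda>n. real n powr (- (real (r + 1) / 2)))"
  unfolding big_O_p_def
proof (intro conjI allI impI)
  show "(\<lambda>\<omega>. T n \<omega> - (\<phi> P + (\<Sum>j=1..r. taylor_term \<Phi> P n (scaled_error P X n \<omega>) j))) \<in> borel_measurable M" for n
    by (rule taylor_remainder_measurable) auto
  fix \<epsilon> :: real assume e: "\<epsilon> > 0"
  have "\<exists>C>0. \<forall>\<^sub>F n in sequentially. prob {\<omega>\<in>space M. norm (T n \<omega> - taylor_polynomial r \<Phi> P (mle X n \<omega> - P)) > C * real n powr (- (real (r + 1) / 2))} \<le> \<epsilon>"
    using remainder_big_O_p[OF taylor_polynomial_continuous[OF order_refl] \<delta> C] e unfolding big_O_p_def by simp
  then obtain K where K: "K > 0" "\<forall>\<^sub>F n in sequentially. prob {\<omega>\<in>space M. norm (T n \<omega> - taylor_polynomial r \<Phi> P (mle X n \<omega> - P)) > K * real n powr (- (real (r + 1) / 2))} \<le> \<epsilon>"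
    by (elim exE conjE)
  from K(2) eventually_gt_at_top[of 0]
  have "\<forall>\<^sub>F n in sequentially. prob {\<omega>\<in>space M. norm (T n \<omega> - (\<phi> P + (\<Sum>j=1..r. taylor_term \<Phi> P n (scaled_error P X n \<omega>) j))) > K * real n powr (- (real (r + 1) / 2))} \<le> \<epsilon>"
    by eventually_elim (simp only: taylor_sum_eq[OF _ order_refl])
  with K(1) show "\<exists>C>0. \<forall>\<^sub>F n in sequentially. prob {\<omega>\<in>space M. norm (T n \<omega> - (\<phi> P + (\<Sum>j=1..r. taylor_term \<Phi> P n (scaled_error P X n \<omega>) j))) > C * real n powr (- (real (r + 1) / 2))} \<le> \<epsilon>"
    by blast
qed

lemma delta_method_higher_order:
  assumes r: "r \<ge> 1"
    and H: "\<And>\<eta>. \<eta> > 0 \<Longrightarrow> \<exists>\<delta>>0. \<forall>h. norm h < \<delta> \<longrightarrow> norm (\<Phi> (P + h) - taylor_polynomial r \<Phi> P h) \<le> \<eta> * norm h ^ r"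
  shows "converges_in_distribution M
      (\<lambda>n \<omega>. (real n powr (real r / 2)) *\<^sub>R (T n \<omega> - \<phi> P - (\<Sum>j\<in>{1..<r}. taylor_term \<Phi> P n (scaled_error P X n \<omega>) j)))
      N (\<lambda>\<omega>. (1 / fact r) *\<^sub>R frechet_differential \<Phi> (replicate r (W \<omega>)) P)"
proof (rule delta_method[where m=r and A="taylor_polynomial r \<Phi> P", OF taylor_polynomial_continuous[OF order_refl] _ H])
  show "continuous_on UNIV (\<lambda>w. (1 / fact r) *\<^sub>R frechet_differential \<Phi> (replicate r w) P)"
    by (intro continuous_on_scaleR continuous_on_const differential_continuous order_refl)
  show "(\<lambda>\<omega>. (real n powr (real r / 2)) *\<^sub>R (T n \<omega> - \<phi> P - (\<Sum>j\<in>{1..<r}. taylor_term \<Phi> P n (scaled_error P X n \<omega>) j))) \<in> borel_measurable M" for n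
  proof (rule scaleR_borel_measurable)
    have "{1..<r} \<subseteq> {..r}" by auto
    from taylor_remainder_measurable[OF this, of n]
    show "(\<lambda>\<omega>. T n \<omega> - \<phi> P - (\<Sum>j\<in>{1..<r}. taylor_term \<Phi> P n (scaled_error P X n \<omega>) j)) \<in> borel_measurable M"
      unfolding diff_diff_eq .
  qed
  fix n :: nat and \<omega> assume n: "n > 0"
  let ?t = "\<lambda>j. taylor_term \<Phi> P n (scaled_error P X n \<omega>) j"
  have "{1..r} = insert r {1..<r}" using r by auto
  hence "(\<Sum>j=1..r. ?t j) = ?t r + (\<Sum>j\<in>{1..<r}. ?t j)" by simp
  with taylor_sum_eq[OF n order_refl, of \<omega>]
  have tp: "taylor_polynomial r \<Phi> P (mle X n \<omega> - P) = \<phi> P + (?t r + (\<Sum>j\<in>{1..<r}. ?t j))" by simp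
  have tr: "real n powr (real r / 2) *\<^sub>R ?t r = (1 / fact r) *\<^sub>R frechet_differential \<Phi> (replicate r (scaled_error P X n \<omega>)) P"
    using n by (simp add: taylor_term_def)
  show "(real n powr (real r / 2)) *\<^sub>R (T n \<omega> - \<phi> P - (\<Sum>j\<in>{1..<r}. ?t j))
      - (1 / fact r) *\<^sub>R frechet_differential \<Phi> (replicate r (scaled_error P X n \<omega>)) P
      = real n powr (real r / 2) *\<^sub>R (T n \<omega> - taylor_polynomial r \<Phi> P (mle X n \<omega> - P))"
    unfolding tp tr[symmetric] by (simp add: algebra_simps)
qed

end

end

end

section \<open>Independence of the representation\<close>

context irreducible_markov_chain
begin

lemma AE_no_impossible_transition:
  assumes "P $ i $ j = 0"
  shows "AE \<omega> in M. \<forall>m. \<not> (X m \<omega> = i \<and> X (Suc m) \<omega> = j)"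
  unfolding AE_all_countable
proof
  fix m
  let ?u = "\<lambda>x y. of_bool (x = i) * of_bool (y = j) :: real"
  have z: "(\<Sum>k\<in>UNIV. P $ X m \<omega> $ k *\<^sub>R ?u (X m \<omega>) k) = 0" for \<omega>
    by (rule sum.neutral) (use assms in auto)
  have "expectation (\<lambda>\<omega>. ?u (X m \<omega>) (X (Suc m) \<omega>)) = 0"
    using expectation_step[of m "\<lambda>_. 1" ?u] by (simp only: z mult_1) simp
  moreover have "integrable M (\<lambda>\<omega>. ?u (X m \<omega>) (X (Suc m) \<omega>))"
    by (rule integrable_bounded[where B=1]) auto
  ultimately have "AE \<omega> in M. ?u (X m \<omega>) (X (Suc m) \<omega>) = 0"
    using integral_nonneg_eq_0_iff_AE[of M "\<lambda>\<omega>. ?u (X m \<omega>) (X (Suc m) \<omega>)"] by simp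
  thus "AE \<omega> in M. \<not> (X m \<omega> = i \<and> X (Suc m) \<omega> = j)" by eventually_elim auto
qed

text \<open>Impossible transitions are almost surely never observed, and the rows of two stochastic matrices have
  the same sums.\<close>

lemma AE_scaled_error_tangent:
  "AE \<omega> in M. \<forall>n. mle X n \<omega> \<in> stochastic_matrices \<longrightarrow> scaled_error P X n \<omega> \<in> tangent_space P"
proof -
  have "AE \<omega> in M. \<forall>i j. P $ i $ j = 0 \<longrightarrow> (\<forall>m. \<not> (X m \<omega> = i \<and> X (Suc m) \<omega> = j))"
    unfolding AE_all_countable
  proof (intro allI)
    fix i j show "AE \<omega> in M. P $ i $ j = 0 \<longrightarrow> (\<forall>m. \<not> (X m \<omega> = i \<and> X (Suc m) \<omega> = j))"
      using AE_no_impossible_transition[of i j] by (cases "P $ i $ j = 0") auto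
  qed
  thus ?thesis
  proof eventually_elim
    case (elim \<omega>)
    show ?case
    proof (intro allI impI)
      fix n assume S: "mle X n \<omega> \<in> stochastic_matrices"
      have "mle X n \<omega> $ i $ j = 0" if p: "P $ i $ j = 0" for i j
      proof -
        have "{m. m < n \<and> X m \<omega> = i \<and> X (Suc m) \<omega> = j} = {}" using elim p by blast
        thus ?thesis by (simp add: mle_def transition_count_def)
      qed
      moreover have "(\<Sum>j\<in>UNIV. mle X n \<omega> $ i $ j - P $ i $ j) = 0" for i
        using S P_row[of i] by (simp add: stochastic_matrices_def sum_subtractf)
      ultimately have "mle X n \<omega> - P \<in> tangent_space P"
        by (simp add: tangent_space_def vec_eq_iff matrix_vector_mult_def)
      thus "scaled_error P X n \<omega> \<in> tangent_space P"
        unfolding scaled_error_def by (rule tangent_space_scale)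
    qed
  qed
qed

end

lemma real_analytic_near_imp_at: "real_analytic_near f p U \<Longrightarrow> p \<in> U \<Longrightarrow> real_analytic_at f p"
  by (auto simp: real_analytic_near_def)

lemma real_analytic_differentiable:
  fixes f :: "'a::euclidean_space \<Rightarrow> 'b::real_normed_vector"
  assumes fd: "\<exists>B::'b set. finite B \<and> span B = UNIV" and f: "real_analytic_at f p"
  shows "f differentiable (at p)"
proof -
  obtain \<delta> where \<delta>: "\<delta> > 0" "iterated_differentiable_on 1 f (ball p \<delta>)"
    using analytic_iterated_differentiable_on[OF fd f, of 1] by (elim exE conjE)
  hence "frechet_differential f [] differentiable (at p)" by (auto simp: iterated_differentiable_on_def)
  moreover have "frechet_differential f [] = f" by (rule ext) simp
  ultimately show ?thesis by simp
qed

lemma continuously_differentiable_imp_differentiable: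
  assumes "continuously_frechet_differentiable_on r f U" "r \<ge> 1" "p \<in> U"
  shows "f differentiable (at p)"
proof -
  have "frechet_differential f [] differentiable (at p)"
    using continuously_imp_iterated_differentiable_on[OF assms(1)] assms(2,3)
    by (auto simp: iterated_differentiable_on_def)
  moreover have "frechet_differential f [] = f" by (rule ext) simp
  ultimately show ?thesis by simp
qed

lemma tangential_differentials_agree:
  fixes P :: "real^'s^'s::finite" and f g \<phi> :: "real^'s^'s \<Rightarrow> 'y::real_normed_vector"
  assumes fd: "\<exists>B::'y set. finite B \<and> span B = UNIV"
    and P: "P \<in> stochastic_matrices" and U: "open U" "P \<in> U"
    and rep: "\<forall>Q\<in>U \<inter> stochastic_matrices. f Q = \<phi> Q" "\<forall>Q\<in>U \<inter> stochastic_matrices. g Q = \<phi> Q"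
    and smooth: "(j = 1 \<and> f differentiable (at P) \<and> g differentiable (at P)) \<or>
           (\<exists>r\<ge>j. continuously_frechet_differentiable_on r f U \<and> continuously_frechet_differentiable_on r g U) \<or>
           (real_analytic_near f P U \<and> real_analytic_near g P U)"
    and h: "h \<in> tangent_space P"
  shows "frechet_differential f (replicate j h) P = frechet_differential g (replicate j h) P"
proof -
  have eq: "f Q = g Q" if "Q \<in> U \<inter> stochastic_matrices" for Q using rep that by simp
  have s: "set (replicate j h) \<subseteq> tangent_space P" using h by auto
  consider (one) "j = 1" "f differentiable (at P)" "g differentiable (at P)"
    | (cr) r where "r \<ge> j" "continuously_frechet_differentiable_on r f U" "continuously_frechet_differentiable_on r g U"
    | (an) "real_analytic_near f P U" "real_analytic_near g P U"
    using smooth by blast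
  thus ?thesis
  proof cases
    case one
    from differentiable_eq_tangential[OF P U one(2,3) eq h] show ?thesis by (simp add: one(1))
  next
    case cr
    show ?thesis
      by (rule frechet_differential_eq_tangential[OF P U
            continuously_imp_iterated_differentiable_on[OF cr(2)] continuously_imp_iterated_differentiable_on[OF cr(3)] eq _ s])
         (use cr(1) in simp_all)
  next
    case an
    obtain \<delta>1 where \<delta>1: "\<delta>1 > 0" "iterated_differentiable_on j f (ball P \<delta>1)"
      using analytic_iterated_differentiable_on[OF fd real_analytic_near_imp_at[OF an(1) U(2)], of j] by (elim exE conjE)
    obtain \<delta>2 where \<delta>2: "\<delta>2 > 0" "iterated_differentiable_on j g (ball P \<delta>2)"
      using analytic_iterated_differentiable_on[OF fd real_analytic_near_imp_at[OF an(2) U(2)], of j] by (elim exE conjE)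
    let ?G = "U \<inter> ball P \<delta>1 \<inter> ball P \<delta>2"
    have G: "open ?G" "P \<in> ?G" using U \<delta>1 \<delta>2 by auto
    show ?thesis
    proof (rule frechet_differential_eq_tangential[OF P G _ _ eq _ s])
      show "iterated_differentiable_on j f ?G" by (rule iterated_differentiable_on_subset[OF \<delta>1(2)]) auto
      show "iterated_differentiable_on j g ?G" by (rule iterated_differentiable_on_subset[OF \<delta>2(2)]) auto
    qed auto
  qed
qed

section \<open>Limit theorems for plug-in estimators\<close>

text \<open>The neighbourhood is a ball on which the Taylor series of \<open>\<Phi>\<close> converges absolutely; the constant term
  of the series is \<open>\<phi> P\<close>.\<close>

lemma (in irreducible_markov_chain) analytic_series_at_estimator:
  fixes \<phi> \<Phi> :: "real^'s^'s \<Rightarrow> 'y::real_normed_vector"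
  assumes fd: "\<exists>B::'y set. finite B \<and> span B = UNIV" and U: "open U" "P \<in> U"
    and rep: "\<forall>Q\<in>U \<inter> stochastic_matrices. \<Phi> Q = \<phi> Q"
    and an: "real_analytic_at \<Phi> P"
  shows "\<exists>V. open V \<and> P \<in> V \<and> V \<subseteq> U \<and>
        (\<forall>n. \<forall>\<omega>\<in>space M. mle X n \<omega> \<in> V \<inter> stochastic_matrices \<longrightarrow>
           summable (\<lambda>j. norm (taylor_term \<Phi> P n (scaled_error P X n \<omega>) (Suc j))) \<and>
           (\<lambda>j. taylor_term \<Phi> P n (scaled_error P X n \<omega>) (Suc j)) sums (\<phi> (mle X n \<omega>) - \<phi> P))"
proof -
  obtain s K where s: "s > 0" and K: "\<forall>h. norm h < s \<longrightarrow>
     summable (\<lambda>j. norm ((1 / fact j) *\<^sub>R frechet_differential \<Phi> (replicate j h) P)) \<and>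
     (\<lambda>j. (1 / fact j) *\<^sub>R frechet_differential \<Phi> (replicate j h) P) sums \<Phi> (P + h) \<and>
     (\<forall>r. norm (\<Phi> (P + h) - taylor_polynomial r \<Phi> P h) \<le> K * (norm h / s) ^ Suc r)"
    using analytic_taylor_series[OF fd an] by (elim exE conjE)
  have ml: "multilinear j (\<lambda>hs. frechet_differential \<Phi> hs P)" for j
  proof -
    obtain \<delta> where "\<delta> > 0" "iterated_differentiable_on j \<Phi> (ball P \<delta>)"
      using analytic_iterated_differentiable_on[OF fd an, of j] by (elim exE conjE)
    thus ?thesis by (intro frechet_differential_multilinear[where G="ball P \<delta>" and r=j]) auto
  qed
  have P: "\<Phi> P = \<phi> P" using bspec[OF rep, of P] U(2) stochastic by simp
  show ?thesis
  proof (intro exI[of _ "U \<inter> ball P s"] conjI allI ballI impI)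
    fix n \<omega> assume m: "mle X n \<omega> \<in> (U \<inter> ball P s) \<inter> stochastic_matrices"
    define h where "h = mle X n \<omega> - P"
    \<comment> \<open>At time zero the estimator is the null matrix, which is not stochastic.\<close>
    have n: "n > 0"
    proof (rule ccontr)
      assume "\<not> n > 0"
      hence "mle X n \<omega> = 0" by (simp add: mle_def departure_count_def vec_eq_iff)
      thus False using m by (simp add: stochastic_matrices_def)
    qed
    have h: "norm h < s" using m by (simp add: h_def dist_norm norm_minus_commute)
    have e: "taylor_term \<Phi> P n (scaled_error P X n \<omega>) j = (1 / fact j) *\<^sub>R frechet_differential \<Phi> (replicate j h) P" for j
      unfolding scaled_error_def h_def by (rule taylor_term_replicate[OF n ml])
    from K h have K1: "summable (\<lambda>j. norm ((1 / fact j) *\<^sub>R frechet_differential \<Phi> (replicate j h) P))"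
      and K2: "(\<lambda>j. (1 / fact j) *\<^sub>R frechet_differential \<Phi> (replicate j h) P) sums \<Phi> (P + h)" by blast+
    show "summable (\<lambda>j. norm (taylor_term \<Phi> P n (scaled_error P X n \<omega>) (Suc j)))"
      unfolding e using summable_Suc_iff[THEN iffD2, OF K1] .
    have "\<Phi> (P + h) = \<phi> (mle X n \<omega>)" using bspec[OF rep, of "mle X n \<omega>"] m by (simp add: h_def)
    hence "(\<lambda>j. (1 / fact j) *\<^sub>R frechet_differential \<Phi> (replicate j h) P) sums
       (\<phi> (mle X n \<omega>) - \<phi> P + (1 / fact 0) *\<^sub>R frechet_differential \<Phi> (replicate 0 h) P)"
      using K2 P by simp
    thus "(\<lambda>j. taylor_term \<Phi> P n (scaled_error P X n \<omega>) (Suc j)) sums (\<phi> (mle X n \<omega>) - \<phi> P)"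
      unfolding e by (rule sums_Suc_iff[THEN iffD2])
  qed (use U s in auto)
qed

theorem theorem2:
  fixes P :: "real^'s^'s::finite"
    and \<pi> :: "real^'s"
    and M :: "'a measure"
    and X :: "nat \<Rightarrow> 'a \<Rightarrow> 's"
    and N :: "'b measure"
    and W :: "'b \<Rightarrow> real^'s^'s"
    and U :: "(real^'s^'s) set"
    and \<phi> \<Phi> :: "real^'s^'s \<Rightarrow> 'y::real_normed_vector"
  assumes P_stochastic: "P \<in> stochastic_matrices"
    and P_irreducible: "irreducible_matrix P"
    and stationary: "stationary_vector P \<pi>"
    and chain: "markov_chain M X P"
    and gaussian: "gaussian_limit_matrix N P \<pi> W"
    and finite_dim: "\<exists>B::'y set. finite B \<and> span B = UNIV"
    and U: "open U" "P \<in> U"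
    and representation: "\<And>Q. Q \<in> U \<inter> stochastic_matrices \<Longrightarrow> \<Phi> Q = \<phi> Q"
  shows
    "(isCont \<Phi> P \<or> \<Phi> differentiable (at P) \<or>
      (\<exists>r\<ge>1. continuously_frechet_differentiable_on r \<Phi> U) \<or> real_analytic_near \<Phi> P U \<longrightarrow>
      (\<forall>T. plug_in_estimator M X U \<phi> T \<longrightarrow> (AE \<omega> in M. (\<lambda>n. T n \<omega>) \<longlonglongrightarrow> \<phi> P))) \<and>
     (\<Phi> differentiable (at P) \<longrightarrow>
      (\<forall>T. plug_in_estimator M X U \<phi> T \<and> (\<forall>n. T n \<in> borel_measurable M) \<longrightarrow>
        converges_in_distribution M (\<lambda>n \<omega>. sqrt (real n) *\<^sub>R (T n \<omega> - \<phi> P))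
          N (\<lambda>\<omega>. frechet_derivative \<Phi> (at P) (W \<omega>)))) \<and>
     (\<forall>r\<ge>2. continuously_frechet_differentiable_on r \<Phi> U \<longrightarrow>
      (\<forall>T. plug_in_estimator M X U \<phi> T \<and> (\<forall>n. T n \<in> borel_measurable M) \<longrightarrow>
        little_o_p M
          (\<lambda>n \<omega>. T n \<omega> - (\<phi> P + (\<Sum>j=1..r. taylor_term \<Phi> P n (scaled_error P X n \<omega>) j)))
          (\<lambda>n. real n powr (- (real r / 2))) \<and>
        (\<forall>m\<in>{1..r}.
          converges_in_distribution M
            (\<lambda>n \<omega>. (real n powr (real m / 2)) *\<^sub>R
               (T n \<omega> - \<phi> P - (\<Sum>j\<in>{1..<m}. taylor_term \<Phi> P n (scaled_error P X n \<omega>) j)))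
            N (\<lambda>\<omega>. (1 / fact m) *\<^sub>R frechet_differential \<Phi> (replicate m (W \<omega>)) P)))) \<and>
     (real_analytic_near \<Phi> P U \<longrightarrow>
      (\<exists>V. open V \<and> P \<in> V \<and> V \<subseteq> U \<and>
        (\<forall>n. \<forall>\<omega>\<in>space M. mle X n \<omega> \<in> V \<inter> stochastic_matrices \<longrightarrow>
           summable (\<lambda>j. norm (taylor_term \<Phi> P n (scaled_error P X n \<omega>) (Suc j))) \<and>
           (\<lambda>j. taylor_term \<Phi> P n (scaled_error P X n \<omega>) (Suc j)) sums
             (\<phi> (mle X n \<omega>) - \<phi> P)) \<and>
        (\<lambda>n. \<P>(\<omega> in M. mle X n \<omega> \<in> V \<inter> stochastic_matrices)) \<longlonglongrightarrow> 1) \<and>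
      (\<forall>r\<ge>1. \<forall>T. plug_in_estimator M X U \<phi> T \<and> (\<forall>n. T n \<in> borel_measurable M) \<longrightarrow>
        big_O_p M
          (\<lambda>n \<omega>. T n \<omega> - (\<phi> P + (\<Sum>j=1..r. taylor_term \<Phi> P n (scaled_error P X n \<omega>) j)))
          (\<lambda>n. real n powr (- (real (r + 1) / 2))))) \<and>
     (\<forall>\<Phi>\<^sub>1 \<Phi>\<^sub>2.
        (\<forall>Q\<in>U \<inter> stochastic_matrices. \<Phi>\<^sub>1 Q = \<phi> Q) \<and>
        (\<forall>Q\<in>U \<inter> stochastic_matrices. \<Phi>\<^sub>2 Q = \<phi> Q) \<longrightarrow>
        (\<forall>r\<ge>1. continuously_frechet_differentiable_on r \<Phi>\<^sub>1 U \<and>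
                continuously_frechet_differentiable_on r \<Phi>\<^sub>2 U \<longrightarrow>
           (\<forall>j\<in>{1..r}. \<forall>Hs. length Hs = j \<and> set Hs \<subseteq> tangent_space P \<longrightarrow>
              frechet_differential \<Phi>\<^sub>1 Hs P = frechet_differential \<Phi>\<^sub>2 Hs P)) \<and>
        (\<forall>j\<ge>1.
           (j = 1 \<and> \<Phi>\<^sub>1 differentiable (at P) \<and> \<Phi>\<^sub>2 differentiable (at P)) \<or>
           (\<exists>r\<ge>j. continuously_frechet_differentiable_on r \<Phi>\<^sub>1 U \<and>
                   continuously_frechet_differentiable_on r \<Phi>\<^sub>2 U) \<or>
           (real_analytic_near \<Phi>\<^sub>1 P U \<and> real_analytic_near \<Phi>\<^sub>2 P U) \<longrightarrow>
           (AE \<omega> in M. \<forall>n. mle X n \<omega> \<in> stochastic_matrices \<longrightarrow>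
              frechet_differential \<Phi>\<^sub>1 (replicate j (scaled_error P X n \<omega>)) P =
              frechet_differential \<Phi>\<^sub>2 (replicate j (scaled_error P X n \<omega>)) P) \<and>
           (AE \<omega> in N.
              frechet_differential \<Phi>\<^sub>1 (replicate j (W \<omega>)) P =
              frechet_differential \<Phi>\<^sub>2 (replicate j (W \<omega>)) P)))"
proof -
  interpret prob_space M using chain by (simp add: markov_chain_def)
  interpret irreducible_markov_chain M X P \<pi>
    by unfold_locales (rule chain P_stochastic P_irreducible stationary)+
  have rep: "\<forall>Q\<in>U \<inter> stochastic_matrices. \<Phi> Q = \<phi> Q" using representation by blast
  have cont: "isCont \<Phi> P"
    if "isCont \<Phi> P \<or> \<Phi> differentiable (at P) \<or>
      (\<exists>r\<ge>1. continuously_frechet_differentiable_on r \<Phi> U) \<or> real_analytic_near \<Phi> P U"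
    using that continuously_differentiable_imp_differentiable[of _ \<Phi> U P] U(2)
      real_analytic_differentiable[OF finite_dim real_analytic_near_imp_at[of \<Phi> P U]]
      differentiable_imp_continuous_within[of \<Phi> P UNIV] by blast
  have consistency: "isCont \<Phi> P \<or> \<Phi> differentiable (at P) \<or>
      (\<exists>r\<ge>1. continuously_frechet_differentiable_on r \<Phi> U) \<or> real_analytic_near \<Phi> P U \<longrightarrow>
      (\<forall>T. plug_in_estimator M X U \<phi> T \<longrightarrow> (AE \<omega> in M. (\<lambda>n. T n \<omega>) \<longlonglongrightarrow> \<phi> P))"
    using plug_in_strongly_consistent[OF _ U rep cont] by blast
  have first_order: "\<Phi> differentiable (at P) \<longrightarrow>
      (\<forall>T. plug_in_estimator M X U \<phi> T \<and> (\<forall>n. T n \<in> borel_measurable M) \<longrightarrow>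
        converges_in_distribution M (\<lambda>n \<omega>. sqrt (real n) *\<^sub>R (T n \<omega> - \<phi> P))
          N (\<lambda>\<omega>. frechet_derivative \<Phi> (at P) (W \<omega>)))"
    using delta_method_first_order[OF gaussian finite_dim U rep] by blast
  have smooth: "multilinear j (\<lambda>hs. frechet_differential \<Phi> hs P)"
    if "continuously_frechet_differentiable_on r \<Phi> U" "j \<le> r" for r j
    by (rule frechet_differential_multilinear[OF U(1) continuously_imp_iterated_differentiable_on[OF that(1)] that(2) U(2)])
  have remainder: "\<exists>\<delta>>0. \<forall>h. norm h < \<delta> \<longrightarrow> norm (\<Phi> (P + h) - taylor_polynomial m \<Phi> P h) \<le> \<eta> * norm h ^ m"
    if "continuously_frechet_differentiable_on r \<Phi> U" "m \<le> r" "\<eta> > 0" for r m \<eta>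
    using taylor_little_o[OF U continuously_frechet_differentiable_on_mono[OF U(1) that(1,2)] that(3)] by metis
  have expansion: "\<forall>r\<ge>2. continuously_frechet_differentiable_on r \<Phi> U \<longrightarrow>
      (\<forall>T. plug_in_estimator M X U \<phi> T \<and> (\<forall>n. T n \<in> borel_measurable M) \<longrightarrow>
        little_o_p M
          (\<lambda>n \<omega>. T n \<omega> - (\<phi> P + (\<Sum>j=1..r. taylor_term \<Phi> P n (scaled_error P X n \<omega>) j)))
          (\<lambda>n. real n powr (- (real r / 2))) \<and>
        (\<forall>m\<in>{1..r}.
          converges_in_distribution M
            (\<lambda>n \<omega>. (real n powr (real m / 2)) *\<^sub>R
               (T n \<omega> - \<phi> P - (\<Sum>j\<in>{1..<m}. taylor_term \<Phi> P n (scaled_error P X n \<omega>) j)))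
            N (\<lambda>\<omega>. (1 / fact m) *\<^sub>R frechet_differential \<Phi> (replicate m (W \<omega>)) P)))"
  proof (intro allI impI conjI ballI)
    fix r :: nat and T assume f: "continuously_frechet_differentiable_on r \<Phi> U"
      and T: "plug_in_estimator M X U \<phi> T \<and> (\<forall>n. T n \<in> borel_measurable M)"
    note T = conjunct1[OF T] spec[OF conjunct2[OF T]]
    show "little_o_p M
          (\<lambda>n \<omega>. T n \<omega> - (\<phi> P + (\<Sum>j=1..r. taylor_term \<Phi> P n (scaled_error P X n \<omega>) j)))
          (\<lambda>n. real n powr (- (real r / 2)))"
      by (rule taylor_little_o_p[OF gaussian finite_dim U rep T smooth[OF f] remainder[OF f order_refl]])
    fix m assume "m \<in> {1..r}"
    hence m: "1 \<le> m" "m \<le> r" by auto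
    show "converges_in_distribution M
            (\<lambda>n \<omega>. (real n powr (real m / 2)) *\<^sub>R
               (T n \<omega> - \<phi> P - (\<Sum>j\<in>{1..<m}. taylor_term \<Phi> P n (scaled_error P X n \<omega>) j)))
            N (\<lambda>\<omega>. (1 / fact m) *\<^sub>R frechet_differential \<Phi> (replicate m (W \<omega>)) P)"
      by (rule delta_method_higher_order[OF gaussian finite_dim U rep T
            smooth[OF f order_trans[OF _ m(2)]] m(1) remainder[OF f m(2)]])
  qed
  have series: "real_analytic_near \<Phi> P U \<longrightarrow>
      (\<exists>V. open V \<and> P \<in> V \<and> V \<subseteq> U \<and>
        (\<forall>n. \<forall>\<omega>\<in>space M. mle X n \<omega> \<in> V \<inter> stochastic_matrices \<longrightarrow>
           summable (\<lambda>j. norm (taylor_term \<Phi> P n (scaled_error P X n \<omega>) (Suc j))) \<and>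
           (\<lambda>j. taylor_term \<Phi> P n (scaled_error P X n \<omega>) (Suc j)) sums
             (\<phi> (mle X n \<omega>) - \<phi> P)) \<and>
        (\<lambda>n. \<P>(\<omega> in M. mle X n \<omega> \<in> V \<inter> stochastic_matrices)) \<longlonglongrightarrow> 1)"
  proof
    assume "real_analytic_near \<Phi> P U"
    hence an: "real_analytic_at \<Phi> P" by (rule real_analytic_near_imp_at[OF _ U(2)])
    from analytic_series_at_estimator[OF finite_dim U rep an]
    obtain V where V: "open V" "P \<in> V" "V \<subseteq> U" "\<forall>n. \<forall>\<omega>\<in>space M. mle X n \<omega> \<in> V \<inter> stochastic_matrices \<longrightarrow>
           summable (\<lambda>j. norm (taylor_term \<Phi> P n (scaled_error P X n \<omega>) (Suc j))) \<and>
           (\<lambda>j. taylor_term \<Phi> P n (scaled_error P X n \<omega>) (Suc j)) sums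
             (\<phi> (mle X n \<omega>) - \<phi> P)" by (elim exE conjE)
    show "\<exists>V. open V \<and> P \<in> V \<and> V \<subseteq> U \<and>
        (\<forall>n. \<forall>\<omega>\<in>space M. mle X n \<omega> \<in> V \<inter> stochastic_matrices \<longrightarrow>
           summable (\<lambda>j. norm (taylor_term \<Phi> P n (scaled_error P X n \<omega>) (Suc j))) \<and>
           (\<lambda>j. taylor_term \<Phi> P n (scaled_error P X n \<omega>) (Suc j)) sums
             (\<phi> (mle X n \<omega>) - \<phi> P)) \<and>
        (\<lambda>n. \<P>(\<omega> in M. mle X n \<omega> \<in> V \<inter> stochastic_matrices)) \<longlonglongrightarrow> 1"
      by (intro exI[of _ V] conjI V mle_prob_tendsto_one)
  qed
  have series_remainder: "real_analytic_near \<Phi> P U \<longrightarrow>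
      (\<forall>r\<ge>1. \<forall>T. plug_in_estimator M X U \<phi> T \<and> (\<forall>n. T n \<in> borel_measurable M) \<longrightarrow>
        big_O_p M
          (\<lambda>n \<omega>. T n \<omega> - (\<phi> P + (\<Sum>j=1..r. taylor_term \<Phi> P n (scaled_error P X n \<omega>) j)))
          (\<lambda>n. real n powr (- (real (r + 1) / 2))))"
  proof (intro allI impI)
    fix r :: nat and T assume "real_analytic_near \<Phi> P U"
      and T: "plug_in_estimator M X U \<phi> T \<and> (\<forall>n. T n \<in> borel_measurable M)"
    note T = conjunct1[OF T] spec[OF conjunct2[OF T]]
    have an: "real_analytic_at \<Phi> P"
      by (rule real_analytic_near_imp_at[OF \<open>real_analytic_near \<Phi> P U\<close> U(2)])
    obtain s K where s: "s > 0" "K \<ge> 0" and K: "\<forall>h. norm h < s \<longrightarrow>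
       summable (\<lambda>j. norm ((1 / fact j) *\<^sub>R frechet_differential \<Phi> (replicate j h) P)) \<and>
       (\<lambda>j. (1 / fact j) *\<^sub>R frechet_differential \<Phi> (replicate j h) P) sums \<Phi> (P + h) \<and>
       (\<forall>r. norm (\<Phi> (P + h) - taylor_polynomial r \<Phi> P h) \<le> K * (norm h / s) ^ Suc r)"
      using analytic_taylor_series[OF finite_dim an] by (elim exE conjE)
    obtain \<delta> where \<delta>: "\<delta> > 0" "iterated_differentiable_on r \<Phi> (ball P \<delta>)"
      using analytic_iterated_differentiable_on[OF finite_dim an, of r] by (elim exE conjE)
    have ml: "multilinear j (\<lambda>hs. frechet_differential \<Phi> hs P)" if "j \<le> r" for j
      by (rule frechet_differential_multilinear[OF open_ball \<delta>(2) that]) (use \<delta>(1) in simp)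
    define C where "C = K / s ^ Suc r + 1"
    have C: "C > 0" using s by (auto simp: C_def intro!: add_nonneg_pos)
    have "norm (\<Phi> (P + h) - taylor_polynomial r \<Phi> P h) \<le> C * norm h ^ Suc r" if "norm h < s" for h
    proof -
      have "norm (\<Phi> (P + h) - taylor_polynomial r \<Phi> P h) \<le> K * (norm h / s) ^ Suc r" using K that by blast
      also have "\<dots> = K / s ^ Suc r * norm h ^ Suc r" by (simp only: power_divide times_divide_eq_right times_divide_eq_left)
      also have "\<dots> \<le> C * norm h ^ Suc r" by (intro mult_right_mono) (auto simp: C_def)
      finally show ?thesis .
    qed
    hence H: "\<forall>h. norm h < s \<longrightarrow> norm (\<Phi> (P + h) - taylor_polynomial r \<Phi> P h) \<le> C * norm h ^ Suc r" by blast
    show "big_O_p M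
          (\<lambda>n \<omega>. T n \<omega> - (\<phi> P + (\<Sum>j=1..r. taylor_term \<Phi> P n (scaled_error P X n \<omega>) j)))
          (\<lambda>n. real n powr (- (real (r + 1) / 2)))"
      by (rule taylor_big_O_p[OF gaussian finite_dim U rep T ml s(1) H C])
  qed
  have independence: "\<forall>\<Phi>\<^sub>1 \<Phi>\<^sub>2.
        (\<forall>Q\<in>U \<inter> stochastic_matrices. \<Phi>\<^sub>1 Q = \<phi> Q) \<and>
        (\<forall>Q\<in>U \<inter> stochastic_matrices. \<Phi>\<^sub>2 Q = \<phi> Q) \<longrightarrow>
        (\<forall>r\<ge>1. continuously_frechet_differentiable_on r \<Phi>\<^sub>1 U \<and>
                continuously_frechet_differentiable_on r \<Phi>\<^sub>2 U \<longrightarrow>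
           (\<forall>j\<in>{1..r}. \<forall>Hs. length Hs = j \<and> set Hs \<subseteq> tangent_space P \<longrightarrow>
              frechet_differential \<Phi>\<^sub>1 Hs P = frechet_differential \<Phi>\<^sub>2 Hs P)) \<and>
        (\<forall>j\<ge>1.
           (j = 1 \<and> \<Phi>\<^sub>1 differentiable (at P) \<and> \<Phi>\<^sub>2 differentiable (at P)) \<or>
           (\<exists>r\<ge>j. continuously_frechet_differentiable_on r \<Phi>\<^sub>1 U \<and>
                   continuously_frechet_differentiable_on r \<Phi>\<^sub>2 U) \<or>
           (real_analytic_near \<Phi>\<^sub>1 P U \<and> real_analytic_near \<Phi>\<^sub>2 P U) \<longrightarrow>
           (AE \<omega> in M. \<forall>n. mle X n \<omega> \<in> stochastic_matrices \<longrightarrow>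
              frechet_differential \<Phi>\<^sub>1 (replicate j (scaled_error P X n \<omega>)) P =
              frechet_differential \<Phi>\<^sub>2 (replicate j (scaled_error P X n \<omega>)) P) \<and>
           (AE \<omega> in N.
              frechet_differential \<Phi>\<^sub>1 (replicate j (W \<omega>)) P =
              frechet_differential \<Phi>\<^sub>2 (replicate j (W \<omega>)) P))"
  proof (intro allI impI, rule conjI)
    fix f g :: "real^'s^'s \<Rightarrow> 'y"
    assume fg: "(\<forall>Q\<in>U \<inter> stochastic_matrices. f Q = \<phi> Q) \<and> (\<forall>Q\<in>U \<inter> stochastic_matrices. g Q = \<phi> Q)"
    show "\<forall>r\<ge>1. continuously_frechet_differentiable_on r f U \<and> continuously_frechet_differentiable_on r g U \<longrightarrow>
           (\<forall>j\<in>{1..r}. \<forall>Hs. length Hs = j \<and> set Hs \<subseteq> tangent_space P \<longrightarrow>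
              frechet_differential f Hs P = frechet_differential g Hs P)"
    proof (intro allI impI ballI)
      fix r j :: nat and Hs
      assume d: "continuously_frechet_differentiable_on r f U \<and> continuously_frechet_differentiable_on r g U"
        and j: "j \<in> {1..r}" and Hs: "length Hs = j \<and> set Hs \<subseteq> tangent_space P"
      show "frechet_differential f Hs P = frechet_differential g Hs P"
        by (rule frechet_differential_eq_tangential[OF P_stochastic U
              continuously_imp_iterated_differentiable_on[OF conjunct1[OF d]]
              continuously_imp_iterated_differentiable_on[OF conjunct2[OF d]]])
           (use fg j Hs in auto)
    qed
    show "\<forall>j\<ge>1.
           (j = 1 \<and> f differentiable (at P) \<and> g differentiable (at P)) \<or>
           (\<exists>r\<ge>j. continuously_frechet_differentiable_on r f U \<and>
                   continuously_frechet_differentiable_on r g U) \<or>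
           (real_analytic_near f P U \<and> real_analytic_near g P U) \<longrightarrow>
           (AE \<omega> in M. \<forall>n. mle X n \<omega> \<in> stochastic_matrices \<longrightarrow>
              frechet_differential f (replicate j (scaled_error P X n \<omega>)) P =
              frechet_differential g (replicate j (scaled_error P X n \<omega>)) P) \<and>
           (AE \<omega> in N.
              frechet_differential f (replicate j (W \<omega>)) P =
              frechet_differential g (replicate j (W \<omega>)) P)"
    proof (intro allI impI)
      fix j :: nat
      assume smooth: "(j = 1 \<and> f differentiable (at P) \<and> g differentiable (at P)) \<or>
           (\<exists>r\<ge>j. continuously_frechet_differentiable_on r f U \<and>
                   continuously_frechet_differentiable_on r g U) \<or>
           (real_analytic_near f P U \<and> real_analytic_near g P U)"
      note agree = tangential_differentials_agree[OF finite_dim P_stochastic U conjunct1[OF fg] conjunct2[OF fg] smooth]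
      show "(AE \<omega> in M. \<forall>n. mle X n \<omega> \<in> stochastic_matrices \<longrightarrow>
              frechet_differential f (replicate j (scaled_error P X n \<omega>)) P =
              frechet_differential g (replicate j (scaled_error P X n \<omega>)) P) \<and>
           (AE \<omega> in N.
              frechet_differential f (replicate j (W \<omega>)) P =
              frechet_differential g (replicate j (W \<omega>)) P)"
      proof
        show "AE \<omega> in M. \<forall>n. mle X n \<omega> \<in> stochastic_matrices \<longrightarrow>
              frechet_differential f (replicate j (scaled_error P X n \<omega>)) P =
              frechet_differential g (replicate j (scaled_error P X n \<omega>)) P"
          using AE_scaled_error_tangent by eventually_elim (simp add: agree)
        show "AE \<omega> in N. frechet_differential f (replicate j (W \<omega>)) P = frechet_differential g (replicate j (W \<omega>)) P"
          using gaussian_limit_tangent[OF gaussian P_stochastic] by eventually_elim (simp add: agree)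
      qed
    qed
  qed
  show ?thesis
    by (intro conjI consistency first_order expansion independence) (use series series_remainder in blast)
qed

end
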